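(* For each positive integer $k$, $$\pi\,m_k(1+x_1+x_2)=2\int_0^{\pi/6}\rho_k(2\sin\vartheta)\,d\vartheta+2\sum_{j=0}^{k}\binom{k}{j}\int_{\pi/6}^{\pi/2}\rho_j\!\left(\frac{1}{2\sin\vartheta}\right)\log^{k-j}(2\sin\vartheta)\,d\vartheta\in i\,\mathfrak Z_{k+1}(3).$$
   Context: For a nonzero Laurent polynomial $P$ in $n$ variables and a positive integer $k$, $m_k(P)=\int_0^1\cdots\int_0^1\log^k|P(e^{2\pi i t_1},\dots,e^{2\pi i t_n})|\,dt_1\cdots dt_n$. For a vector $\mathbf A=(a_1,\dots,a_d)$ of positive integers (depth $d(\mathbf A)=d$, weight $w(\mathbf A)=\sum a_j$), $L_{\mathbf A}(x)=\sum_{\ell_1>\dots>\ell_d>0}x^{\ell_1}/\prod_{j=1}^d\ell_j^{a_j}$. For $X\in(0,1)$ and integers $n\ge2$, $\rho_n(X)=\frac{(-1)^n n!}{4^n}\sum 4^{d(\mathbf A)}L_{\mathbf A}(X^2)$, the sum over all vectors $\mathbf A$ of positive integers with $w(\mathbf A)=n$, $a_1=2$ and $a_2,\dots,a_{d(\mathbf A)}\in\{1,2\}$; also $\rho_0(X)=1$, $\rho_1(X)=0$. $\mathrm{Li}_{a_1,\dots,a_n}(z_1,\dots,z_n)=\sum_{\ell_1>\dots>\ell_n>0}\prod_j z_j^{\ell_j}/\ell_j^{a_j}$; for integers $k,N\ge1$, $\mathfrak Z_k(N)$ is the $\mathbb Q$-span of all convergent values $\mathrm{Li}_{a_1,\dots,a_n}(z_1,\dots,z_n)$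 with $n\ge1$, $a_j\in\mathbb Z_{>0}$, $z_j^N=1$, $\sum a_j=k$ (convergent iff $(a_1,z_1)\neq(1,1)$); $\mathfrak Z_0(N)=\mathbb Q$. *)

theory Defs
  imports "HOL-Analysis.Analysis" "HOL-Library.Poly_Mapping"
begin

text \<open>
  A complex Laurent polynomial in the variables \<open>x\<^sub>i\<close>, \<open>i :: 'n\<close>, is an element of the monoid
  algebra over the exponent vectors \<open>'n \<Rightarrow>\<^sub>0 int\<close>; the ring structure is the convolution
  one of polynomial mappings.
\<close>
type_synonym 'n laurent_poly = "('n \<Rightarrow>\<^sub>0 int) \<Rightarrow>\<^sub>0 complex"

definition laurent_var :: "'n \<Rightarrow> 'n laurent_poly"
  where "laurent_var i = Poly_Mapping.single (Poly_Mapping.single i 1) 1"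

definition laurent_eval :: "'n::finite laurent_poly \<Rightarrow> ('n \<Rightarrow> complex) \<Rightarrow> complex"
  where "laurent_eval P z =
    (\<Sum>e\<in>Poly_Mapping.keys P. Poly_Mapping.lookup P e *
      (\<Prod>i\<in>UNIV. z i powi Poly_Mapping.lookup e i))"

text \<open>
  The zeros of \<open>P\<close>, where \<open>ln 0 = 0\<close> by convention, form a null set for \<open>P \<noteq> 0\<close>.
\<close>
definition mahler :: "nat \<Rightarrow> 'n::finite laurent_poly \<Rightarrow> real"
  where "mahler k P =
    (\<integral>t. (ln (norm (laurent_eval P (\<lambda>i. exp (2 * of_real pi * \<i> * of_real (t i)))))) ^ k
      \<partial>(\<Pi>\<^sub>M i\<in>(UNIV :: 'n set). restrict_space lborel {0..1}))"

definition desc_tuples :: "nat \<Rightarrow> nat list set"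
  where "desc_tuples d = {l. length l = d \<and> sorted_wrt (>) l \<and> 0 \<notin> set l}"

text \<open>
  An unordered sum of nonnegative terms for \<open>x \<ge> 0\<close>; it converges for \<open>0 \<le> x < 1\<close>,
  and also at \<open>x = 1\<close> if \<open>hd A \<ge> 2\<close>.
\<close>
definition multi_L :: "nat list \<Rightarrow> real \<Rightarrow> real"
  where "multi_L A x =
    (\<Sum>\<^sub>\<infinity>l\<in>desc_tuples (length A). x ^ hd l / (\<Prod>j<length A. real (l ! j) ^ (A ! j)))"

definition rho_indices :: "nat \<Rightarrow> nat list set"
  where "rho_indices n = {A. sum_list A = n \<and> A \<noteq> [] \<and> hd A = 2 \<and> set (tl A) \<subseteq> {1, 2}}"

definition rho :: "nat \<Rightarrow> real \<Rightarrow> real"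
  where "rho n X =
    (if n = 0 then 1
     else if n = 1 then 0
     else (-1) ^ n * fact n / 4 ^ n * (\<Sum>A\<in>rho_indices n. 4 ^ length A * multi_L A (X\<^sup>2)))"

text \<open>
  For roots of unity the series may converge only conditionally (when \<open>a\<^sub>1 = 1\<close>), so its value is
  the limit of the partial sums over \<open>M \<ge> l\<^sub>1 > \<dots> > l\<^sub>n > 0\<close>.
\<close>
definition multi_Li :: "nat list \<Rightarrow> complex list \<Rightarrow> complex"
  where "multi_Li a z =
    lim (\<lambda>M. \<Sum>l\<in>{l \<in> desc_tuples (length a). set l \<subseteq> {..M}}.
      \<Prod>j<length a. (z ! j) ^ (l ! j) / of_nat (l ! j) ^ (a ! j))"

text \<open>
  The condition \<open>(hd a, hd z) \<noteq> (1, 1)\<close> is the convergence criterion for the series.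
\<close>
definition MPL_values :: "nat \<Rightarrow> nat \<Rightarrow> complex set"
  where "MPL_values k N = {multi_Li a z | a z.
    a \<noteq> [] \<and> length z = length a \<and> 0 \<notin> set a \<and> (\<forall>w\<in>set z. w ^ N = 1) \<and>
    sum_list a = k \<and> (hd a, hd z) \<noteq> (1, 1)}"

definition MPL_space :: "nat \<Rightarrow> nat \<Rightarrow> complex set"
  where "MPL_space k N =
    (if k = 0 then \<rat>
     else module.span (\<lambda>(q::rat) (w::complex). of_rat q * w) (MPL_values k N))"

lemma vector_space_rat_complex: "vector_space (\<lambda>(q::rat) (w::complex). of_rat q * w)"
  by unfold_locales (simp_all add: algebra_simps of_rat_add of_rat_mult)

end

theory Submission
  imports Defs "HOL-Complex_Analysis.Complex_Analysis"
begin

text \<open>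
  Integrating over one variable reduces the Mahler measure to the means of \<open>ln |1 + a e(t)| ^ k\<close>,
  \<open>|a| < 1\<close>. Parseval's identity for the powers of \<open>ln (1 + z)\<close> evaluates them: the coefficients of
  \<open>ln (1 + z) ^ j / j!\<close> are the coefficients of \<open>s ^ j\<close> in the binomials \<open>C(s, n)\<close>, and the
  coefficient of \<open>s ^ k\<close> in \<open>C(s, n) ^ 2\<close> is the weighted sum over words in 1 and 2 that defines
  \<open>rho k\<close>.

  For the membership, \<open>z = 4 sin^2 \<theta> = (1 - w)^2 / (1 + w + w^2)\<close> with \<open>0 < w < 1\<close> turns the forms
  \<open>dlog z\<close> and \<open>dlog (1 - z)\<close>, which generate the functions \<open>L_A (z)\<close>, into rational combinations
  of \<open>dw / (w - \<alpha>)\<close> with \<open>\<alpha> = 0\<close> or \<open>\<alpha> ^ 3 = 1\<close>. In the second integral \<open>1 / (4 sin^2 \<theta>) = q (1 - q)\<close>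
  with \<open>q\<close> on the line \<open>Re q = 1/2\<close>, and the integrand is the imaginary part of a holomorphic form
  \<open>Q(q) dq / q\<close> that is real on the segment from \<open>1/2\<close> to \<open>1\<close>. Hence the line can be replaced by
  the arc of \<open>|q| = 1\<close> from \<open>e^(-i pi/3)\<close> to \<open>1\<close>, on which
  \<open>q (1 - q) = (w - 1) (w - \<omega>) / (w - \<omega>^2)^2\<close> with \<open>\<omega> = e^(2 i pi/3)\<close> and \<open>0 < w < 1\<close> again.

  In both cases the powers of \<open>log z\<close> are iterated integrals from \<open>w = 0\<close> and \<open>L_A (z)\<close> is an
  iterated integral from \<open>w = 1\<close>, so their product with \<open>dlog ((w - \<omega>^2) / (w - \<omega>))\<close> integrates to a
  single concatenated iterated integral from 0 to 1. It converges at both ends, so no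
  regularisation is needed, and expanding it in powers of \<open>w\<close> gives multiple polylogarithms at
  cube roots of unity.
\<close>

section \<open>Abel summation\<close>

text \<open>Why one parameter serves both integrals: put Y = e^(2 i \<theta>) and c = e^(i pi/3). On
  the first path z = -(1 - Y)^2 / Y and 1 - z = (Y - c) (Y - 1/c) / Y; on the arc q = 1/Y, z = q (1
  - q) and 1 - z = (q - c) (q - 1/c). So all zeros and poles of z and 1 - z lie among Y = 0,
  infinity, 1, c, 1/c, and the Moebius map w = (c - Y) / (c Y - 1) sends these points, in this
  order, to \<omega>^2, \<omega>, 1, 0, infinity. It turns dY / Y = 2 i d\<theta> into dlog ((w -
  \<omega>^2) / (w - \<omega>)), which is the origin of the factor i. The obstacle is convergence.
  Since z = 1 at w = 0 and z = 0 at w = 1, the form dlog z has a pole at 1 but none at 0, dlog (1 -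
  z) has one at 0 but none at 1, and the form coming from d\<theta> is regular at both. The
  concatenated word therefore has admissible letters at its two ends. The functions met on the way
  may still diverge at an end; in each integration by parts a zero of the other factor outweighs
  that divergence, so every boundary term vanishes.\<close>

lemma null_coeff_powser_bound:
  fixes c :: "nat \<Rightarrow> complex"
  assumes c: "c \<longlonglongrightarrow> 0" and e: "e > 0"
  shows "\<exists>C\<ge>0. \<forall>z. norm z < 1 \<longrightarrow> norm (suminf (\<lambda>n. c n * z ^ n)) \<le> C + e / (1 - norm z)"
proof -
  have "Bseq c" using c convergentI convergent_imp_Bseq by blast
  then obtain B where B: "B > 0" "\<And>n. norm (c n) \<le> B" by (auto simp: Bseq_def)
  obtain N where N: "\<And>n. n \<ge> N \<Longrightarrow> norm (c n) < e"
    using c e by (metis (no_types, lifting) LIMSEQ_iff diff_zero)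
  \<comment> \<open>The first \<open>N\<close> coefficients contribute at most \<open>N * B\<close>,
    the others at most \<open>e\<close> times a geometric series. Only \<open>norm z\<close> enters,
    so the bound holds for every direction in which \<open>z\<close> approaches the unit
    circle.\<close>
  have "norm (suminf (\<lambda>n. c n * z ^ n)) \<le> real N * B + e / (1 - norm z)" if z: "norm z < 1" for z
  proof -
    have smc: "summable (\<lambda>n. norm (c n) * norm z ^ n)"
    proof (rule summable_comparison_test')
      show "summable (\<lambda>n. B * norm z ^ n)"
        using z by (intro summable_mult summable_geometric) auto
      show "norm (norm (c n) * norm z ^ n) \<le> B * norm z ^ n" for n
        using B by (simp add: mult_right_mono)
    qed
    have "norm (suminf (\<lambda>n. c n * z ^ n)) \<le> (suminf (\<lambda>n. norm (c n) * norm z ^ n))"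
      using smc by (intro summable_norm[THEN order_trans] suminf_le)
        (auto simp: norm_mult norm_power)
    also have "\<dots> \<le> (suminf (\<lambda>n. (if n < N then B else 0) + e * norm z ^ n))"
    proof (rule suminf_le)
      show "norm (c n) * norm z ^ n \<le> (if n < N then B else 0) + e * norm z ^ n" for n
      proof (cases "n < N")
        case True
        have "norm (c n) * norm z ^ n \<le> B * 1"
          using B z by (intro mult_mono) (auto simp: power_le_one)
        thus ?thesis using True e by (auto intro: add_increasing2)
      next
        case False
        thus ?thesis using N[of n] by (auto intro!: mult_right_mono)
      qed
      show "summable (\<lambda>n. (if n < N then B else 0) + e * norm z ^ n)"
        using z by (intro summable_add summable_mult summable_geometric summable_finite[of "{..<N}"]) auto
    qed (rule smc)
    also have "\<dots> = (suminf (\<lambda>n. (if n < N then B else 0))) + (suminf (\<lambda>n. e * norm z ^ n))"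
      using z by (intro suminf_add[symmetric] summable_mult summable_geometric summable_finite[of "{..<N}"]) auto
    also have "(suminf (\<lambda>n. (if n < N then B else 0))) = (\<Sum>n<N. B)"
      by (subst suminf_finite[of "{..<N}"]) auto
    also have "(suminf (\<lambda>n. e * norm z ^ n)) = e / (1 - norm z)"
      using z by (subst suminf_mult) (auto simp: suminf_geometric)
    finally show ?thesis by simp
  qed
  thus ?thesis using B by (intro exI[of _ "real N * B"]) auto
qed

lemma abel_mean_tendsto_0:
  fixes c :: "nat \<Rightarrow> complex"
  assumes c: "c \<longlonglongrightarrow> 0"
  shows "((\<lambda>t::real. of_real (1 - t) * suminf (\<lambda>n. c n * of_real t ^ n)) \<longlongrightarrow> 0) (at_left 1)"
proof (rule tendstoI)
  fix e :: real assume e: "e > 0"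
  obtain C where C: "\<And>z. norm z < 1 \<Longrightarrow> norm (suminf (\<lambda>n. c n * z ^ n)) \<le> C + (e / 2) / (1 - norm z)"
    using null_coeff_powser_bound[OF c, of "e / 2"] e by auto
  have "((\<lambda>t::real. (1 - t) * C + e / 2) \<longlongrightarrow> (1 - 1) * C + e / 2) (at_left 1)"
    by (intro tendsto_intros)
  hence "eventually (\<lambda>t::real. (1 - t) * C + e / 2 < e) (at_left 1)"
    by (rule order_tendstoD(2)) (use e in simp)
  moreover have "eventually (\<lambda>t::real. t \<in> {0<..<1}) (at_left 1)"
    by (rule eventually_at_left_real) simp
  ultimately show "\<forall>\<^sub>F t::real in at_left 1. dist (of_real (1 - t) * suminf (\<lambda>n. c n * of_real t ^ n)) 0 < e"
  proof eventually_elim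
    case (elim t)
    hence t: "0 < t" "t < 1" by auto
    have "(1 - t) * norm (suminf (\<lambda>n. c n * of_real t ^ n)) \<le> (1 - t) * (C + (e / 2) / (1 - t))"
      using t C[of "of_real t"] by (intro mult_left_mono) auto
    also have "\<dots> = (1 - t) * C + e / 2"
      using t by (simp add: field_simps)
    also have "\<dots> < e" using elim by simp
    finally show ?case using t by (simp add: norm_mult del: of_real_diff)
  qed
qed

text \<open>Summation by parts: with \<open>S n\<close> the partial sum minus \<open>s\<close>, the
  power series is \<open>s\<close> plus \<open>1 - t\<close> times the series of
  \<open>S n * t ^ n\<close>, and that mean of a null sequence vanishes. Only
  \<open>b sums s\<close> is assumed because words with leading exponent 1 converge
  conditionally.\<close>

lemma abel_limit:
  fixes b :: "nat \<Rightarrow> complex"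
  assumes b: "b sums s"
  shows "((\<lambda>t::real. (suminf (\<lambda>n. b n * of_real t ^ n))) \<longlongrightarrow> s) (at_left 1)"
proof -
  define S where "S n = (\<Sum>m\<le>n. b m) - s" for n
  have S: "S \<longlonglongrightarrow> 0"
  proof -
    have "(\<lambda>n. (\<Sum>m\<le>n. b m) - s) \<longlonglongrightarrow> s - s"
      using b by (intro tendsto_intros) (simp add: sums_def_le)
    thus ?thesis by (simp add: S_def[abs_def])
  qed
  obtain B where B: "\<And>n. norm (S n) \<le> B"
    using S by (meson Bseq_def convergentI convergent_imp_Bseq)
  have eq: "(suminf (\<lambda>n. b n * of_real t ^ n)) = s + of_real (1 - t) * (suminf (\<lambda>n. S n * of_real t ^ n))"
    if t: "0 < t" "t < 1" for t :: real
  proof -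
    have tn: "norm (of_real t :: complex) < 1" using t by simp
    have smS: "summable (\<lambda>n. S n * of_real t ^ n)"
    proof (rule summable_comparison_test')
      show "summable (\<lambda>n. B * t ^ n)"
        using t by (intro summable_mult summable_geometric) auto
      show "norm (S n * of_real t ^ n) \<le> B * t ^ n" for n
        using t B by (simp add: mult_right_mono norm_mult norm_power)
    qed
    have 1: "(\<lambda>n. S n * of_real t ^ n) sums (suminf (\<lambda>n. S n * of_real t ^ n))"
      using smS by blast
    have 2: "(\<lambda>n. s * of_real t ^ n) sums (s * (1 / (1 - of_real t)))"
      by (intro sums_mult geometric_sums tn)
    define P where "P n = (\<Sum>m\<le>n. b m) * of_real t ^ n" for n
    have 3: "P sums ((suminf (\<lambda>n. S n * of_real t ^ n)) + s * (1 / (1 - of_real t)))"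
      using sums_add[OF 1 2] by (simp add: S_def P_def[abs_def] algebra_simps)
    have 4: "(\<lambda>n. of_real t * P n) sums (of_real t * ((suminf (\<lambda>n. S n * of_real t ^ n)) + s * (1 / (1 - of_real t))))"
      using 3 by (rule sums_mult)
    \<comment> \<open>Multiplying the series of partial sums by \<open>t\<close> shifts it by one
      index; subtracting the shifted series leaves the terms \<open>b n * t ^ n\<close>.\<close>
    have 5: "(\<lambda>n. if n = 0 then 0 else of_real t * P (n - 1)) sums
        (of_real t * ((suminf (\<lambda>n. S n * of_real t ^ n)) + s * (1 / (1 - of_real t))))"
      using sums_Suc[of "\<lambda>n. if n = 0 then 0 else of_real t * P (n - 1)"] 4 by simp
    have "(\<lambda>n. P n - (if n = 0 then 0 else of_real t * P (n - 1))) sums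
       (((suminf (\<lambda>n. S n * of_real t ^ n)) + s * (1 / (1 - of_real t))) - 
        (of_real t * ((suminf (\<lambda>n. S n * of_real t ^ n)) + s * (1 / (1 - of_real t)))))"
      by (intro sums_diff 3 5)
    also have "(\<lambda>n. P n - (if n = 0 then 0 else of_real t * P (n - 1))) = (\<lambda>n. b n * of_real t ^ n)"
    proof
      show "P n - (if n = 0 then 0 else of_real t * P (n - 1)) = b n * of_real t ^ n" for n
        by (cases n) (auto simp: P_def algebra_simps)
    qed
    also have "((suminf (\<lambda>n. S n * of_real t ^ n)) + s * (1 / (1 - of_real t))) - 
        (of_real t * ((suminf (\<lambda>n. S n * of_real t ^ n)) + s * (1 / (1 - of_real t)))) =
        s + of_real (1 - t) * (suminf (\<lambda>n. S n * of_real t ^ n))"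
    proof -
      have "1 - (of_real t :: complex) \<noteq> 0" using t
        by (metis less_irrefl of_real_eq_1_iff right_minus_eq)
      hence *: "s * (1 / (1 - of_real t)) - of_real t * (s * (1 / (1 - of_real t))) = s"
        by (simp add: divide_simps) (simp add: algebra_simps)
      have "(A + K) - x * (A + K) = s + (1 - x) * A" if "K - x * K = s" for A K x :: complex
        unfolding that[symmetric] by (simp add: algebra_simps)
      from this[OF *] show ?thesis by simp
    qed
    finally show ?thesis by (simp add: sums_iff)
  qed
  have "((\<lambda>t::real. of_real (1 - t) * (suminf (\<lambda>n. S n * of_real t ^ n))) \<longlongrightarrow> 0) (at_left 1)"
    by (rule abel_mean_tendsto_0[OF S])
  hence "((\<lambda>t::real. s + of_real (1 - t) * (suminf (\<lambda>n. S n * of_real t ^ n))) \<longlongrightarrow> s + 0) (at_left 1)"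
    by (intro tendsto_intros)
  moreover have "eventually (\<lambda>t::real. t \<in> {0<..<1}) (at_left 1)"
    by (rule eventually_at_left_real) simp
  hence "\<forall>\<^sub>F t in at_left 1. s + of_real (1 - t) * (suminf (\<lambda>n. S n * of_real t ^ n)) = (suminf (\<lambda>n. b n * of_real t ^ n))"
    by eventually_elim (use eq in auto)
  ultimately show ?thesis
    by (auto elim: Lim_transform_eventually)
qed

section \<open>Nested sums and polylogarithms\<close>

text \<open>\<open>nested_term ps n\<close> collects the part of the nested sum with leading index
  \<open>n\<close>. The empty word is concentrated at index 0, below all genuine indices, so that
  the inner sum over \<open>m < n\<close> equals 1 for every \<open>n > 0\<close> when a single
  letter is left; nonempty words vanish at 0.\<close>

fun nested_term :: "(nat \<times> complex) list \<Rightarrow> nat \<Rightarrow> complex" where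
  "nested_term [] n = (if n = 0 then 1 else 0)"
| "nested_term ((a, y) # ps) n = y ^ n / of_nat n ^ a * (\<Sum>m<n. nested_term ps m)"

text \<open>Only the leading index carries \<open>z\<close>, so differentiation acts on the head of
  the word, as for an iterated integral.\<close>

definition polylog :: "(nat \<times> complex) list \<Rightarrow> complex \<Rightarrow> complex"
  where "polylog ps z = suminf (\<lambda>n. nested_term ps n * z ^ n)"

definition unimodular :: "(nat \<times> complex) list \<Rightarrow> bool"
  where "unimodular ps \<longleftrightarrow> (\<forall>(a, y)\<in>set ps. a > 0 \<and> norm y = 1)"

lemma unimodular_simps [simp]:
  "unimodular []" "unimodular ((a, y) # ps) \<longleftrightarrow> a > 0 \<and> norm y = 1 \<and> unimodular ps"
  by (auto simp: unimodular_def)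

lemma nested_term_0 [simp]: "ps \<noteq> [] \<Longrightarrow> nested_term ps 0 = 0"
  by (cases ps) auto

text \<open>Telescoping: \<open>1 / sqrt (n + 1)\<close> is at most
  \<open>2 * sqrt (n + 1) - 2 * sqrt n\<close>. The term \<open>m = 0\<close> is 0 because division
  by zero gives 0.\<close>

lemma sum_inverse_sqrt_le: "(\<Sum>m<n. 1 / sqrt (real m)) \<le> 2 * sqrt (real n)"
proof -
  have "(\<Sum>m<Suc n. 1 / sqrt (real m)) \<le> 2 * sqrt (real n)" for n
  proof (induction n)
    case (Suc n)
    have "2 * sqrt (real n) * sqrt (real (Suc n)) \<le> 2 * real n + 1"
    proof -
      have "sqrt (real n) * sqrt (real (Suc n)) \<le> (real n + real (Suc n)) / 2"
        using arith_geo_mean_sqrt[of "real n" "real (Suc n)"] by (simp add: real_sqrt_mult)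
      thus ?thesis by (simp add: field_simps)
    qed
    hence "1 \<le> (2 * sqrt (real (Suc n)) - 2 * sqrt (real n)) * sqrt (real (Suc n))"
      by (simp add: algebra_simps)
    hence "1 / sqrt (real (Suc n)) \<le> 2 * sqrt (real (Suc n)) - 2 * sqrt (real n)"
      by (simp add: pos_divide_le_eq)
    with Suc show ?case by simp
  qed simp
  from this[of n] show ?thesis
    by (simp add: sum.lessThan_Suc) (smt (verit) divide_nonneg_nonneg of_nat_0_le_iff real_sqrt_ge_0_iff)
qed

text \<open>The square root stands in for the powers of the logarithm that nested harmonic sums
  really produce. It is stable under prepending a letter: dividing by at least \<open>n\<close>
  turns \<open>sqrt n\<close> into \<open>1 / sqrt n\<close>, whose partial sums are again of order
  \<open>sqrt n\<close>.\<close>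

lemma sum_norm_nested_term_le:
  assumes "unimodular ps"
  shows "\<exists>C\<ge>0. \<forall>n. (\<Sum>m<n. norm (nested_term ps m)) \<le> C * sqrt (real n)"
  using assms
proof (induction ps)
  case Nil
  have "(\<Sum>m<n. norm (nested_term [] m)) \<le> 1 * sqrt (real n)" for n
    by (cases n) (auto simp: if_distrib sum.delta cong: if_cong)
  thus ?case by (intro exI[of _ 1]) auto
next
  case (Cons p ps)
  obtain a y where p: "p = (a, y)" by (cases p)
  with Cons obtain C where C: "C \<ge> 0" "\<And>n. (\<Sum>m<n. norm (nested_term ps m)) \<le> C * sqrt (real n)"
    and a: "a > 0" "norm y = 1" by auto
  have *: "norm (nested_term (p # ps) n) \<le> C * (1 / sqrt (real n))" for n
  proof (cases "n = 0")
    case False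
    have "norm (nested_term (p # ps) n) = norm (\<Sum>m<n. nested_term ps m) / real n ^ a"
      using a by (simp add: p norm_mult norm_divide norm_power)
    also have "\<dots> \<le> (C * sqrt (real n)) / real n ^ 1"
      using False a C by (intro frac_le power_increasing order_trans[OF norm_sum C(2)]) auto
    also have "\<dots> = C * (1 / sqrt (real n))"
      using False by (simp add: field_simps)
    finally show ?thesis .
  qed simp
  have "(\<Sum>m<n. norm (nested_term (p # ps) m)) \<le> (2 * C) * sqrt (real n)" for n
  proof -
    have "(\<Sum>m<n. norm (nested_term (p # ps) m)) \<le> (\<Sum>m<n. C * (1 / sqrt (real m)))"
      by (intro sum_mono *)
    also have "\<dots> \<le> C * (2 * sqrt (real n))"
      unfolding sum_distrib_left[symmetric] using C sum_inverse_sqrt_le by (intro mult_left_mono)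
    finally show ?thesis by simp
  qed
  thus ?case using C by (intro exI[of _ "2 * C"]) auto
qed

lemma norm_nested_term_le:
  assumes "unimodular ((a, y) # ps)"
  shows "\<exists>C\<ge>0. \<forall>n. norm (nested_term ((a, y) # ps) n) \<le> C * sqrt (real n) / real n ^ a"
proof -
  obtain C where C: "C \<ge> 0" "\<And>n. (\<Sum>m<n. norm (nested_term ps m)) \<le> C * sqrt (real n)"
    using sum_norm_nested_term_le[of ps] assms by auto
  have "norm (nested_term ((a, y) # ps) n) \<le> C * sqrt (real n) / real n ^ a" for n
    using assms order_trans[OF norm_sum C(2)] 
    by (auto simp: norm_mult norm_divide norm_power intro!: divide_right_mono)
  thus ?thesis using C by blast
qed

lemma nested_term_tendsto_0:
  assumes "unimodular ps" "ps \<noteq> []"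
  shows "nested_term ps \<longlonglongrightarrow> 0"
proof -
  obtain a y qs where ps: "ps = (a, y) # qs" using assms by (metis neq_Nil_conv surj_pair)
  obtain C where C: "C \<ge> 0" "\<And>n. norm (nested_term ps n) \<le> C * sqrt (real n) / real n ^ a"
    using norm_nested_term_le[of a y qs] assms by (auto simp: ps)
  have "norm (nested_term ps n) \<le> C * (1 / sqrt (real n))" for n
  proof (cases "n = 0")
    case False
    have "norm (nested_term ps n) \<le> C * sqrt (real n) / real n ^ a" by (rule C)
    also have "\<dots> \<le> C * sqrt (real n) / real n ^ 1"
      using False assms C by (intro frac_le power_increasing) (auto simp: ps)
    also have "\<dots> = C * (1 / sqrt (real n))"
      using False by (simp add: field_simps)
    finally show ?thesis .
  qed (use assms in auto)
  moreover have "(\<lambda>n. C * (1 / sqrt (real n))) \<longlonglongrightarrow> C * 0"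
    by (intro tendsto_intros tendsto_divide_0[OF tendsto_const] filterlim_at_top_imp_at_infinity
          filterlim_compose[OF sqrt_at_top] filterlim_real_sequentially)
  ultimately show ?thesis
    by (intro Lim_null_comparison[where f = "nested_term ps" and g = "\<lambda>n. C * (1 / sqrt (real n))"]) auto
qed

lemma nested_term_bounded:
  assumes "unimodular ps"
  shows "\<exists>C. \<forall>n. norm (nested_term ps n) \<le> C"
proof (cases "ps = []")
  case True
  thus ?thesis by (intro exI[of _ 1]) auto
next
  case False
  hence "Bseq (nested_term ps)"
    using nested_term_tendsto_0[OF assms] convergentI convergent_imp_Bseq by blast
  thus ?thesis by (auto simp: Bseq_def)
qed

lemma summable_norm_bounded_coeff_power:
  fixes c :: "nat \<Rightarrow> complex"
  assumes "\<And>n. norm (c n) \<le> C" "norm z < 1"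
  shows "summable (\<lambda>n. norm (c n * z ^ n))"
proof (rule summable_comparison_test')
  show "summable (\<lambda>n. C * norm z ^ n)"
    using assms by (intro summable_mult summable_geometric) auto
  show "norm (norm (c n * z ^ n)) \<le> C * norm z ^ n" for n
    using assms(1) by (simp add: norm_mult norm_power mult_right_mono)
qed

lemma summable_norm_polylog:
  assumes "unimodular ps" "norm z < 1"
  shows "summable (\<lambda>n. norm (nested_term ps n * z ^ n))"
proof -
  obtain C where "\<And>n. norm (nested_term ps n) \<le> C"
    using nested_term_bounded[OF assms(1)] by auto
  thus ?thesis using assms(2) by (rule summable_norm_bounded_coeff_power)
qed

lemma polylog_sums:
  assumes "unimodular ps" "norm z < 1"
  shows "(\<lambda>n. nested_term ps n * z ^ n) sums polylog ps z"
  unfolding polylog_def using summable_norm_polylog[OF assms]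
  by (rule summable_sums[OF summable_norm_cancel])

lemma polylog_Nil [simp]: "polylog [] z = 1"
  unfolding polylog_def by (subst suminf_finite[of "{0}"]) auto

lemma polylog_0 [simp]: "ps \<noteq> [] \<Longrightarrow> polylog ps 0 = 0"
  unfolding polylog_def by (subst suminf_finite[of "{0}"]) auto

text \<open>Since only the leading index carries the variable, rescaling the argument of a
  polylogarithm by \<open>x\<close> amounts to multiplying the first root by
  \<open>x\<close>.\<close>

fun twist :: "complex \<Rightarrow> (nat \<times> complex) list \<Rightarrow> (nat \<times> complex) list" where
  "twist x [] = []"
| "twist x ((a, y) # ps) = (a, x * y) # ps"

lemma nested_term_twist: "nested_term (twist x ps) n = x ^ n * nested_term ps n"
  by (cases "(x, ps)" rule: twist.cases) (auto simp: power_mult_distrib)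

lemma polylog_twist: "polylog (twist x ps) z = polylog ps (x * z)"
  by (simp add: polylog_def nested_term_twist power_mult_distrib mult_ac)

lemma has_field_derivative_polylog:
  assumes "unimodular ps" "norm z < 1"
  shows "(polylog ps has_field_derivative (suminf (\<lambda>n. diffs (nested_term ps) n * z ^ n))) (at z)"
  unfolding polylog_def[abs_def]
proof (rule termdiffs_strong'[where K = 1])
  show "summable (\<lambda>n. nested_term ps n * w ^ n)" if "norm w < 1" for w
    by (rule summable_norm_cancel) (rule summable_norm_polylog[OF assms(1) that])
qed (rule assms)

lemma has_field_derivative_polylog_Suc:
  assumes "unimodular ((a, y) # ps)" "norm z < 1" "z \<noteq> 0"
  shows "(polylog ((Suc a, y) # ps) has_field_derivative polylog ((a, y) # ps) z / z) (at z)"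
proof -
  have "diffs (nested_term ((Suc a, y) # ps)) n = nested_term ((a, y) # ps) (Suc n)" for n
    by (simp add: diffs_def field_simps del: of_nat_Suc)
  moreover have "(\<lambda>n. nested_term ((a, y) # ps) (Suc n) * z ^ Suc n) sums polylog ((a, y) # ps) z"
    using polylog_sums[OF assms(1,2)] by (subst sums_Suc_iff) simp
  hence "(\<lambda>n. nested_term ((a, y) # ps) (Suc n) * z ^ Suc n / z) sums (polylog ((a, y) # ps) z / z)"
    by (rule sums_divide)
  ultimately have "(suminf (\<lambda>n. diffs (nested_term ((Suc a, y) # ps)) n * z ^ n)) = polylog ((a, y) # ps) z / z"
    using assms(3) by (simp add: sums_iff del: nested_term.simps)
  moreover have "unimodular ((Suc a, y) # ps)" using assms by simp
  ultimately show ?thesis using has_field_derivative_polylog assms(2) by metis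
qed

text \<open>Multiplying by the geometric series \<open>1 / (1 - y * z)\<close> forms partial sums of
  coefficients, and these partial sums are what the letter \<open>(1, y)\<close> leaves after
  differentiation. The argument becomes \<open>y * z\<close> because \<open>y\<close> is attached to
  the leading index.\<close>

lemma has_field_derivative_polylog_1:
  assumes "unimodular ps" "norm y = 1" "norm z < 1"
  shows "(polylog ((1, y) # ps) has_field_derivative y / (1 - y * z) * polylog ps (y * z)) (at z)"
proof -
  have yz: "norm (y * z) < 1" using assms by (simp add: norm_mult)
  have "(\<lambda>k. \<Sum>i\<le>k. nested_term ps i * (y * z) ^ i * (y * z) ^ (k - i)) sums
        ((suminf (\<lambda>n. nested_term ps n * (y * z) ^ n)) * (suminf (\<lambda>n. (y * z) ^ n)))"
    using yz by (intro Cauchy_product_sums summable_norm_polylog assms)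
      (auto simp: norm_power intro!: summable_geometric)
  also have "(\<lambda>k. \<Sum>i\<le>k. nested_term ps i * (y * z) ^ i * (y * z) ^ (k - i)) =
      (\<lambda>k. (y * z) ^ k * (\<Sum>i\<le>k. nested_term ps i))"
    unfolding sum_distrib_left
    by (intro ext sum.cong) (auto simp: mult_ac simp flip: power_add)
  finally have "(\<lambda>k. y * ((y * z) ^ k * (\<Sum>i\<le>k. nested_term ps i))) sums
      (y * (polylog ps (y * z) * (1 / (1 - y * z))))"
    using yz by (intro sums_mult) (simp add: suminf_geometric polylog_def)
  moreover have "diffs (nested_term ((1, y) # ps)) n * z ^ n = y * ((y * z) ^ n * (\<Sum>i\<le>n. nested_term ps i))" for n
    by (simp add: diffs_def field_simps power_mult_distrib lessThan_Suc_atMost del: of_nat_Suc)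
  ultimately have "(suminf (\<lambda>n. diffs (nested_term ((1, y) # ps)) n * z ^ n)) = y / (1 - y * z) * polylog ps (y * z)"
    by (simp add: sums_iff mult_ac del: nested_term.simps)
  moreover have "unimodular ((1, y) # ps)" using assms by simp
  ultimately show ?thesis using has_field_derivative_polylog assms(3) by metis
qed

text \<open>Summation by parts: \<open>y ^ Suc n * (b (Suc n) - b n)\<close> minus the telescoping
  difference of \<open>y ^ n * b n\<close> is \<open>(1 - y) * (y ^ n * b n)\<close>, and
  \<open>1 - y\<close> can be cancelled.\<close>

lemma summable_dirichlet_unit:
  fixes b :: "nat \<Rightarrow> complex"
  assumes "norm y = 1" "y \<noteq> 1" "b \<longlonglongrightarrow> 0" "summable (\<lambda>n. norm (b (Suc n) - b n))"
  shows "summable (\<lambda>n. y ^ n * b n)"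
proof -
  have "summable (\<lambda>n. y ^ Suc n * (b (Suc n) - b n))"
    using assms by (intro summable_norm_cancel[of "\<lambda>n. y ^ Suc n * (b (Suc n) - b n)"])
      (simp add: norm_mult norm_power)
  moreover have "(\<lambda>n. y ^ n * b n) \<longlonglongrightarrow> 0"
    using assms by (intro tendsto_norm_zero_cancel[of "\<lambda>n. y ^ n * b n"]) (simp add: norm_mult norm_power tendsto_norm_zero)
  hence "summable (\<lambda>n. y ^ Suc n * b (Suc n) - y ^ n * b n)"
    by (rule telescope_summable)
  ultimately have "summable (\<lambda>n. y ^ Suc n * (b (Suc n) - b n) - (y ^ Suc n * b (Suc n) - y ^ n * b n))"
    by (rule summable_diff)
  hence "summable (\<lambda>n. (1 - y) * (y ^ n * b n))"
    by (rule summable_cong[THEN iffD1, rotated]) (auto simp: algebra_simps)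
  thus ?thesis using assms(2) by simp
qed

lemma summable_sqrt_div_sq: "summable (\<lambda>n. sqrt (real n) / real n ^ 2)"
proof -
  have "summable (\<lambda>n. real n powr (-3/2))" by (simp add: summable_real_powr_iff)
  moreover have "real n powr (-3/2) = sqrt (real n) / real n ^ 2" for n
  proof (cases "n = 0")
    case False
    have "real n powr (-3/2) = real n powr (1/2 - 2)" by simp
    also have "\<dots> = sqrt (real n) / real n ^ 2"
      using False by (subst powr_diff) (simp add: powr_half_sqrt powr_numeral)
    finally show ?thesis .
  qed auto
  ultimately show ?thesis by simp
qed

lemma summable_norm_nested_term:
  assumes "unimodular ((a, y) # ps)" "a \<ge> 2"
  shows "summable (\<lambda>n. norm (nested_term ((a, y) # ps) n))"
proof -
  obtain C where C: "C \<ge> 0" "\<And>n. norm (nested_term ((a, y) # ps) n) \<le> C * sqrt (real n) / real n ^ a"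
    using norm_nested_term_le[OF assms(1)] by auto
  show ?thesis
  proof (rule summable_comparison_test')
    show "summable (\<lambda>n. C * (sqrt (real n) / real n ^ 2))"
      by (intro summable_mult summable_sqrt_div_sq)
    show "norm (norm (nested_term ((a, y) # ps) n)) \<le> C * (sqrt (real n) / real n ^ 2)" if "n \<ge> 1" for n
    proof -
      have "norm (nested_term ((a, y) # ps) n) \<le> C * sqrt (real n) / real n ^ a" by (rule C)
      also have "\<dots> \<le> C * sqrt (real n) / real n ^ 2"
        using that assms C by (intro frac_le power_increasing) auto
      finally show ?thesis by simp
    qed
  qed
qed

text \<open>A leading exponent of at least 2 gives terms of order \<open>n ^ (-3/2)\<close> and
  absolute convergence. For leading exponent 1 the leading root differs from 1, and the Dirichlet
  test applies because \<open>T n / n\<close> is a null sequence of bounded variation.\<close>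

lemma summable_nested_term:
  assumes "unimodular ps" "ps \<noteq> []" "hd ps \<noteq> (1, 1)"
  shows "summable (nested_term ps)"
proof -
  obtain a y qs where ps: "ps = (a, y) # qs" using assms by (metis neq_Nil_conv surj_pair)
  show ?thesis
  proof (cases "a \<ge> 2")
    case True
    thus ?thesis using summable_norm_nested_term[of a y qs] assms ps summable_norm_cancel by blast
  next
    case False
    hence a: "a = 1" and y: "norm y = 1" "y \<noteq> 1" and um: "unimodular qs" using assms by (auto simp: ps)
    define T where "T n = (\<Sum>m<n. nested_term qs m)" for n
    obtain C where C: "C \<ge> 0" "\<And>n. (\<Sum>m<n. norm (nested_term qs m)) \<le> C * sqrt (real n)"
      using sum_norm_nested_term_le[OF um] by auto
    have T: "norm (T n) \<le> C * sqrt (real n)" for n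
      unfolding T_def by (rule order_trans[OF norm_sum C(2)])
    \<comment> \<open>An empty tail has no coefficient at \<open>n \<ge> 1\<close>, so 0 serves;
      otherwise its leading exponent is at least 1 and the square root estimate applies.\<close>
    obtain C' where C': "C' \<ge> 0" "\<And>n. n \<ge> 1 \<Longrightarrow> norm (nested_term qs n) \<le> C' / sqrt (real n)"
    proof (cases qs)
      case Nil
      thus ?thesis using that[of 0] by auto
    next
      case (Cons p ps')
      obtain b x where p: "p = (b, x)" by (cases p)
      obtain C' where C': "C' \<ge> 0" "\<And>n. norm (nested_term qs n) \<le> C' * sqrt (real n) / real n ^ b"
        using norm_nested_term_le[of b x ps'] um Cons p by auto
      have "norm (nested_term qs n) \<le> C' / sqrt (real n)" if "n \<ge> 1" for n
      proof -
        have "norm (nested_term qs n) \<le> C' * sqrt (real n) / real n ^ b" by (rule C')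
        also have "\<dots> \<le> C' * sqrt (real n) / real n ^ 1"
          using that um C' Cons p by (intro frac_le power_increasing) auto
        also have "\<dots> = C' / sqrt (real n)" using that by (simp add: field_simps)
        finally show ?thesis .
      qed
      thus ?thesis using that[of C'] C' by blast
    qed
    have "summable (\<lambda>n. y ^ n * (T n / of_nat n))"
    proof (rule summable_dirichlet_unit[OF y])
      have "nested_term ((1, 1) # qs) \<longlonglongrightarrow> 0"
        by (rule nested_term_tendsto_0) (use um in auto)
      also have "nested_term ((1, 1) # qs) = (\<lambda>n. T n / of_nat n)"
        by (rule ext) (simp add: T_def)
      finally show "(\<lambda>n. T n / of_nat n) \<longlonglongrightarrow> 0" .
      show "summable (\<lambda>n. norm (T (Suc n) / of_nat (Suc n) - T n / of_nat n))"
      proof (rule summable_comparison_test')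
        show "summable (\<lambda>n. (C' + C) * (sqrt (real n) / real n ^ 2))"
          by (intro summable_mult summable_sqrt_div_sq)
        fix n :: nat assume n: "n \<ge> 1"
        \<comment> \<open>The increment splits into the new term of the partial sum and the change
          of \<open>1 / n\<close>; both are of order \<open>n ^ (-3/2)\<close>.\<close>
        have "T (Suc n) / of_nat (Suc n) - T n / of_nat n =
              nested_term qs n / of_nat (Suc n) - T n / (of_nat n * of_nat (Suc n))"
          using n by (simp add: T_def divide_simps del: of_nat_Suc) (simp add: algebra_simps)
        also have "norm \<dots> \<le> norm (nested_term qs n) / real (Suc n) + norm (T n) / (real n * real (Suc n))"
          by (rule norm_triangle_ineq4[THEN order_trans]) (simp add: norm_divide norm_mult del: of_nat_Suc)
        also have "\<dots> \<le> (C' / sqrt (real n)) / real n + (C * sqrt (real n)) / (real n * real n)"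
          using n C'(2)[OF n] T[of n] C' C by (intro add_mono frac_le) auto
        also have "\<dots> = (C' + C) * (sqrt (real n) / real n ^ 2)"
          using n by (simp add: field_simps power2_eq_square)
        finally show "norm (norm (T (Suc n) / of_nat (Suc n) - T n / of_nat n)) \<le> (C' + C) * (sqrt (real n) / real n ^ 2)"
          by simp
      qed
    qed
    moreover have "nested_term ps = (\<lambda>n. y ^ n * (T n / of_nat n))"
      by (rule ext) (simp add: ps a T_def)
    ultimately show ?thesis by simp
  qed
qed

lemma polylog_tendsto_at_left_1:
  assumes "unimodular ps" "ps \<noteq> []" "hd ps \<noteq> (1, 1)"
  shows "((\<lambda>t::real. polylog ps (of_real t)) \<longlongrightarrow> suminf (nested_term ps)) (at_left 1)"
  unfolding polylog_def by (rule abel_limit) (use summable_nested_term[OF assms] in blast)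

lemma polylog_times_one_minus_tendsto_0:
  assumes "unimodular ps" "ps \<noteq> []"
  shows "((\<lambda>t::real. of_real (1 - t) * polylog ps (of_real t)) \<longlongrightarrow> 0) (at_left 1)"
  unfolding polylog_def by (rule abel_mean_tendsto_0[OF nested_term_tendsto_0[OF assms]])

section \<open>Multiple polylogarithm values\<close>

text \<open>The bound is strict so that, once a leading index \<open>m\<close> is fixed, the
  remaining indices are again exactly a set of this kind, with bound \<open>m\<close>.\<close>

definition bounded_tuples :: "nat \<Rightarrow> nat \<Rightarrow> nat list set"
  where "bounded_tuples d n = {l \<in> desc_tuples d. set l \<subseteq> {..<n}}"

lemma bounded_tuples_0 [simp]: "bounded_tuples 0 n = {[]}"
  by (auto simp: bounded_tuples_def desc_tuples_def)

lemma bounded_tuples_Suc: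
  "bounded_tuples (Suc d) n = (\<Union>m\<in>{1..<n}. (#) m ` bounded_tuples d m)"
proof (intro equalityI subsetI)
  fix l assume l: "l \<in> bounded_tuples (Suc d) n"
  then obtain m k where "l = m # k"
    by (auto simp: bounded_tuples_def desc_tuples_def length_Suc_conv)
  with l show "l \<in> (\<Union>m\<in>{1..<n}. (#) m ` bounded_tuples d m)"
    by (fastforce simp: bounded_tuples_def desc_tuples_def)
next
  fix l assume "l \<in> (\<Union>m\<in>{1..<n}. (#) m ` bounded_tuples d m)"
  then obtain m k where "l = m # k" "m \<ge> 1" "m < n" "k \<in> bounded_tuples d m"
    by auto
  thus "l \<in> bounded_tuples (Suc d) n"
    by (auto simp: bounded_tuples_def desc_tuples_def subset_iff intro: less_trans)
qed

lemma finite_bounded_tuples [simp]: "finite (bounded_tuples d n)"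
  by (induction d arbitrary: n) (auto simp: bounded_tuples_Suc)

lemma sum_bounded_tuples_Suc:
  "(\<Sum>l\<in>bounded_tuples (Suc d) n. f l) = (\<Sum>m=1..<n. \<Sum>l\<in>bounded_tuples d m. f (m # l))"
  unfolding bounded_tuples_Suc
  by (subst sum.UNION_disjoint) (auto simp: sum.reindex intro!: sum.cong)

text \<open>Splitting off the leading index reproduces the recursion of \<open>nested_term\<close>.
  Positivity of \<open>n\<close> serves the empty word: its only tuple contributes 1, which the
  right-hand side places at \<open>m = 0\<close>.\<close>

lemma sum_bounded_tuples_eq_nested_term:
  assumes "length ys = length as" "0 \<notin> set as" "n > 0"
  shows "(\<Sum>l\<in>bounded_tuples (length as) n.
            \<Prod>j<length as. (ys ! j) ^ (l ! j) / of_nat (l ! j) ^ (as ! j)) =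
         (\<Sum>m<n. nested_term (zip as ys) m)"
  using assms
proof (induction as arbitrary: ys n)
  case Nil
  thus ?case by (simp add: sum.delta)
next
  case (Cons a as)
  then obtain y ys' where ys: "ys = y # ys'" by (cases ys) auto
  have a: "a > 0" using Cons by auto
  have "(\<Sum>l\<in>bounded_tuples (length (a # as)) n.
            \<Prod>j<length (a # as). (ys ! j) ^ (l ! j) / of_nat (l ! j) ^ ((a # as) ! j)) =
        (\<Sum>m=1..<n. y ^ m / of_nat m ^ a * (\<Sum>l\<in>bounded_tuples (length as) m.
            \<Prod>j<length as. (ys' ! j) ^ (l ! j) / of_nat (l ! j) ^ (as ! j)))"
    by (simp add: sum_bounded_tuples_Suc ys prod.lessThan_Suc_shift sum_distrib_left del: prod.lessThan_Suc)
  also have "\<dots> = (\<Sum>m=1..<n. nested_term (zip (a # as) ys) m)"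
    using Cons.prems by (intro sum.cong refl) (subst Cons.IH, auto simp: ys)
  also have "\<dots> = (\<Sum>m<n. nested_term (zip (a # as) ys) m)"
    using a by (intro sum.mono_neutral_left) (auto simp: ys)
  finally show ?case .
qed

lemma multi_Li_eq_suminf:
  assumes "length ys = length as" "0 \<notin> set as" "summable (nested_term (zip as ys))"
  shows "multi_Li as ys = suminf (nested_term (zip as ys))"
proof -
  have "(\<lambda>M. \<Sum>l\<in>{l \<in> desc_tuples (length as). set l \<subseteq> {..M}}.
      \<Prod>j<length as. (ys ! j) ^ (l ! j) / of_nat (l ! j) ^ (as ! j)) =
      (\<lambda>M. \<Sum>m<Suc M. nested_term (zip as ys) m)"
  proof
    fix M
    have "{l \<in> desc_tuples (length as). set l \<subseteq> {..M}} = bounded_tuples (length as) (Suc M)"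
      by (simp add: bounded_tuples_def lessThan_Suc_atMost)
    thus "(\<Sum>l\<in>{l \<in> desc_tuples (length as). set l \<subseteq> {..M}}.
      \<Prod>j<length as. (ys ! j) ^ (l ! j) / of_nat (l ! j) ^ (as ! j)) =
      (\<Sum>m<Suc M. nested_term (zip as ys) m)"
      using sum_bounded_tuples_eq_nested_term[OF assms(1,2), of "Suc M"] by simp
  qed
  moreover have "(\<lambda>M. \<Sum>m<Suc M. nested_term (zip as ys) m) \<longlonglongrightarrow> suminf (nested_term (zip as ys))"
    using summable_LIMSEQ[OF assms(3)] by (rule LIMSEQ_Suc)
  ultimately show ?thesis unfolding multi_Li_def by (simp add: limI)
qed

definition ones :: "nat list \<Rightarrow> (nat \<times> complex) list"
  where "ones A = map (\<lambda>a. (a, 1)) A"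

lemma ones_simps [simp]:
  "ones [] = []" "ones (a # A) = (a, 1) # ones A" "ones A = [] \<longleftrightarrow> A = []"
  by (auto simp: ones_def)

lemma unimodular_ones [simp]: "unimodular (ones A) \<longleftrightarrow> 0 \<notin> set A"
  by (induction A) auto

lemma zip_replicate_ones: "zip A (replicate (length A) 1) = ones A"
  by (induction A) auto

text \<open>Bridges the unordered sum in \<open>multi_L\<close> and the ordered power series: for
  nonnegative terms, a limit along one increasing exhaustion by finite sets already determines the
  unordered sum.\<close>

lemma has_sum_nonneg_exhaustion:
  fixes f :: "'a \<Rightarrow> real"
  assumes nonneg: "\<And>x. x \<in> S \<Longrightarrow> f x \<ge> 0" and F: "\<And>n. finite (F n)" "mono F" "(\<Union>n. F n) = S"
    and lim: "(\<lambda>n. sum f (F n)) \<longlonglongrightarrow> s"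
  shows "(f has_sum s) S"
proof -
  have FS: "F n \<subseteq> S" for n using F by auto
  have ex: "\<exists>n. X \<subseteq> F n" if "finite X" "X \<subseteq> S" for X
    using that
  proof (induction X)
    case (insert x X)
    then obtain n m where "X \<subseteq> F n" "x \<in> F m" using F by auto
    hence "insert x X \<subseteq> F (max n m)"
      using F(2) by (auto simp: mono_def dest!: spec[of _ "max n m"]) (metis max.cobounded1 max.cobounded2 monoD F(2) subsetD)+
    thus ?case by blast
  qed auto
  have bd: "sum f (F n) \<le> s" for n
  proof (rule incseq_le[OF _ lim], unfold incseq_def, safe)
    fix m n :: nat assume "m \<le> n"
    thus "sum f (F m) \<le> sum f (F n)"
      using FS[of n] nonneg by (intro sum_mono2 F monoD[OF F(2)]) auto
  qed
  have "f summable_on S"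
  proof (rule nonneg_bdd_above_summable_on[OF nonneg])
    show "bdd_above (sum f ` {F. F \<subseteq> S \<and> finite F})"
    proof (rule bdd_aboveI[of _ s])
      fix x assume "x \<in> sum f ` {F. F \<subseteq> S \<and> finite F}"
      then obtain X where X: "X \<subseteq> S" "finite X" "x = sum f X" by auto
      then obtain n where "X \<subseteq> F n" using ex by blast
      hence "sum f X \<le> sum f (F n)" using F(1) FS[of n] nonneg by (intro sum_mono2) auto
      thus "x \<le> s" using bd[of n] X by simp
    qed
  qed
  hence hs: "(f has_sum infsum f S) S" by simp
  have "filterlim F (finite_subsets_at_top S) sequentially"
    unfolding filterlim_iff eventually_finite_subsets_at_top
  proof safe
    fix P X assume X: "finite X" "X \<subseteq> S" and P: "\<forall>Y. finite Y \<and> X \<subseteq> Y \<and> Y \<subseteq> S \<longrightarrow> P Y"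
    then obtain n where n: "X \<subseteq> F n" using ex by blast
    have "X \<subseteq> F m" if "m \<ge> n" for m using n F(2) that by (auto simp: mono_def)
    thus "\<forall>\<^sub>F x in sequentially. P (F x)"
      using P F FS by (intro eventually_sequentiallyI[of n]) auto
  qed
  hence "(\<lambda>n. sum f (F n)) \<longlonglongrightarrow> infsum f S"
    using hs unfolding has_sum_def by (rule filterlim_compose[rotated])
  with lim have "infsum f S = s" using LIMSEQ_unique by blast
  with hs show ?thesis by simp
qed

lemma multi_L_eq_polylog:
  assumes "A \<noteq> []" "0 \<notin> set A" "0 \<le> x" "x < 1"
  shows "complex_of_real (multi_L A x) = polylog (ones A) (of_real x)"
proof -
  define g where "g l = x ^ hd l / (\<Prod>j<length A. real (l ! j) ^ (A ! j))" for l
  \<comment> \<open>The power of \<open>x\<close> involves the leading index only, so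
    \<open>x\<close> is placed as the argument of the first letter and all other arguments are
    1.\<close>
  define ys where "ys = complex_of_real x # replicate (length A - 1) 1"
  obtain a A' where A: "A = a # A'" using assms by (cases A) auto
  have zip: "zip A ys = twist (of_real x) (ones A)"
    by (simp add: ys_def A zip_replicate_ones)
  have sum_g: "complex_of_real (sum g (bounded_tuples (length A) n)) =
      (\<Sum>m<n. nested_term (ones A) m * of_real x ^ m)" if "n > 0" for n
  proof -
    have "complex_of_real (sum g (bounded_tuples (length A) n)) =
       (\<Sum>l\<in>bounded_tuples (length A) n. \<Prod>j<length A. (ys ! j) ^ (l ! j) / of_nat (l ! j) ^ (A ! j))"
      unfolding of_real_sum
    proof (rule sum.cong[OF refl])
      fix l assume "l \<in> bounded_tuples (length A) n"
      then obtain m k where l: "l = m # k"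
        by (auto simp: bounded_tuples_def desc_tuples_def A length_Suc_conv)
      have "(\<Prod>j<length A. (ys ! j) ^ (l ! j)) = of_real x ^ m"
        by (simp add: A ys_def l prod.lessThan_Suc_shift del: prod.lessThan_Suc)
      thus "complex_of_real (g l) = (\<Prod>j<length A. (ys ! j) ^ (l ! j) / of_nat (l ! j) ^ (A ! j))"
        by (simp add: g_def l prod_dividef)
    qed
    also have "\<dots> = (\<Sum>m<n. nested_term (zip A ys) m)"
      using assms that by (intro sum_bounded_tuples_eq_nested_term) (auto simp: ys_def A)
    finally show ?thesis by (simp add: zip nested_term_twist mult_ac)
  qed
  have "(\<lambda>n. \<Sum>m<n. nested_term (ones A) m * of_real x ^ m) \<longlonglongrightarrow> polylog (ones A) (of_real x)"
    using polylog_sums[of "ones A" "of_real x"] assms by (simp add: sums_def)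
  hence lim: "(\<lambda>n. complex_of_real (sum g (bounded_tuples (length A) n))) \<longlonglongrightarrow> polylog (ones A) (of_real x)"
    by (rule Lim_transform_eventually) (use eventually_gt_at_top[of 0] in eventually_elim, rule sum_g[symmetric])
  hence "(\<lambda>n. sum g (bounded_tuples (length A) n)) \<longlonglongrightarrow> Re (polylog (ones A) (of_real x))"
    using tendsto_Re by fastforce
  hence "(g has_sum Re (polylog (ones A) (of_real x))) (desc_tuples (length A))"
  proof (rule has_sum_nonneg_exhaustion[rotated -1])
    show "g l \<ge> 0" for l using assms by (auto simp: g_def intro!: divide_nonneg_nonneg prod_nonneg)
    show "mono (bounded_tuples (length A))" by (force simp: mono_def bounded_tuples_def)
    show "(\<Union>n. bounded_tuples (length A) n) = desc_tuples (length A)"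
    proof (intro equalityI subsetI)
      fix l assume "l \<in> desc_tuples (length A)"
      hence "l \<in> bounded_tuples (length A) (Suc (Max (insert 0 (set l))))"
        by (auto simp: bounded_tuples_def less_Suc_eq_le)
      thus "l \<in> (\<Union>n. bounded_tuples (length A) n)" by blast
    qed (auto simp: bounded_tuples_def)
  qed auto
  hence "multi_L A x = Re (polylog (ones A) (of_real x))"
    unfolding multi_L_def g_def by (rule infsumI)
  moreover have "Im (polylog (ones A) (of_real x)) = 0"
  proof -
    have "(\<lambda>n. Im (complex_of_real (sum g (bounded_tuples (length A) n)))) \<longlonglongrightarrow> Im (polylog (ones A) (of_real x))"
      by (rule tendsto_Im[OF lim])
    thus ?thesis by (simp add: LIMSEQ_const_iff)
  qed
  ultimately show ?thesis by (simp add: complex_eq_iff)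
qed

definition cubic_words :: "nat \<Rightarrow> (nat \<times> complex) list set"
  where "cubic_words n = {ps. sum_list (map fst ps) = n \<and> (\<forall>(a, y)\<in>set ps. a > 0 \<and> y ^ 3 = 1)}"

definition convergent_cubic_words :: "nat \<Rightarrow> (nat \<times> complex) list set"
  where "convergent_cubic_words n = {ps \<in> cubic_words n. ps \<noteq> [] \<and> hd ps \<noteq> (1, 1)}"

lemma norm_eq_1_of_cube: "y ^ 3 = 1 \<Longrightarrow> norm (y :: complex) = 1"
proof -
  assume "y ^ 3 = 1"
  hence "norm y ^ 3 = 1" by (metis norm_one norm_power)
  thus ?thesis using power_eq_imp_eq_base[of "norm y" 3 1] by simp
qed

lemma unimodular_cubic_words: "ps \<in> cubic_words n \<Longrightarrow> unimodular ps"
  by (auto simp: cubic_words_def unimodular_def norm_eq_1_of_cube)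

lemma cubic_words_nonempty: "ps \<in> cubic_words n \<Longrightarrow> n > 0 \<Longrightarrow> ps \<noteq> []"
  by (auto simp: cubic_words_def)

lemma module_rat_complex: "module (\<lambda>(q::rat) (w::complex). of_rat q * w)"
  using vector_space_rat_complex by (simp add: module_iff_vector_space)

lemma MPL_space_0 [simp]: "0 \<in> MPL_space n N"
  by (auto simp: MPL_space_def module.span_zero[OF module_rat_complex])

lemma MPL_space_add: "x \<in> MPL_space n N \<Longrightarrow> y \<in> MPL_space n N \<Longrightarrow> x + y \<in> MPL_space n N"
  by (auto simp: MPL_space_def module.span_add[OF module_rat_complex] split: if_splits)

lemma MPL_space_scale: "x \<in> MPL_space n N \<Longrightarrow> of_rat q * x \<in> MPL_space n N"
  using module.span_scale[OF module_rat_complex, of x _ q]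
  by (auto simp: MPL_space_def split: if_splits)

lemma suminf_nested_term_in_MPL_space:
  assumes "ps \<in> convergent_cubic_words n"
  shows "suminf (nested_term ps) \<in> MPL_space n 3"
proof -
  have ps: "ps \<in> cubic_words n" "ps \<noteq> []" "hd ps \<noteq> (1, 1)"
    using assms by (auto simp: convergent_cubic_words_def)
  have n: "n > 0"
    using ps by (cases ps) (auto simp: cubic_words_def)
  define as where "as = map fst ps"
  define ys where "ys = map snd ps"
  have zip: "zip as ys = ps" by (simp add: as_def ys_def zip_map_fst_snd)
  have 0: "0 \<notin> set as" using ps by (force simp: as_def cubic_words_def)
  have "multi_Li as ys = suminf (nested_term ps)"
    using multi_Li_eq_suminf[of ys as] 0 summable_nested_term[OF unimodular_cubic_words] ps
    by (simp add: zip) (simp add: as_def ys_def)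
  moreover have "multi_Li as ys \<in> MPL_values n 3"
    unfolding MPL_values_def mem_Collect_eq
    using ps 0 by (intro exI[of _ as] exI[of _ ys])
      (auto simp: as_def ys_def cubic_words_def hd_map prod_eq_iff)
  ultimately show ?thesis
    using n by (auto simp: MPL_space_def intro!: module.span_base[OF module_rat_complex])
qed

lemma cnj_nested_term: "cnj (nested_term ps n) = nested_term (map (\<lambda>(a, y). (a, cnj y)) ps) n"
  by (induction ps n rule: nested_term.induct) (auto simp: cnj_sum)

text \<open>Conjugation permutes the cube roots of unity, fixes 1 and the rationals, and commutes
  with the nested sums. It is what allows imaginary parts to be taken inside the space.\<close>

lemma MPL_space_cnj:
  assumes "n > 0" "x \<in> MPL_space n 3"
  shows "cnj x \<in> MPL_space n 3"
proof -
  have "x \<in> module.span (\<lambda>(q::rat) (w::complex). of_rat q * w) (MPL_values n 3)"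
    using assms by (simp add: MPL_space_def)
  thus ?thesis
  proof (induction rule: module.span_induct_alt[OF module_rat_complex, consumes 1, case_names base step])
    case (step q x y)
    from step(1) obtain a z where x: "x = multi_Li a z" and az: "a \<noteq> []" "length z = length a" "0 \<notin> set a"
      "\<forall>w\<in>set z. w ^ 3 = 1" "sum_list a = n" "(hd a, hd z) \<noteq> (1, 1)"
      by (auto simp: MPL_values_def)
    define ps where "ps = zip a z"
    have ps: "ps \<in> convergent_cubic_words n"
      using az by (cases a; cases z) 
        (auto simp: convergent_cubic_words_def cubic_words_def ps_def dest: set_zip_leftD set_zip_rightD intro!: Nat.gr0I)
    define qs where "qs = map (\<lambda>(a, y). (a, cnj y)) ps"
    have qs: "qs \<in> convergent_cubic_words n"
      using ps by (cases ps) (auto simp: convergent_cubic_words_def cubic_words_def qs_def o_def case_prod_beta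
          simp flip: complex_cnj_power)
    have sm: "summable (nested_term ps)"
      using ps by (intro summable_nested_term unimodular_cubic_words[of _ n]) (auto simp: convergent_cubic_words_def)
    have "x = suminf (nested_term ps)"
      unfolding x ps_def using az sm by (intro multi_Li_eq_suminf) (auto simp: ps_def)
    hence "cnj x = suminf (nested_term qs)"
      using sums_cnj[of "nested_term ps" "suminf (nested_term ps)"] sm
      by (auto simp: cnj_nested_term qs_def[symmetric] sums_iff)
    hence "cnj x \<in> MPL_space n 3" using suminf_nested_term_in_MPL_space[OF qs] by simp
    moreover have "cnj (of_rat q) = of_rat q" by (cases q) (simp add: of_rat_rat)
    ultimately show ?case using step by (simp add: MPL_space_add MPL_space_scale)
  qed simp
qed

section \<open>Spans of polylogarithms at cube roots of unity\<close>

text \<open>Rational linear combinations, kept as functions together with a derivation that adds one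
  word at a time. Primitives, limits and bounds for the whole span then follow by induction from the
  case of a single word.\<close>

inductive polylog_span :: "(nat \<times> complex) list set \<Rightarrow> (complex \<Rightarrow> complex) \<Rightarrow> bool"
  for W :: "(nat \<times> complex) list set" where
  zero: "polylog_span W (\<lambda>_. 0)"
| step: "ps \<in> W \<Longrightarrow> polylog_span W h \<Longrightarrow> polylog_span W (\<lambda>z. of_rat q * polylog ps z + h z)"

lemma polylog_span_add:
  assumes "polylog_span W f" "polylog_span W g"
  shows "polylog_span W (\<lambda>z. f z + g z)"
  using assms by induction (auto simp: add.assoc intro: polylog_span.step)

lemma polylog_span_scale:
  assumes "polylog_span W f"
  shows "polylog_span W (\<lambda>z. of_rat r * f z)"
  using assms
proof induction
  case (step ps h q)
  from polylog_span.step[OF step(1) step.IH, of "r * q"] show ?case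
    by (simp add: algebra_simps of_rat_mult)
qed (auto intro: polylog_span.zero)

lemma polylog_span_mono: "polylog_span W f \<Longrightarrow> W \<subseteq> W' \<Longrightarrow> polylog_span W' f"
  by (induction rule: polylog_span.induct) (auto intro: polylog_span.intros)

lemma polylog_span_base: "ps \<in> W \<Longrightarrow> polylog_span W (polylog ps)"
  using polylog_span.step[OF _ polylog_span.zero, of ps W 1] by simp

lemma convergent_cubic_words_subset: "convergent_cubic_words n \<subseteq> cubic_words n"
  by (auto simp: convergent_cubic_words_def)

lemma twist_cubic_words: "ps \<in> cubic_words n \<Longrightarrow> \<alpha> ^ 3 = 1 \<Longrightarrow> twist \<alpha> ps \<in> cubic_words n"
  by (cases "(\<alpha>, ps)" rule: twist.cases) (auto simp: cubic_words_def power_mult_distrib)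

text \<open>The form \<open>1 / (z - \<alpha>)\<close> is minus the geometric kernel of the letter
  \<open>(1, 1 / \<alpha>)\<close>. Prepending this letter rescales the inner argument by
  \<open>1 / \<alpha>\<close>, which twisting the old head by \<open>\<alpha>\<close> undoes. The
  new head is \<open>(1, 1)\<close>, hence divergent at 1, exactly for
  \<open>\<alpha> = 1\<close>.\<close>

lemma polylog_span_primitive_pole:
  assumes "polylog_span (cubic_words n) h" "\<alpha> ^ 3 = 1"
  obtains H where "polylog_span (if \<alpha> = 1 then cubic_words (Suc n) else convergent_cubic_words (Suc n)) H"
    and "\<And>z. norm z < 1 \<Longrightarrow> (H has_field_derivative h z / (z - \<alpha>)) (at z)"
proof -
  have na: "norm \<alpha> = 1" using assms(2) by (rule norm_eq_1_of_cube)
  hence a0: "\<alpha> \<noteq> 0" by auto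
  let ?W = "if \<alpha> = 1 then cubic_words (Suc n) else convergent_cubic_words (Suc n)"
  have "\<exists>H. polylog_span ?W H \<and> (\<forall>z. norm z < 1 \<longrightarrow> (H has_field_derivative h z / (z - \<alpha>)) (at z))"
    using assms(1)
  proof induction
    case zero
    show ?case by (intro exI[of _ "\<lambda>_. 0"]) (auto intro: polylog_span.zero)
  next
    case (step ps h q)
    then obtain H where H: "polylog_span ?W H" "\<And>z. norm z < 1 \<Longrightarrow> (H has_field_derivative h z / (z - \<alpha>)) (at z)"
      by blast
    define qs where "qs = (1, 1 / \<alpha>) # twist \<alpha> ps"
    have tw: "twist \<alpha> ps \<in> cubic_words n" using twist_cubic_words step assms by blast
    have "qs \<in> ?W"
      using tw assms(2) a0
      by (auto simp: qs_def cubic_words_def convergent_cubic_words_def power_divide)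
    hence "polylog_span ?W (\<lambda>z. of_rat (- q) * polylog qs z + H z)"
      using H by (intro polylog_span.step)
    moreover have "((\<lambda>z. of_rat (- q) * polylog qs z + H z) has_field_derivative
         (of_rat q * polylog ps z + h z) / (z - \<alpha>)) (at z)" if z: "norm z < 1" for z
    proof -
      have za: "z \<noteq> \<alpha>" using z na by auto
      have "(polylog qs has_field_derivative (1 / \<alpha>) / (1 - (1 / \<alpha>) * z) * polylog (twist \<alpha> ps) ((1 / \<alpha>) * z)) (at z)"
        unfolding qs_def
        by (rule has_field_derivative_polylog_1) (use tw unimodular_cubic_words z na in \<open>auto simp: norm_divide\<close>)
      moreover have "(1 / \<alpha>) / (1 - (1 / \<alpha>) * z) * polylog (twist \<alpha> ps) ((1 / \<alpha>) * z) = - (polylog ps z / (z - \<alpha>))"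
        using a0 za by (simp add: polylog_twist divide_simps) (simp add: algebra_simps)
      ultimately have d: "(polylog qs has_field_derivative - (polylog ps z / (z - \<alpha>))) (at z)" by simp
      show ?thesis
        by (rule derivative_eq_intros refl d H z)+ (simp add: of_rat_minus add_divide_distrib)
    qed
    ultimately show ?case by blast
  qed
  thus ?thesis using that by blast
qed

text \<open>Integrating against \<open>1 / z\<close> raises the leading exponent, so the result
  always converges at 1. Positive weight guarantees that there is a leading letter and that
  \<open>h\<close> vanishes at the pole.\<close>

lemma polylog_span_primitive_zero:
  assumes "polylog_span (cubic_words n) h" "n > 0"
  obtains H where "polylog_span (convergent_cubic_words (Suc n)) H"
    and "\<And>z. norm z < 1 \<Longrightarrow> z \<noteq> 0 \<Longrightarrow> (H has_field_derivative h z / z) (at z)"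
proof -
  let ?W = "convergent_cubic_words (Suc n)"
  have "\<exists>H. polylog_span ?W H \<and> (\<forall>z. norm z < 1 \<longrightarrow> z \<noteq> 0 \<longrightarrow> (H has_field_derivative h z / z) (at z))"
    using assms(1)
  proof induction
    case zero
    show ?case by (intro exI[of _ "\<lambda>_. 0"]) (auto intro: polylog_span.zero)
  next
    case (step ps h q)
    then obtain H where H: "polylog_span ?W H" "\<And>z. norm z < 1 \<Longrightarrow> z \<noteq> 0 \<Longrightarrow> (H has_field_derivative h z / z) (at z)"
      by blast
    obtain a y ps' where ps: "ps = (a, y) # ps'"
      using cubic_words_nonempty[OF step(1) assms(2)] by (metis neq_Nil_conv surj_pair)
    define qs where "qs = (Suc a, y) # ps'"
    have "qs \<in> ?W"
      using step(1) by (auto simp: qs_def ps cubic_words_def convergent_cubic_words_def)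
    hence "polylog_span ?W (\<lambda>z. of_rat q * polylog qs z + H z)"
      using H by (intro polylog_span.step)
    moreover have "((\<lambda>z. of_rat q * polylog qs z + H z) has_field_derivative
         (of_rat q * polylog ps z + h z) / z) (at z)" if z: "norm z < 1" "z \<noteq> 0" for z
    proof -
      have d: "(polylog qs has_field_derivative polylog ps z / z) (at z)"
        unfolding qs_def ps
        by (rule has_field_derivative_polylog_Suc)
          (use unimodular_cubic_words[OF step(1)] ps z in auto)
      show ?thesis
        by (rule derivative_eq_intros refl d H z)+ (simp add: add_divide_distrib)
    qed
    ultimately show ?case by blast
  qed
  thus ?thesis using that by blast
qed

lemma polylog_span_at_0:
  assumes "polylog_span (cubic_words n) h" "n > 0"
  shows "h 0 = 0"
  using assms by (induction rule: polylog_span.induct) (auto dest: cubic_words_nonempty)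

lemma polylog_span_differentiable:
  assumes "polylog_span (cubic_words n) h" "norm z < 1"
  shows "h field_differentiable (at z)"
  using assms
proof (induction rule: polylog_span.induct)
  case (step ps h q)
  have "polylog ps field_differentiable (at z)"
    using has_field_derivative_polylog[OF unimodular_cubic_words[OF step(1)]] step.prems
    by (auto simp: field_differentiable_def)
  thus ?case using step by (intro derivative_intros) auto
qed auto

lemma polylog_span_convergent_tendsto:
  assumes "polylog_span (convergent_cubic_words n) h"
  obtains c where "c \<in> MPL_space n 3" "((\<lambda>t::real. h (of_real t)) \<longlongrightarrow> c) (at_left 1)"
proof -
  have "\<exists>c. c \<in> MPL_space n 3 \<and> ((\<lambda>t::real. h (of_real t)) \<longlongrightarrow> c) (at_left 1)"
    using assms
  proof induction
    case zero
    thus ?case by (intro exI[of _ 0]) auto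
  next
    case (step ps h q)
    then obtain c where c: "c \<in> MPL_space n 3" "((\<lambda>t::real. h (of_real t)) \<longlongrightarrow> c) (at_left 1)" by blast
    have "((\<lambda>t::real. polylog ps (of_real t)) \<longlongrightarrow> suminf (nested_term ps)) (at_left 1)"
      using step(1) by (intro polylog_tendsto_at_left_1 unimodular_cubic_words[of _ n])
        (auto simp: convergent_cubic_words_def)
    hence "((\<lambda>t::real. of_rat q * polylog ps (of_real t) + h (of_real t)) \<longlongrightarrow>
              of_rat q * suminf (nested_term ps) + c) (at_left 1)"
      by (intro tendsto_intros c)
    moreover have "of_rat q * suminf (nested_term ps) + c \<in> MPL_space n 3"
      by (intro MPL_space_add MPL_space_scale c suminf_nested_term_in_MPL_space step)
    ultimately show ?case by blast
  qed
  thus ?thesis using that by blast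
qed

lemma polylog_span_times_one_minus_tendsto:
  assumes "polylog_span (cubic_words n) h" "n > 0"
  shows "((\<lambda>t::real. of_real (1 - t) * h (of_real t)) \<longlongrightarrow> 0) (at_left 1)"
  using assms
proof induction
  case (step ps h q)
  have "((\<lambda>t::real. of_real (1 - t) * polylog ps (of_real t)) \<longlongrightarrow> 0) (at_left 1)"
    using step cubic_words_nonempty by (intro polylog_times_one_minus_tendsto_0 unimodular_cubic_words[of _ n]) auto
  hence "((\<lambda>t::real. of_rat q * (of_real (1 - t) * polylog ps (of_real t)) + of_real (1 - t) * h (of_real t)) \<longlongrightarrow> of_rat q * 0 + 0) (at_left 1)"
    using step by (intro tendsto_intros) auto
  thus ?case by (simp add: algebra_simps)
qed auto

text \<open>A nonempty word has no coefficient at index 0. The factor \<open>norm z\<close> gained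
  from this is the zero that outweighs divergent factors in the boundary terms.\<close>

lemma norm_polylog_le:
  assumes "unimodular ps" "ps \<noteq> []"
  shows "\<exists>B\<ge>0. \<forall>z. norm z < 1 \<longrightarrow> norm (polylog ps z) \<le> B * norm z / (1 - norm z)"
proof -
  obtain B where B: "\<And>n. norm (nested_term ps n) \<le> B"
    using nested_term_bounded[OF assms(1)] by auto
  have B0: "B \<ge> 0" using B[of 0] norm_ge_zero order_trans by blast
  have "norm (polylog ps z) \<le> B * norm z / (1 - norm z)" if z: "norm z < 1" for z
  proof -
    have "(\<lambda>n. nested_term ps (Suc n) * z ^ Suc n) sums polylog ps z"
      using polylog_sums[OF assms(1) z] assms(2) by (subst sums_Suc_iff) simp
    moreover have "(\<lambda>n. (B * norm z) * norm z ^ n) sums ((B * norm z) * (1 / (1 - norm z)))"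
      using z by (intro sums_mult geometric_sums) simp
    moreover have "norm (nested_term ps (Suc n) * z ^ Suc n) \<le> (B * norm z) * norm z ^ n" for n
      using mult_right_mono[OF B[of "Suc n"], of "norm z ^ Suc n"]
      by (simp add: norm_mult norm_power mult_ac)
    ultimately have "norm (polylog ps z) \<le> (B * norm z) * (1 / (1 - norm z))"
      by (rule norm_sums_le)
    thus ?thesis by simp
  qed
  thus ?thesis using B0 by blast
qed

lemma polylog_span_bound_near_0:
  assumes "polylog_span (cubic_words n) h" "n > 0"
  shows "\<exists>B\<ge>0. \<forall>z. norm z < 1 \<longrightarrow> norm (h z) \<le> B * norm z / (1 - norm z)"
  using assms
proof induction
  case zero
  thus ?case by (intro exI[of _ 0]) auto
next
  case (step ps h q)
  obtain B where B: "B \<ge> 0" "\<And>z. norm z < 1 \<Longrightarrow> norm (h z) \<le> B * norm z / (1 - norm z)"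
    using step by blast
  obtain B' where B': "B' \<ge> 0" "\<And>z. norm z < 1 \<Longrightarrow> norm (polylog ps z) \<le> B' * norm z / (1 - norm z)"
    using norm_polylog_le[of ps] unimodular_cubic_words step cubic_words_nonempty by blast
  have "norm (of_rat q * polylog ps z + h z) \<le> (norm (of_rat q :: complex) * B' + B) * norm z / (1 - norm z)"
    if z: "norm z < 1" for z
  proof -
    have "norm (of_rat q * polylog ps z + h z) \<le> norm (of_rat q :: complex) * norm (polylog ps z) + norm (h z)"
      by (metis norm_mult norm_triangle_ineq)
    also have "\<dots> \<le> norm (of_rat q :: complex) * (B' * norm z / (1 - norm z)) + B * norm z / (1 - norm z)"
      using B(2)[OF z] B'(2)[OF z] by (intro add_mono mult_left_mono) auto
    also have "\<dots> = (norm (of_rat q :: complex) * B' + B) * norm z / (1 - norm z)"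
      by (simp add: add_divide_distrib algebra_simps)
    finally show ?thesis .
  qed
  thus ?case using B B' by (intro exI[of _ "norm (of_rat q :: complex) * B' + B"]) auto
qed

definition omega :: complex where "omega = Complex (- 1 / 2) (sqrt 3 / 2)"

lemma omega_sq: "omega ^ 2 = Complex (- 1 / 2) (- sqrt 3 / 2)"
  by (simp add: omega_def power2_eq_square complex_eq_iff field_simps)

lemma omega_cube: "omega ^ 3 = 1"
proof -
  have "omega ^ 3 = omega ^ 2 * omega" by (simp add: power3_eq_cube power2_eq_square)
  thus ?thesis by (simp add: omega_sq) (simp add: omega_def complex_eq_iff field_simps)
qed

lemma omega_sq_cube: "(omega ^ 2) ^ 3 = 1"
  by (metis omega_cube power_commutes power_mult mult.commute power_one)

lemma omega_ne_1: "omega \<noteq> 1" "omega ^ 2 \<noteq> 1"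
  by (simp_all add: omega_sq, simp_all add: omega_def complex_eq_iff)

definition pole_form :: "rat \<Rightarrow> rat \<Rightarrow> rat \<Rightarrow> complex \<Rightarrow> complex"
  where "pole_form a b c z = of_rat a / (z - 1) + of_rat b / (z - omega) + of_rat c / (z - omega ^ 2)"

text \<open>While \<open>pole_form\<close> has the shape of dlog Z, this is the shape of -dlog (1 -
  Z) for a path along which 1 - Z has a simple zero at 0: residue -1 at 0, and no pole at 1.\<close>

definition zero_form :: "rat \<Rightarrow> rat \<Rightarrow> complex \<Rightarrow> complex"
  where "zero_form b c z = - 1 / z + of_rat b / (z - omega) + of_rat c / (z - omega ^ 2)"

text \<open>Of the three poles only the one at 1 can produce a head \<open>(1, 1)\<close>, so
  convergence at 1 is decided by whether \<open>a\<close> vanishes.\<close>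

lemma polylog_span_primitive_form:
  assumes h: "polylog_span (cubic_words n) h"
  obtains H where "polylog_span (if a = 0 then convergent_cubic_words (Suc n) else cubic_words (Suc n)) H"
    and "\<And>z. norm z < 1 \<Longrightarrow> (H has_field_derivative
           h z * pole_form a b c z) (at z)"
proof -
  obtain A where A: "polylog_span (cubic_words (Suc n)) A"
    "\<And>z. norm z < 1 \<Longrightarrow> (A has_field_derivative h z / (z - 1)) (at z)"
    using polylog_span_primitive_pole[OF h, of 1] by auto
  obtain B where B: "polylog_span (convergent_cubic_words (Suc n)) B"
    "\<And>z. norm z < 1 \<Longrightarrow> (B has_field_derivative h z / (z - omega)) (at z)"
    using polylog_span_primitive_pole[OF h omega_cube] omega_ne_1 by auto
  obtain C where C: "polylog_span (convergent_cubic_words (Suc n)) C"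
    "\<And>z. norm z < 1 \<Longrightarrow> (C has_field_derivative h z / (z - omega ^ 2)) (at z)"
    using polylog_span_primitive_pole[OF h omega_sq_cube] omega_ne_1 by auto
  define G where "G z = of_rat b * B z + of_rat c * C z" for z
  have G: "polylog_span (convergent_cubic_words (Suc n)) G"
    unfolding G_def by (intro polylog_span_add polylog_span_scale B C)
  define H where "H z = of_rat a * A z + G z" for z
  have "polylog_span (if a = 0 then convergent_cubic_words (Suc n) else cubic_words (Suc n)) H"
  proof (cases "a = 0")
    case True
    thus ?thesis using G by (simp add: H_def[abs_def])
  next
    case False
    have "polylog_span (cubic_words (Suc n)) H"
      unfolding H_def
      by (intro polylog_span_add polylog_span_scale A polylog_span_mono[OF G convergent_cubic_words_subset])
    thus ?thesis using False by simp
  qed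
  moreover have "(H has_field_derivative
           h z * pole_form a b c z) (at z)"
    if "norm z < 1" for z
    unfolding H_def G_def
    by (rule derivative_eq_intros refl A B C that)+ (simp add: algebra_simps pole_form_def)
  ultimately show ?thesis using that by blast
qed

lemma polylog_span_primitive_form_zero:
  assumes h: "polylog_span (cubic_words n) h" "n > 0"
  obtains H where "polylog_span (convergent_cubic_words (Suc n)) H"
    and "\<And>z. norm z < 1 \<Longrightarrow> z \<noteq> 0 \<Longrightarrow> (H has_field_derivative
           h z * zero_form b c z) (at z)"
proof -
  obtain A where A: "polylog_span (convergent_cubic_words (Suc n)) A"
    "\<And>z. norm z < 1 \<Longrightarrow> z \<noteq> 0 \<Longrightarrow> (A has_field_derivative h z / z) (at z)"
    using polylog_span_primitive_zero[OF h] by auto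
  obtain G where G: "polylog_span (convergent_cubic_words (Suc n)) G"
    "\<And>z. norm z < 1 \<Longrightarrow> (G has_field_derivative
           h z * pole_form 0 b c z) (at z)"
    using polylog_span_primitive_form[OF h(1), of 0 b c] by auto
  define H where "H z = of_rat (- 1) * A z + G z" for z
  have "polylog_span (convergent_cubic_words (Suc n)) H"
    unfolding H_def by (intro polylog_span_add polylog_span_scale A G)
  moreover have "(H has_field_derivative
           h z * zero_form b c z) (at z)"
    if "norm z < 1" "z \<noteq> 0" for z
    unfolding H_def
    by (rule derivative_eq_intros refl A G that)+ (simp add: algebra_simps pole_form_def zero_form_def)
  ultimately show ?thesis using that by blast
qed

section \<open>Integration by parts along a path in the unit disc\<close>

text \<open>\<open>Z\<close> is the argument z as a function of w. Its derivative is recorded twice,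
  through dlog Z and through -dlog (1 - Z), since these are the two letters of the polylogarithms in
  \<open>Z\<close>. The constant \<open>K\<close> fixes the rates at the ends: \<open>Z\<close>
  vanishes at least linearly at \<open>t = 1\<close>, and near \<open>t = 0\<close> its distance
  from the unit circle is at least of order \<open>t\<close>.\<close>

locale cubic_path =
  fixes Z :: "complex \<Rightarrow> complex" and a1 a2 a3 b2 b3 :: rat and K :: real
  assumes deriv_Z: "\<And>t::real. 0 < t \<Longrightarrow> t < 1 \<Longrightarrow> (Z has_field_derivative
      Z t * pole_form a1 a2 a3 t) (at (of_real t))"
    and deriv_Z': "\<And>t::real. 0 < t \<Longrightarrow> t < 1 \<Longrightarrow> (Z has_field_derivative
      (1 - Z t) * zero_form b2 b3 t) (at (of_real t))"
    and Z_nonzero: "\<And>t::real. 0 < t \<Longrightarrow> t < 1 \<Longrightarrow> Z t \<noteq> 0"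
    and norm_Z_less: "\<And>t::real. 0 < t \<Longrightarrow> t < 1 \<Longrightarrow> norm (Z t) < 1"
    and norm_Z_le: "\<And>t::real. 0 < t \<Longrightarrow> t < 1 \<Longrightarrow> norm (Z t) \<le> K * (1 - t)"
    and one_minus_norm_Z_ge: "\<And>t::real. 0 < t \<Longrightarrow> t < 1 \<Longrightarrow> t \<le> K * (1 - norm (Z t))"
begin

lemma K_pos: "K > 0"
proof -
  have "0 < K * (1 - norm (Z (of_real (1 / 2))))"
    by (rule less_le_trans[OF _ one_minus_norm_Z_ge]) auto
  moreover have "0 < 1 - norm (Z (of_real (1 / 2)))"
    using norm_Z_less[of "1 / 2"] by simp
  ultimately show ?thesis using zero_less_mult_pos2 by blast
qed

text \<open>\<open>h\<close> may diverge at 1, but \<open>(1 - t) * h t\<close> tends to 0; the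
  polylogarithm has a zero at \<open>Z = 0\<close> and is therefore of order
  \<open>1 - t\<close>.\<close>

lemma boundary_at_left_1:
  assumes "polylog_span (cubic_words n) h" "n > 0" "A \<noteq> []" "0 \<notin> set A"
  shows "((\<lambda>t::real. h t * polylog (ones A) (Z t)) \<longlongrightarrow> 0) (at_left 1)"
proof -
  obtain B where B: "B \<ge> 0" "\<And>z. norm z < 1 \<Longrightarrow> norm (polylog (ones A) z) \<le> B * norm z / (1 - norm z)"
    using norm_polylog_le[of "ones A"] assms by auto
  have "((\<lambda>t::real. of_real (1 - t) * h (of_real t)) \<longlongrightarrow> 0) (at_left 1)"
    by (rule polylog_span_times_one_minus_tendsto[OF assms(1,2)])
  hence "((\<lambda>t::real. norm (of_real (1 - t) * h (of_real t)) * (B * K * K / t)) \<longlongrightarrow> 0 * (B * K * K / 1)) (at_left 1)"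
    by (intro tendsto_intros tendsto_norm_zero) auto
  hence lim: "((\<lambda>t::real. norm (of_real (1 - t) * h (of_real t)) * (B * K * K / t)) \<longlongrightarrow> 0) (at_left 1)"
    by simp
  have "eventually (\<lambda>t::real. t \<in> {0<..<1}) (at_left 1)"
    by (rule eventually_at_left_real) simp
  hence "\<forall>\<^sub>F t in at_left 1. norm (h (of_real t) * polylog (ones A) (Z t)) \<le> 
           norm (of_real (1 - t) * h (of_real t)) * (B * K * K / t)"
  proof eventually_elim
    case (elim t)
    hence t: "0 < t" "t < 1" by auto
    have pos: "1 - norm (Z t) > 0" using norm_Z_less[OF t] by simp
    have "norm (polylog (ones A) (Z t)) \<le> B * norm (Z t) / (1 - norm (Z t))"
      by (rule B(2)[OF norm_Z_less[OF t]])
    also have "\<dots> \<le> B * (K * (1 - t)) / (t / K)"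
      using one_minus_norm_Z_ge[OF t] t K_pos B norm_Z_le[OF t] pos
      by (intro frac_le mult_left_mono) (auto simp: pos_divide_le_eq mult.commute)
    also have "\<dots> = (1 - t) * (B * K * K / t)" using K_pos t by (simp add: field_simps)
    finally have "norm (h (of_real t)) * norm (polylog (ones A) (Z t)) \<le> norm (h (of_real t)) * ((1 - t) * (B * K * K / t))"
      by (intro mult_left_mono) auto
    thus ?case using t by (simp add: norm_mult mult_ac del: of_real_diff)
  qed
  thus ?thesis using lim by (rule Lim_null_comparison)
qed

text \<open>The roles are exchanged: \<open>h\<close> is of order \<open>t\<close>, whereas the
  polylogarithm is only o(1 / (1 - norm (Z t))), hence o(1 / t). The coefficients being a null
  sequence, and not merely bounded, is what makes the product vanish.\<close>

lemma boundary_at_right_0: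
  assumes "polylog_span (cubic_words n) h" "n > 0" "A \<noteq> []" "0 \<notin> set A"
  shows "((\<lambda>t::real. h t * polylog (ones A) (Z t)) \<longlongrightarrow> 0) (at_right 0)"
proof (rule tendstoI)
  fix e :: real assume e: "e > 0"
  obtain B where B: "B \<ge> 0" "\<And>z. norm z < 1 \<Longrightarrow> norm (h z) \<le> B * norm z / (1 - norm z)"
    using polylog_span_bound_near_0[OF assms(1,2)] by auto
  \<comment> \<open>The limit of the bound below is \<open>B * \<epsilon> * K\<close>, which this
    choice keeps below \<open>e\<close>; the summand 1 keeps the denominator positive when
    \<open>B = 0\<close>.\<close>
  define \<epsilon> where "\<epsilon> = e / (2 * (B * K + 1))"
  have \<epsilon>: "\<epsilon> > 0" using e B K_pos by (auto simp: \<epsilon>_def intro!: divide_pos_pos add_nonneg_pos)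
  have um: "unimodular (ones A)" "ones A \<noteq> []" using assms by auto
  obtain C where C: "C \<ge> 0" "\<And>z. norm z < 1 \<Longrightarrow> norm (polylog (ones A) z) \<le> C + \<epsilon> / (1 - norm z)"
    using null_coeff_powser_bound[OF nested_term_tendsto_0[OF um] \<epsilon>] by (auto simp: polylog_def)
  have "((\<lambda>t::real. B / (1 - t) * (t * C + \<epsilon> * K)) \<longlongrightarrow> B / (1 - 0) * (0 * C + \<epsilon> * K)) (at_right 0)"
    by (intro tendsto_intros) auto
  moreover have "B / (1 - 0) * (0 * C + \<epsilon> * K) < e"
  proof -
    have "B * K < 2 * (B * K + 1)" using B K_pos by (smt (verit) mult_nonneg_nonneg)
    hence "e * (B * K) < e * (2 * (B * K + 1))" using e by simp
    moreover have "2 * (B * K + 1) > 0" using B K_pos by (auto intro!: add_nonneg_pos)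
    ultimately have "e * (B * K) / (2 * (B * K + 1)) < e" by (simp add: pos_divide_less_eq)
    thus ?thesis by (simp add: \<epsilon>_def mult_ac)
  qed
  ultimately have "\<forall>\<^sub>F t in at_right (0::real). B / (1 - t) * (t * C + \<epsilon> * K) < e"
    by (rule order_tendstoD(2))
  moreover have "eventually (\<lambda>t::real. t \<in> {0<..<1}) (at_right 0)"
    by (rule eventually_at_right_real) simp
  ultimately show "\<forall>\<^sub>F t::real in at_right 0. dist (h t * polylog (ones A) (Z t)) 0 < e"
  proof eventually_elim
    case (elim t)
    hence t: "0 < t" "t < 1" by auto
    have pos: "1 - norm (Z t) > 0" using norm_Z_less[OF t] by simp
    have "norm (h (of_real t)) \<le> B * t / (1 - t)" using B(2)[of "of_real t"] t by simp
    moreover have "norm (polylog (ones A) (Z t)) \<le> C + \<epsilon> / (1 - norm (Z t))"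
      by (rule C(2)[OF norm_Z_less[OF t]])
    ultimately have "norm (h t * polylog (ones A) (Z t)) \<le> B * t / (1 - t) * (C + \<epsilon> / (1 - norm (Z t)))"
      unfolding norm_mult using B t by (intro mult_mono) auto
    also have "\<dots> = B / (1 - t) * (t * C + \<epsilon> * (t / (1 - norm (Z t))))"
      by (simp add: algebra_simps)
    also have "\<dots> \<le> B / (1 - t) * (t * C + \<epsilon> * K)"
      using B t \<epsilon> pos one_minus_norm_Z_ge[OF t] by (intro mult_left_mono add_left_mono) (auto simp: pos_divide_le_eq)
    also have "\<dots> < e" using elim by simp
    finally show ?case by simp
  qed
qed

text \<open>The factor \<open>Z t\<close> from the logarithmic derivative of \<open>Z\<close>
  cancels the \<open>1 / Z t\<close> produced by lowering the exponent, so that only a form in w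
  remains. For leading exponent 1 the factor \<open>1 - Z t\<close> cancels in the same way.\<close>

lemma deriv_polylog_Suc:
  fixes t :: real
  assumes "0 < t" "t < 1" "0 \<notin> set (a # A)"
  shows "((\<lambda>z. polylog (ones (Suc a # A)) (Z z)) has_field_derivative
     polylog (ones (a # A)) (Z t) * pole_form a1 a2 a3 t)
     (at (of_real t))"
proof -
  have um: "unimodular ((a, 1) # ones A)" using assms(3) by auto
  have "(polylog ((Suc a, 1) # ones A) has_field_derivative polylog ((a, 1) # ones A) (Z t) / Z t) (at (Z t))"
    by (rule has_field_derivative_polylog_Suc[OF um norm_Z_less Z_nonzero]) (use assms in auto)
  from DERIV_chain2[OF this deriv_Z[OF assms(1,2)]] show ?thesis
    using Z_nonzero[OF assms(1,2)] by (simp add: mult_ac)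
qed

lemma deriv_polylog_1:
  fixes t :: real
  assumes "0 < t" "t < 1" "0 \<notin> set A"
  shows "((\<lambda>z. polylog (ones (1 # A)) (Z z)) has_field_derivative
     polylog (ones A) (Z t) * zero_form b2 b3 t)
     (at (of_real t))"
proof -
  have "(polylog ((1, 1) # ones A) has_field_derivative 1 / (1 - 1 * Z t) * polylog (ones A) (1 * Z t)) (at (Z t))"
    by (rule has_field_derivative_polylog_1) (use assms norm_Z_less in auto)
  moreover have "1 - Z t \<noteq> 0" using norm_Z_less[OF assms(1,2)] by auto
  ultimately show ?thesis
    using DERIV_chain2[of "polylog ((1, 1) # ones A)" "1 / (1 - 1 * Z t) * polylog (ones A) (1 * Z t)" Z,
        OF _ deriv_Z'[OF assms(1,2)]]
    by (simp add: mult_ac)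
qed

text \<open>Integrating by parts moves the letters of the word one at a time from \<open>polylog (ones A) (Z t)\<close>,
  an iterated integral based at \<open>t = 1\<close>, to the iterated integral \<open>h\<close> based at \<open>t = 0\<close>.\<close>

lemma transfer_iterated_integral:
  assumes "polylog_span (cubic_words n) h" "n > 0" "A \<noteq> []" "0 \<notin> set A"
  shows "\<exists>P c. c \<in> MPL_space (n + sum_list A) 3 \<and>
    (\<forall>t::real. 0 < t \<longrightarrow> t < 1 \<longrightarrow> (\<forall>D. ((\<lambda>z. polylog (ones A) (Z z)) has_field_derivative D) (at (of_real t)) \<longrightarrow>
        (P has_field_derivative h t * D) (at (of_real t)))) \<and>
    ((\<lambda>t::real. P t) \<longlongrightarrow> 0) (at_right 0) \<and> ((\<lambda>t::real. P t) \<longlongrightarrow> c) (at_left 1)"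
  using assms
proof (induction "sum_list A" arbitrary: A h n rule: less_induct)
  case less
  obtain a A' where A: "A = a # A'" using less.prems by (cases A) auto
  have a0: "a > 0" using less.prems A by auto
  \<comment> \<open>The word after one letter of the iterated integral has been removed: an exponent
    above 1 is lowered (letter dlog Z), an exponent 1 is dropped (letter dlog (1 - Z)).\<close>
  define A'' where "A'' = (if a = 1 then A' else (a - 1) # A')"
  have A''0: "0 \<notin> set A''" using less.prems a0 by (auto simp: A''_def A)
  have sumA: "sum_list A = Suc (sum_list A'')" using a0 by (auto simp: A''_def A)
  \<comment> \<open>The same form \<open>f\<close> is taken off the polylogarithm and integrated
    against \<open>h\<close>. For exponent 1 it has no pole at 1, which keeps \<open>H\<close> in
    the convergent span.\<close>
  obtain H f where H: "polylog_span (if a = 1 then convergent_cubic_words (Suc n) else cubic_words (Suc n)) H"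
    and dH: "\<And>t::real. 0 < t \<Longrightarrow> t < 1 \<Longrightarrow> (H has_field_derivative h t * f t) (at (of_real t))"
    and dL: "\<And>t::real. 0 < t \<Longrightarrow> t < 1 \<Longrightarrow> ((\<lambda>z. polylog (ones A) (Z z)) has_field_derivative
       polylog (ones A'') (Z t) * f t) (at (of_real t))"
  proof (cases "a = 1")
    case True
    obtain H where H: "polylog_span (convergent_cubic_words (Suc n)) H"
      "\<And>z. norm z < 1 \<Longrightarrow> z \<noteq> 0 \<Longrightarrow> (H has_field_derivative
         h z * zero_form b2 b3 z) (at z)"
      using polylog_span_primitive_form_zero less.prems by blast
    show ?thesis
    proof (rule that[of H "zero_form b2 b3"])
      show "polylog_span (if a = 1 then convergent_cubic_words (Suc n) else cubic_words (Suc n)) H"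
        using H True by simp
    qed (use H(2) deriv_polylog_1[of _ A'] A''0 True in \<open>auto simp: A A''_def\<close>)
  next
    case False
    obtain H where H: "polylog_span (if a1 = 0 then convergent_cubic_words (Suc n) else cubic_words (Suc n)) H"
      "\<And>z. norm z < 1 \<Longrightarrow> (H has_field_derivative
         h z * pole_form a1 a2 a3 z) (at z)"
      using polylog_span_primitive_form[OF less.prems(1), of a1 a2 a3] by blast
    have H': "polylog_span (cubic_words (Suc n)) H"
      using H(1) polylog_span_mono[OF _ convergent_cubic_words_subset] by (auto split: if_splits)
    show ?thesis
    proof (rule that[of H "pole_form a1 a2 a3"])
      show "polylog_span (if a = 1 then convergent_cubic_words (Suc n) else cubic_words (Suc n)) H"
        using H' False by simp
    qed (use H(2) deriv_polylog_Suc[of _ "a - 1" A'] A''0 False a0 in \<open>auto simp: A A''_def\<close>)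
  qed
  have H': "polylog_span (cubic_words (Suc n)) H"
    using H polylog_span_mono[OF _ convergent_cubic_words_subset] by (auto split: if_splits)
  have uniq: "D = polylog (ones A'') (Z t) * f t"
    if "0 < t" "t < 1" "((\<lambda>z. polylog (ones A) (Z z)) has_field_derivative D) (at (of_real t))" for t :: real and D
    using DERIV_unique[OF that(3) dL[OF that(1,2)]] .
  show ?case
  proof (cases "A'' = []")
    case True
    \<comment> \<open>The last letter to be removed is always dlog (1 - Z), so the final primitive
      converges at 1, and its limit is the constant sought.\<close>
    hence a: "a = 1" by (auto simp: A''_def split: if_splits)
    have Hc: "polylog_span (convergent_cubic_words (Suc n)) H" using H a by simp
    obtain c where c: "c \<in> MPL_space (Suc n) 3" "((\<lambda>t::real. H t) \<longlongrightarrow> c) (at_left 1)"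
      using polylog_span_convergent_tendsto[OF Hc] by blast
    have "isCont H 0"
      using polylog_span_differentiable[OF H', of 0] field_differentiable_imp_continuous_at by auto
    hence "((\<lambda>t::real. H (of_real t)) \<longlongrightarrow> H (of_real 0)) (at_right 0)"
      by (intro isCont_tendsto_compose[of _ H] tendsto_intros) auto
    hence "((\<lambda>t::real. H (of_real t)) \<longlongrightarrow> 0) (at_right 0)"
      using polylog_span_at_0[OF H'] by simp
    moreover have "(H has_field_derivative h t * D) (at (of_real t))"
      if "0 < t" "t < 1" "((\<lambda>z. polylog (ones A) (Z z)) has_field_derivative D) (at (of_real t))" for t :: real and D
      using dH[OF that(1,2)] uniq[OF that] True by simp
    ultimately show ?thesis
      using c True sumA by (intro exI[of _ H] exI[of _ c]) auto
  next
    case False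
    have "\<exists>P c. c \<in> MPL_space (Suc n + sum_list A'') 3 \<and>
      (\<forall>t::real. 0 < t \<longrightarrow> t < 1 \<longrightarrow> (\<forall>D. ((\<lambda>z. polylog (ones A'') (Z z)) has_field_derivative D) (at (of_real t)) \<longrightarrow>
          (P has_field_derivative H t * D) (at (of_real t)))) \<and>
      ((\<lambda>t::real. P t) \<longlongrightarrow> 0) (at_right 0) \<and> ((\<lambda>t::real. P t) \<longlongrightarrow> c) (at_left 1)"
      by (rule less.hyps) (use sumA H' False A''0 in auto)
    then obtain P c where c: "c \<in> MPL_space (Suc n + sum_list A'') 3"
      and P: "\<And>t D. 0 < t \<Longrightarrow> t < 1 \<Longrightarrow> ((\<lambda>z. polylog (ones A'') (Z z)) has_field_derivative D) (at (of_real t)) \<Longrightarrow>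
          (P has_field_derivative H (of_real t) * D) (at (of_real t))"
      and P0: "((\<lambda>t::real. P t) \<longlongrightarrow> 0) (at_right 0)" and P1: "((\<lambda>t::real. P t) \<longlongrightarrow> c) (at_left 1)"
      by blast
    \<comment> \<open>Integration by parts: \<open>P\<close> integrates \<open>H\<close> against the
      derivative of the shorter polylogarithm. The boundary products vanish at both ends, so the
      constant merely changes sign.\<close>
    define Q where "Q z = H z * polylog (ones A'') (Z z) - P z" for z
    have "(Q has_field_derivative h t * D) (at (of_real t))"
      if t: "0 < t" "t < 1" "((\<lambda>z. polylog (ones A) (Z z)) has_field_derivative D) (at (of_real t))" for t :: real and D
    proof -
      have "\<exists>E. ((\<lambda>z. polylog (ones A'') (Z z)) has_field_derivative E) (at (of_real t))"
      proof -
        have "polylog (ones A'') field_differentiable (at (Z t))"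
          using has_field_derivative_polylog[of "ones A''" "Z t"] A''0 norm_Z_less[OF t(1,2)]
          by (auto simp: field_differentiable_def)
        moreover have "Z field_differentiable (at (of_real t))"
          using deriv_Z[OF t(1,2)] by (auto simp: field_differentiable_def)
        ultimately show ?thesis
          using field_differentiable_compose[of Z "of_real t" "polylog (ones A'')"]
          by (auto simp: field_differentiable_def o_def)
      qed
      then obtain E where E: "((\<lambda>z. polylog (ones A'') (Z z)) has_field_derivative E) (at (of_real t))" ..
      have "(Q has_field_derivative (h t * f t * polylog (ones A'') (Z t) + E * H t) - H t * E) (at (of_real t))"
        unfolding Q_def by (intro DERIV_diff DERIV_mult dH E P t)
      thus ?thesis using uniq[OF t] by (simp add: algebra_simps)
    qed
    moreover have "((\<lambda>t::real. Q t) \<longlongrightarrow> 0 - 0) (at_right 0)"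
      unfolding Q_def using False A''0 by (intro tendsto_intros P0 boundary_at_right_0[OF H']) auto
    moreover have "((\<lambda>t::real. Q t) \<longlongrightarrow> 0 - c) (at_left 1)"
      unfolding Q_def using False A''0 by (intro tendsto_intros P1 boundary_at_left_1[OF H']) auto
    moreover have "- c \<in> MPL_space (n + sum_list A) 3"
      using MPL_space_scale[OF c, of "- 1"] sumA by simp
    ultimately show ?thesis by (intro exI[of _ Q] exI[of _ "- c"]) auto
  qed
qed

end

section \<open>The two paths\<close>

lemma polylog_span_log_form:
  obtains l where "polylog_span (cubic_words 1) l" "l 0 = 0"
    "\<And>z. norm z < 1 \<Longrightarrow> (l has_field_derivative pole_form a b c z) (at z)"
proof -
  have "[] \<in> cubic_words 0" by (simp add: cubic_words_def)
  hence "polylog_span (cubic_words 0) (polylog [])" by (rule polylog_span_base)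
  then obtain l where l: "polylog_span (if a = 0 then convergent_cubic_words (Suc 0) else cubic_words (Suc 0)) l"
    "\<And>z. norm z < 1 \<Longrightarrow> (l has_field_derivative polylog [] z * pole_form a b c z) (at z)"
    using polylog_span_primitive_form[of 0 "polylog []" a b c] by blast
  have "polylog_span (cubic_words 1) l"
    using l(1) polylog_span_mono[OF _ convergent_cubic_words_subset] by (auto split: if_splits)
  thus ?thesis using that[of l] l(2) polylog_span_at_0[of 1 l] by simp
qed

text \<open>The divided power \<open>l ^ m / fact m\<close> is the \<open>m\<close>-fold iterated
  integral of the one form, so each step is a primitive against that form; the constant of
  integration is 0 because both sides vanish at 0.\<close>

lemma polylog_span_log_form_power:
  assumes l: "l 0 = 0" "\<And>z. norm z < 1 \<Longrightarrow> (l has_field_derivative pole_form a b c z) (at z)"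
  shows "\<exists>g. polylog_span (cubic_words m) g \<and> (\<forall>z. norm z < 1 \<longrightarrow> g z = l z ^ m / fact m)"
proof (induction m)
  case 0
  have "[] \<in> cubic_words 0" by (simp add: cubic_words_def)
  hence "polylog_span (cubic_words 0) (polylog [])" by (rule polylog_span_base)
  thus ?case by - (rule exI[of _ "polylog []"], rule conjI, assumption, simp)
next
  case (Suc m)
  then obtain g where g: "polylog_span (cubic_words m) g" "\<And>z. norm z < 1 \<Longrightarrow> g z = l z ^ m / fact m" by blast
  obtain G where G: "polylog_span (if a = 0 then convergent_cubic_words (Suc m) else cubic_words (Suc m)) G"
    "\<And>z. norm z < 1 \<Longrightarrow> (G has_field_derivative g z * pole_form a b c z) (at z)"
    using polylog_span_primitive_form[OF g(1), of a b c] by blast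
  have G': "polylog_span (cubic_words (Suc m)) G"
    using G(1) polylog_span_mono[OF _ convergent_cubic_words_subset] by (auto split: if_splits)
  have "\<exists>C. \<forall>z\<in>ball 0 1. G z - l z ^ Suc m / fact (Suc m) = C"
  proof (rule has_field_derivative_zero_constant)
    fix z :: complex assume "z \<in> ball 0 1"
    hence z: "norm z < 1" by simp
    have dl: "((\<lambda>z. l z ^ Suc m) has_field_derivative of_nat (Suc m) * l z ^ m * pole_form a b c z) (at z)"
      using DERIV_power[OF l(2)[OF z], of "Suc m"] by (simp add: mult_ac del: of_nat_Suc power_Suc)
    have "((\<lambda>z. G z - l z ^ Suc m / fact (Suc m)) has_field_derivative
        g z * pole_form a b c z - of_nat (Suc m) * l z ^ m * pole_form a b c z / fact (Suc m)) (at z)"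
      by (intro DERIV_diff DERIV_cdivide G(2) z dl)
    also have "g z * pole_form a b c z - of_nat (Suc m) * l z ^ m * pole_form a b c z / fact (Suc m) = 0"
      by (simp add: g(2)[OF z] fact_Suc divide_simps del: of_nat_Suc)
    finally show "((\<lambda>z. G z - l z ^ Suc m / fact (Suc m)) has_field_derivative 0) (at z within ball 0 1)"
      by (rule has_field_derivative_at_within)
  qed simp
  then obtain C where C: "\<And>z. norm z < 1 \<Longrightarrow> G z - l z ^ Suc m / fact (Suc m) = C" by auto
  have "C = 0" using C[of 0] polylog_span_at_0[OF G'] l(1) by simp
  thus ?case using G' C by (intro exI[of _ G]) auto
qed

context cubic_path
begin

text \<open>This is the concatenation: \<open>m\<close> letters from the power of \<open>l\<close>,
  one letter from d\<theta>, and \<open>sum_list A\<close> letters from the polylogarithm based at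
  the other end, which adds up to the weight claimed.\<close>

lemma iterated_integral_value:
  assumes l: "l 0 = 0" "\<And>z. norm z < 1 \<Longrightarrow> (l has_field_derivative pole_form a b c z) (at z)"
    and A: "0 \<notin> set A"
  shows "\<exists>F v. v \<in> MPL_space (m + 1 + sum_list A) 3 \<and>
    (\<forall>t::real. 0 < t \<longrightarrow> t < 1 \<longrightarrow> (F has_field_derivative
        l t ^ m * pole_form 0 (- 1) 1 t * polylog (ones A) (Z t)) (at (of_real t))) \<and>
    ((\<lambda>t::real. F t) \<longlongrightarrow> 0) (at_right 0) \<and> ((\<lambda>t::real. F t) \<longlongrightarrow> v) (at_left 1)"
proof -
  obtain g where g: "polylog_span (cubic_words m) g" "\<And>z. norm z < 1 \<Longrightarrow> g z = l z ^ m / fact m"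
    using polylog_span_log_form_power[OF l] by blast
  \<comment> \<open>With the coefficients 0, -1, 1 the form is dlog ((w - \<omega>^2) / (w -
    \<omega>)); having no pole at 1, it makes \<open>h\<close> convergent there.\<close>
  obtain h where h: "polylog_span (convergent_cubic_words (Suc m)) h"
    "\<And>z. norm z < 1 \<Longrightarrow> (h has_field_derivative g z * pole_form 0 (- 1) 1 z) (at z)"
    using polylog_span_primitive_form[OF g(1), of 0 "- 1" 1] by auto
  have h': "polylog_span (cubic_words (Suc m)) h"
    using h polylog_span_mono[OF _ convergent_cubic_words_subset] by blast
  have dh: "(h has_field_derivative l t ^ m / fact m * pole_form 0 (- 1) 1 t) (at (of_real t))"
    if "0 < t" "t < 1" for t :: real
    using h(2)[of "of_real t"] g(2)[of "of_real t"] that by simp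
  have q: "of_rat (fact m) = (fact m :: complex)" by (metis of_nat_fact of_rat_of_nat_eq)
  show ?thesis
  proof (cases "A = []")
    case True
    obtain v where v: "v \<in> MPL_space (Suc m) 3" "((\<lambda>t::real. h t) \<longlongrightarrow> v) (at_left 1)"
      using polylog_span_convergent_tendsto[OF h(1)] by blast
    have "isCont h 0"
      using polylog_span_differentiable[OF h', of 0] field_differentiable_imp_continuous_at by auto
    hence "((\<lambda>t::real. h (of_real t)) \<longlongrightarrow> h (of_real 0)) (at_right 0)"
      by (intro isCont_tendsto_compose[of _ h] tendsto_intros) auto
    hence h0: "((\<lambda>t::real. h (of_real t)) \<longlongrightarrow> 0) (at_right 0)"
      using polylog_span_at_0[OF h'] by simp
    show ?thesis
    proof (intro exI[of _ "\<lambda>z. fact m * h z"] exI[of _ "fact m * v"] conjI allI impI)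
      show "fact m * v \<in> MPL_space (m + 1 + sum_list A) 3"
        using MPL_space_scale[OF v(1), of "fact m"] True by (simp add: q)
      show "((\<lambda>t::real. fact m * h t) \<longlongrightarrow> 0) (at_right 0)"
        using tendsto_mult[OF tendsto_const h0, of "fact m"] by simp
      show "((\<lambda>t::real. fact m * h t) \<longlongrightarrow> fact m * v) (at_left 1)"
        by (intro tendsto_intros v)
      fix t :: real assume "0 < t" "t < 1"
      from DERIV_cmult[OF dh[OF this], of "fact m"]
      show "((\<lambda>z. fact m * h z) has_field_derivative
         l t ^ m * pole_form 0 (- 1) 1 t * polylog (ones A) (Z t)) (at (of_real t))"
        by (simp add: True)
    qed
  next
    case False
    obtain P v where v: "v \<in> MPL_space (Suc m + sum_list A) 3"
      and P: "\<And>t D. 0 < t \<Longrightarrow> t < 1 \<Longrightarrow> ((\<lambda>z. polylog (ones A) (Z z)) has_field_derivative D) (at (of_real t)) \<Longrightarrow>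
          (P has_field_derivative h (of_real t) * D) (at (of_real t))"
      and P0: "((\<lambda>t::real. P t) \<longlongrightarrow> 0) (at_right 0)" and P1: "((\<lambda>t::real. P t) \<longlongrightarrow> v) (at_left 1)"
      using transfer_iterated_integral[OF h' _ False A] by blast
    \<comment> \<open>Since \<open>P\<close> integrates \<open>h\<close> against the derivative of
      the polylogarithm, the product minus \<open>P\<close> integrates the derivative of
      \<open>h\<close> against the polylogarithm itself; \<open>fact m\<close> removes the divided
      power.\<close>
    define F where "F z = fact m * (h z * polylog (ones A) (Z z) - P z)" for z
    show ?thesis
    proof (intro exI[of _ F] exI[of _ "- (fact m * v)"] conjI allI impI)
      show "- (fact m * v) \<in> MPL_space (m + 1 + sum_list A) 3"
        using MPL_space_scale[OF v(1), of "- fact m"] by (simp add: q of_rat_minus)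
      have "((\<lambda>t::real. F t) \<longlongrightarrow> fact m * (0 - 0)) (at_right 0)"
        unfolding F_def using False A by (intro tendsto_intros P0 boundary_at_right_0[OF h']) auto
      thus "((\<lambda>t::real. F t) \<longlongrightarrow> 0) (at_right 0)" by simp
      have "((\<lambda>t::real. F t) \<longlongrightarrow> fact m * (0 - v)) (at_left 1)"
        unfolding F_def using False A by (intro tendsto_intros P1 boundary_at_left_1[OF h']) auto
      thus "((\<lambda>t::real. F t) \<longlongrightarrow> - (fact m * v)) (at_left 1)" by simp
      fix t :: real assume t: "0 < t" "t < 1"
      have "polylog (ones A) field_differentiable (at (Z t))"
        using has_field_derivative_polylog[of "ones A" "Z t"] A norm_Z_less[OF t]
        by (auto simp: field_differentiable_def)
      moreover have "Z field_differentiable (at (of_real t))"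
        using deriv_Z[OF t] by (auto simp: field_differentiable_def)
      ultimately obtain E where E: "((\<lambda>z. polylog (ones A) (Z z)) has_field_derivative E) (at (of_real t))"
        using field_differentiable_compose[of Z "of_real t" "polylog (ones A)"]
        by (auto simp: field_differentiable_def o_def)
      have "(F has_field_derivative fact m * ((l t ^ m / fact m * pole_form 0 (- 1) 1 t * polylog (ones A) (Z t) + E * h t) - h t * E))
          (at (of_real t))"
        unfolding F_def by (intro DERIV_cmult DERIV_diff DERIV_mult dh E P t)
      thus "(F has_field_derivative l t ^ m * pole_form 0 (- 1) 1 t * polylog (ones A) (Z t)) (at (of_real t))"
        by (simp add: mult_ac)
    qed
  qed
qed

end

section \<open>The two rational functions and their logarithmic forms\<close>

lemma omega_relation: "omega ^ 2 + omega + 1 = 0"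
  by (simp add: omega_sq) (simp add: omega_def complex_eq_iff)

lemma of_real_ne_omega: "complex_of_real t \<noteq> omega" "complex_of_real t \<noteq> omega ^ 2"
  by (simp_all add: omega_sq, simp_all add: omega_def complex_eq_iff)

lemma norm_of_real_minus_omega:
  "norm (complex_of_real t - omega) = sqrt (1 + t + t ^ 2)"
  "norm (complex_of_real t - omega ^ 2) = sqrt (1 + t + t ^ 2)"
  by (simp_all add: omega_sq, simp_all add: omega_def cmod_def power2_eq_square field_simps)

definition circle_path :: "complex \<Rightarrow> complex"
  where "circle_path z = (1 - z) ^ 2 / ((z - omega) * (z - omega ^ 2))"

definition arc_path :: "complex \<Rightarrow> complex"
  where "arc_path z = (z - 1) * (z - omega) / (z - omega ^ 2) ^ 2"

lemma deriv_circle_path: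
  assumes "z \<noteq> 1" "z \<noteq> omega" "z \<noteq> omega ^ 2"
  shows "(circle_path has_field_derivative circle_path z * pole_form 2 (- 1) (- 1) z) (at z)"
proof -
  have nz: "1 - z \<noteq> 0" "z - 1 \<noteq> 0" "z - omega \<noteq> 0" "z - omega ^ 2 \<noteq> 0" using assms by auto
  have "(circle_path has_field_derivative 
     (- 2 * (1 - z) * ((z - omega) * (z - omega ^ 2)) - (1 - z) ^ 2 * ((z - omega) + (z - omega ^ 2))) /
     ((z - omega) * (z - omega ^ 2)) ^ 2) (at z)"
    unfolding circle_path_def
    by (rule derivative_eq_intros refl)+ (use nz in \<open>simp; fail | simp add: power2_eq_square algebra_simps; fail\<close>)+
  also have "(- 2 * (1 - z) * ((z - omega) * (z - omega ^ 2)) - (1 - z) ^ 2 * ((z - omega) + (z - omega ^ 2))) /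
     ((z - omega) * (z - omega ^ 2)) ^ 2 = circle_path z * pole_form 2 (- 1) (- 1) z"
  proof -
    have "(- 2 * p * (q * r) - p ^ 2 * (q + r)) / (q * r) ^ 2 = p ^ 2 / (q * r) * (- 2 / p - 1 / q - 1 / r)"
      if "p \<noteq> 0" "q \<noteq> 0" "r \<noteq> 0" for p q r :: complex
      using that by (simp add: field_simps power2_eq_square)
    from this[OF nz(1,3,4)] have "(- 2 * (1 - z) * ((z - omega) * (z - omega ^ 2)) - (1 - z) ^ 2 * ((z - omega) + (z - omega ^ 2))) /
     ((z - omega) * (z - omega ^ 2)) ^ 2 = circle_path z * (- 2 / (1 - z) - 1 / (z - omega) - 1 / (z - omega ^ 2))"
      by (simp add: circle_path_def)
    moreover have "- 2 / (1 - z) = 2 / (z - 1)" using nz by (simp add: field_simps)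
    ultimately show ?thesis by (simp add: pole_form_def of_rat_minus)
  qed
  finally show ?thesis .
qed

text \<open>Behind the identity is
  \<open>1 - circle_path z = 3 * z / ((z - omega) * (z - omega ^ 2))\<close>: the zero at 0 gives
  the residue -1, the two simple poles give the coefficients 1 and 1.\<close>

lemma circle_path_zero_form:
  assumes "z \<noteq> 0" "z \<noteq> 1" "z \<noteq> omega" "z \<noteq> omega ^ 2"
  shows "circle_path z * pole_form 2 (- 1) (- 1) z = (1 - circle_path z) * zero_form 1 1 z"
proof -
  define w where "w = omega"
  have w: "w ^ 2 + w + 1 = 0" using omega_relation by (simp add: w_def)
  have nz: "z \<noteq> 0" "z - 1 \<noteq> 0" "z - w \<noteq> 0" "z - w ^ 2 \<noteq> 0" using assms by (auto simp: w_def)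
  show ?thesis
    unfolding circle_path_def pole_form_def zero_form_def w_def[symmetric]
    using nz apply (simp add: of_rat_minus divide_simps)
    using w by algebra
qed

lemma deriv_arc_path:
  assumes "z \<noteq> 1" "z \<noteq> omega" "z \<noteq> omega ^ 2"
  shows "(arc_path has_field_derivative arc_path z * pole_form 1 1 (- 2) z) (at z)"
proof -
  have nz: "z - 1 \<noteq> 0" "z - omega \<noteq> 0" "z - omega ^ 2 \<noteq> 0" using assms by auto
  have "(arc_path has_field_derivative 
     (((z - 1) + (z - omega)) * (z - omega ^ 2) ^ 2 - (z - 1) * (z - omega) * (2 * (z - omega ^ 2))) /
     ((z - omega ^ 2) ^ 2) ^ 2) (at z)"
    unfolding arc_path_def
    by (rule derivative_eq_intros refl)+ (use nz in \<open>simp; fail | simp add: power2_eq_square algebra_simps; fail\<close>)+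
  also have "(((z - 1) + (z - omega)) * (z - omega ^ 2) ^ 2 - (z - 1) * (z - omega) * (2 * (z - omega ^ 2))) /
     ((z - omega ^ 2) ^ 2) ^ 2 = arc_path z * pole_form 1 1 (- 2) z"
  proof -
    have "((p + q) * r ^ 2 - p * q * (2 * r)) / (r ^ 2) ^ 2 = p * q / r ^ 2 * (1 / p + 1 / q - 2 / r)"
      if "p \<noteq> 0" "q \<noteq> 0" "r \<noteq> 0" for p q r :: complex
      using that by (simp add: field_simps power2_eq_square)
    from this[OF nz] show ?thesis by (simp add: arc_path_def pole_form_def of_rat_minus)
  qed
  finally show ?thesis .
qed

text \<open>Behind the identity is
  \<open>1 - arc_path z = - 3 * omega ^ 2 * z / (z - omega ^ 2) ^ 2\<close>, which holds by
  \<open>omega ^ 2 + omega + 1 = 0\<close>; the double pole gives the coefficient 2 at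
  \<open>omega ^ 2\<close>.\<close>

lemma arc_path_zero_form:
  assumes "z \<noteq> 0" "z \<noteq> 1" "z \<noteq> omega" "z \<noteq> omega ^ 2"
  shows "arc_path z * pole_form 1 1 (- 2) z = (1 - arc_path z) * zero_form 0 2 z"
proof -
  define w where "w = omega"
  have w: "w ^ 2 + w + 1 = 0" using omega_relation by (simp add: w_def)
  have nz: "z \<noteq> 0" "z - 1 \<noteq> 0" "z - w \<noteq> 0" "z - w ^ 2 \<noteq> 0" using assms by (auto simp: w_def)
  show ?thesis
    unfolding arc_path_def pole_form_def zero_form_def w_def[symmetric]
    using nz apply (simp add: of_rat_minus divide_simps)
    using w by algebra
qed

lemma norm_circle_path:
  assumes "0 < t" "t < 1"
  shows "norm (circle_path (of_real t)) = (1 - t) ^ 2 / (1 + t + t ^ 2)"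
proof -
  have "sqrt (1 + t + t ^ 2) * sqrt (1 + t + t ^ 2) = 1 + t + t ^ 2"
    using assms by simp
  moreover have "norm (1 - complex_of_real t) = 1 - t"
    using assms by (metis abs_of_pos diff_gt_0_iff_gt norm_of_real of_real_1 of_real_diff)
  ultimately show ?thesis
    using assms by (simp add: circle_path_def norm_divide norm_mult norm_power norm_of_real_minus_omega)
qed

lemma norm_arc_path:
  assumes "0 < t" "t < 1"
  shows "norm (arc_path (of_real t)) = (1 - t) / sqrt (1 + t + t ^ 2)"
proof -
  define s where "s = sqrt (1 + t + t ^ 2)"
  have "1 + t + t ^ 2 > 0" using assms by (simp add: add_pos_pos)
  hence "s > 0" by (simp add: s_def)
  moreover have "norm (complex_of_real t - 1) = 1 - t"
    using assms by (metis abs_of_pos diff_gt_0_iff_gt norm_of_real of_real_1 of_real_diff norm_minus_commute)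
  ultimately show ?thesis
    unfolding arc_path_def norm_divide norm_mult norm_power norm_of_real_minus_omega s_def[symmetric]
    by (simp add: power2_eq_square)
qed

interpretation circle: cubic_path circle_path 2 "- 1" "- 1" 1 1 1
proof
  fix t :: real assume t: "0 < t" "t < 1"
  have ne: "complex_of_real t \<noteq> 0" "complex_of_real t \<noteq> 1" using t by auto
  note ne = ne of_real_ne_omega[of t]
  show d: "(circle_path has_field_derivative circle_path t * pole_form 2 (- 1) (- 1) t) (at (of_real t))"
    by (intro deriv_circle_path ne)
  show "(circle_path has_field_derivative (1 - circle_path t) * zero_form 1 1 t) (at (of_real t))"
    using d unfolding circle_path_zero_form[OF ne] .
  show "circle_path t \<noteq> 0" using ne by (auto simp: circle_path_def)
  have pos: "1 + t + t ^ 2 > 0" using t by (simp add: add_pos_pos)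
  have "(1 - t) ^ 2 < 1 + t + t ^ 2" using t by (simp add: power2_eq_square algebra_simps)
  thus "norm (circle_path t) < 1" using pos by (simp add: norm_circle_path[OF t])
  have "(1 - t) * (1 - t) \<le> (1 - t) * (1 + t + t ^ 2)"
    using t by (intro mult_left_mono) (auto intro: order_trans[of _ 1])
  thus "norm (circle_path t) \<le> 1 * (1 - t)" using pos
    by (simp add: norm_circle_path[OF t] pos_divide_le_eq power2_eq_square)
  \<comment> \<open>Here \<open>1 - norm (circle_path t)\<close> equals
    \<open>3 * t / (1 + t + t ^ 2)\<close>, whose denominator is at most 3; hence the constant
    1.\<close>
  have "t ^ 2 \<le> 1" using t by (simp add: power_le_one)
  hence "t * (1 + t + t ^ 2) \<le> t * 3" using t by (intro mult_left_mono) auto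
  also have "\<dots> = 1 + t + t ^ 2 - (1 - t) ^ 2" by (simp add: power2_eq_square algebra_simps)
  finally show "t \<le> 1 * (1 - norm (circle_path t))"
    using pos by (simp add: norm_circle_path[OF t] field_simps)
qed

interpretation arc: cubic_path arc_path 1 1 "- 2" 0 2 2
proof
  fix t :: real assume t: "0 < t" "t < 1"
  have ne: "complex_of_real t \<noteq> 0" "complex_of_real t \<noteq> 1" using t by auto
  note ne = ne of_real_ne_omega[of t]
  show d: "(arc_path has_field_derivative arc_path t * pole_form 1 1 (- 2) t) (at (of_real t))"
    by (intro deriv_arc_path ne)
  show "(arc_path has_field_derivative (1 - arc_path t) * zero_form 0 2 t) (at (of_real t))"
    using d unfolding arc_path_zero_form[OF ne] .
  show "arc_path t \<noteq> 0" using ne by (auto simp: arc_path_def)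
  have pos: "1 + t + t ^ 2 > 0" using t by (simp add: add_pos_pos)
  define X where "X = norm (arc_path t)"
  have X0: "X \<ge> 0" by (simp add: X_def)
  \<comment> \<open>The square of the modulus is the modulus of \<open>circle_path\<close> at the
    same \<open>t\<close>. The earlier estimate thus bounds \<open>1 - X ^ 2\<close>, and the factor
    \<open>1 + X\<close>, at most 2, explains the constant 2 of this path.\<close>
  have X2: "X ^ 2 = (1 - t) ^ 2 / (1 + t + t ^ 2)"
    using pos by (simp add: X_def norm_arc_path[OF t] power_divide)
  have "X ^ 2 \<le> (1 - t) ^ 2 / 1"
    unfolding X2 using t by (intro frac_le) auto
  hence X1: "X \<le> 1 - t" using t by (simp add: power2_le_iff_abs_le)
  thus "norm (arc_path t) < 1" "norm (arc_path t) \<le> 2 * (1 - t)" using t by (auto simp: X_def)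
  have "t ^ 2 \<le> 1" using t by (simp add: power_le_one)
  hence "t * (1 + t + t ^ 2) \<le> t * 3" using t by (intro mult_left_mono) auto
  also have "\<dots> = 1 + t + t ^ 2 - (1 - t) ^ 2" by (simp add: power2_eq_square algebra_simps)
  finally have "t \<le> 1 - X ^ 2"
    unfolding X2 using pos by (simp add: field_simps)
  also have "1 - X ^ 2 = (1 + X) * (1 - X)" by (simp add: power2_eq_square algebra_simps)
  also have "\<dots> \<le> 2 * (1 - X)" using X1 X0 t by (intro mult_right_mono) auto
  finally show "t \<le> 2 * (1 - norm (arc_path t))" by (simp add: X_def)
qed

section \<open>The integral over small angles\<close>

lemma set_integrable_bounded_open_interval:
  fixes g :: "real \<Rightarrow> 'a::{banach, second_countable_topology}"
  assumes "continuous_on {a<..<b} g" "\<And>x. a < x \<Longrightarrow> x < b \<Longrightarrow> norm (g x) \<le> M"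
  shows "set_integrable lborel {a<..<b} g"
proof -
  have "set_integrable lborel {a<..<b} (\<lambda>_. M)"
    using integrable_real_indicator[of "{a<..<b}" lborel] emeasure_bounded_finite[of "{a<..<b}"]
    by (simp add: set_integrable_def)
  thus ?thesis
  proof (rule set_integrable_bound)
    show "set_borel_measurable lborel {a<..<b} g"
      using borel_measurable_continuous_on_indicator[of "{a<..<b}" g] assms(1)
      by (simp add: set_borel_measurable_def)
    show "AE x in lborel. x \<in> {a<..<b} \<longrightarrow> norm (g x) \<le> norm M"
      using assms(2) by (intro AE_I2) fastforce
  qed
qed

lemma set_integral_Icc_eq_Ioo:
  fixes f :: "real \<Rightarrow> 'a::{banach, second_countable_topology}"
  shows "(LBINT x:{a..b}. f x) = (LBINT x:{a<..<b}. f x)"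
  by (rule set_integral_discrete_difference[where X = "{a, b}"]) auto

lemma set_integral_cong_Ioo:
  fixes f g :: "real \<Rightarrow> 'a::{banach, second_countable_topology}"
  assumes "\<And>x. a < x \<Longrightarrow> x < b \<Longrightarrow> f x = g x"
  shows "(LBINT x:{a..b}. f x) = (LBINT x:{a..b}. g x)"
  unfolding set_integral_Icc_eq_Ioo by (rule set_lebesgue_integral_cong) (use assms in auto)

text \<open>The primitives used below have one-sided limits at the endpoints but need not be defined
  there; boundedness of the integrand supplies integrability.\<close>

lemma integral_eq_limit_difference:
  fixes g G :: "real \<Rightarrow> 'a::euclidean_space"
  assumes "a < b"
    and G: "\<And>x. a < x \<Longrightarrow> x < b \<Longrightarrow> (G has_vector_derivative g x) (at x)"
    and g: "continuous_on {a<..<b} g" "\<And>x. a < x \<Longrightarrow> x < b \<Longrightarrow> norm (g x) \<le> M"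
    and A: "(G \<longlongrightarrow> A) (at_right a)" and B: "(G \<longlongrightarrow> B) (at_left b)"
  shows "(LBINT x:{a..b}. g x) = B - A"
proof -
  have "(LBINT x=a..b. g x) = B - A"
  proof (rule interval_integral_FTC_integrable)
    show "ereal a < ereal b" using assms by simp
    show "(G has_vector_derivative g x) (at x)" if "ereal a < ereal x" "ereal x < ereal b" for x
      using G that by simp
    show "isCont g x" if "ereal a < ereal x" "ereal x < ereal b" for x
      using g(1) that by (simp add: continuous_on_eq_continuous_at)
    show "set_integrable lborel (einterval (ereal a) (ereal b)) g"
      using set_integrable_bounded_open_interval[OF g] by simp
    show "((G \<circ> real_of_ereal) \<longlongrightarrow> A) (at_right (ereal a))"
      using A by (simp add: ereal_tendsto_simps)
    show "((G \<circ> real_of_ereal) \<longlongrightarrow> B) (at_left (ereal b))"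
      using B by (simp add: ereal_tendsto_simps)
  qed
  thus ?thesis using assms(1) by (simp add: interval_integral_Icc)
qed

text \<open>A head of at least 2 makes the coefficients absolutely summable, and their total bounds
  the function on the whole open disc.\<close>

lemma norm_polylog_ones_bounded:
  assumes "0 \<notin> set A" "A = [] \<or> hd A \<ge> 2"
  shows "\<exists>C. \<forall>z. norm z < 1 \<longrightarrow> norm (polylog (ones A) z) \<le> C"
proof (cases A)
  case Nil
  thus ?thesis by (intro exI[of _ 1]) auto
next
  case (Cons a B)
  have sm: "summable (\<lambda>n. norm (nested_term (ones A) n))"
    using assms Cons summable_norm_nested_term[of a 1 "ones B"] by simp
  have "norm (polylog (ones A) z) \<le> (suminf (\<lambda>n. norm (nested_term (ones A) n)))" if z: "norm z < 1" for z
  proof -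
    have le: "norm (nested_term (ones A) n * z ^ n) \<le> norm (nested_term (ones A) n)" for n
      using z by (simp add: norm_mult norm_power power_le_one mult_left_le)
    have "(\<lambda>n. nested_term (ones A) n * z ^ n) sums polylog (ones A) z"
      using assms z by (intro polylog_sums) auto
    thus ?thesis using summable_sums[OF sm] le by (rule norm_sums_le)
  qed
  thus ?thesis by blast
qed

text \<open>The parameter w as a function of the angle: it equals sin (pi/6 - \<theta>) / sin (pi/6
  + \<theta>) and decreases from 1 at 0 to 0 at pi/6.\<close>

definition cubic_param :: "real \<Rightarrow> real"
  where "cubic_param \<theta> = (cos \<theta> - sqrt 3 * sin \<theta>) / (cos \<theta> + sqrt 3 * sin \<theta>)"

lemma sin_cos_bounds:
  assumes "0 < \<theta>" "\<theta> < pi / 6"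
  shows "0 < sin \<theta>" "sin \<theta> < 1 / 2" "sqrt 3 / 2 < cos \<theta>"
proof -
  show "0 < sin \<theta>" using assms by (intro sin_gt_zero) auto
  show "sin \<theta> < 1 / 2" using sin_monotone_2pi[of \<theta> "pi / 6"] assms by (simp add: sin_30)
  show "sqrt 3 / 2 < cos \<theta>" using cos_monotone_0_pi[of \<theta> "pi / 6"] assms by (simp add: cos_30)
qed

lemma cubic_param_denominator_pos:
  assumes "0 < \<theta>" "\<theta> < pi / 6"
  shows "0 < cos \<theta> + sqrt 3 * sin \<theta>"
  using sin_cos_bounds[OF assms] by (smt (verit) mult_pos_pos real_sqrt_gt_zero zero_less_numeral half_gt_zero)

lemma cubic_param_bounds:
  assumes "0 < \<theta>" "\<theta> < pi / 6"
  shows "0 < cubic_param \<theta>" "cubic_param \<theta> < 1"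
proof -
  have "sqrt 3 * sin \<theta> < sqrt 3 * (1 / 2)" using sin_cos_bounds[OF assms] by (intro mult_strict_left_mono) auto
  hence "0 < cos \<theta> - sqrt 3 * sin \<theta>" using sin_cos_bounds[OF assms] by linarith
  thus "0 < cubic_param \<theta>" using cubic_param_denominator_pos[OF assms] by (simp add: cubic_param_def)
  show "cubic_param \<theta> < 1" using cubic_param_denominator_pos[OF assms] sin_cos_bounds(1)[OF assms]
    by (simp add: cubic_param_def)
qed

lemma filterlim_cubic_param_0: "filterlim cubic_param (at_left 1) (at_right 0)"
  unfolding filterlim_at
proof
  have "(cubic_param \<longlongrightarrow> (cos 0 - sqrt 3 * sin 0) / (cos 0 + sqrt 3 * sin 0)) (at_right 0)"
    unfolding cubic_param_def[abs_def] by (intro tendsto_intros) auto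
  thus "(cubic_param \<longlongrightarrow> 1) (at_right 0)" by simp
  have "eventually (\<lambda>t::real. t \<in> {0<..<pi/6}) (at_right 0)"
    by (rule eventually_at_right_real) simp
  thus "\<forall>\<^sub>F x in at_right 0. cubic_param x \<in> {..<1} \<and> cubic_param x \<noteq> 1"
    by eventually_elim (use cubic_param_bounds in fastforce)
qed

lemma filterlim_cubic_param_pi_6: "filterlim cubic_param (at_right 0) (at_left (pi / 6))"
  unfolding filterlim_at
proof
  have "(cubic_param \<longlongrightarrow> (cos (pi/6) - sqrt 3 * sin (pi/6)) / (cos (pi/6) + sqrt 3 * sin (pi/6))) (at_left (pi/6))"
    unfolding cubic_param_def[abs_def] by (intro tendsto_intros) (auto simp: sin_30 cos_30)
  thus "(cubic_param \<longlongrightarrow> 0) (at_left (pi/6))" by (simp add: sin_30 cos_30)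
  have "eventually (\<lambda>t::real. t \<in> {0<..<pi/6}) (at_left (pi/6))"
    by (rule eventually_at_left_real) simp
  thus "\<forall>\<^sub>F x in at_left (pi/6). cubic_param x \<in> {0<..} \<and> cubic_param x \<noteq> 0"
    by eventually_elim (use cubic_param_bounds in fastforce)
qed

lemma deriv_cubic_param:
  assumes "0 < \<theta>" "\<theta> < pi / 6"
  shows "(cubic_param has_real_derivative - 2 * sqrt 3 / (cos \<theta> + sqrt 3 * sin \<theta>) ^ 2) (at \<theta>)"
proof -
  define C S r where "C = cos \<theta>" and "S = sin \<theta>" and "r = sqrt 3"
  have rel: "C ^ 2 + S ^ 2 = 1" "r ^ 2 = 3" by (auto simp: C_def S_def r_def)
  have "(cubic_param has_real_derivative ((- S - r * C) * (C + r * S) - (C - r * S) * (- S + r * C)) / ((C + r * S) * (C + r * S))) (at \<theta>)"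
    unfolding cubic_param_def[abs_def] C_def S_def r_def
    by (rule derivative_eq_intros refl)+ (use cubic_param_denominator_pos[OF assms] in \<open>auto simp: mult.commute\<close>)
  also have "(- S - r * C) * (C + r * S) - (C - r * S) * (- S + r * C) = - 2 * r"
    using rel by algebra
  finally show ?thesis by (simp add: C_def S_def r_def power2_eq_square)
qed

lemma pole_form_of_real:
  "pole_form 0 (- 1) 1 (of_real t) = - \<i> * sqrt 3 / of_real (1 + t + t ^ 2)"
proof -
  have nz: "complex_of_real t - omega \<noteq> 0" "complex_of_real t - omega ^ 2 \<noteq> 0"
    using of_real_ne_omega[of t] by auto
  have p: "(complex_of_real t - omega) * (complex_of_real t - omega ^ 2) = of_real (1 + t + t ^ 2)"
    using omega_relation by (simp add: algebra_simps) algebra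
  have d: "omega ^ 2 - omega = - \<i> * sqrt 3"
    by (simp add: omega_sq) (simp add: omega_def complex_eq_iff)
  have "pole_form 0 (- 1) 1 (of_real t) = (omega ^ 2 - omega) / ((complex_of_real t - omega) * (complex_of_real t - omega ^ 2))"
    using nz by (simp add: pole_form_def of_rat_minus field_simps)
  thus ?thesis by (simp only: p d)
qed

text \<open>\<open>1 + w + w ^ 2\<close> equals 3 over the square of the denominator of
  \<open>cubic_param\<close>, so all dependence on \<theta> cancels and the form pulls back to 2 i
  d\<theta>. The measure d\<theta> thereby becomes a letter of the iterated integral, at the price
  of a factor i.\<close>

lemma pole_form_cubic_param:
  assumes "0 < \<theta>" "\<theta> < pi / 6"
  shows "pole_form 0 (- 1) 1 (of_real (cubic_param \<theta>)) * of_real (- 2 * sqrt 3 / (cos \<theta> + sqrt 3 * sin \<theta>) ^ 2) = 2 * \<i>"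
proof -
  define C S r where "C = cos \<theta>" and "S = sin \<theta>" and "r = sqrt 3"
  have rel: "C ^ 2 + S ^ 2 = 1" "r ^ 2 = 3" by (auto simp: C_def S_def r_def)
  have pos: "C + r * S > 0" using cubic_param_denominator_pos[OF assms] by (simp add: C_def S_def r_def)
  have "1 + cubic_param \<theta> + cubic_param \<theta> ^ 2 = ((C + r * S) ^ 2 + (C - r * S) * (C + r * S) + (C - r * S) ^ 2) / (C + r * S) ^ 2"
    using pos by (simp add: cubic_param_def C_def S_def r_def power_divide add_divide_distrib power2_eq_square)
  also have "(C + r * S) ^ 2 + (C - r * S) * (C + r * S) + (C - r * S) ^ 2 = 3"
    using rel by algebra
  finally have *: "1 + cubic_param \<theta> + cubic_param \<theta> ^ 2 = 3 / (C + r * S) ^ 2" .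
  have "pole_form 0 (- 1) 1 (of_real (cubic_param \<theta>)) * of_real (- 2 * r / (C + r * S) ^ 2) =
     - \<i> * of_real (r * (- 2 * r / (C + r * S) ^ 2) / (3 / (C + r * S) ^ 2))"
  proof -
    have "(- \<i> * of_real r / of_real a) * of_real x = - \<i> * of_real (r * x / a)" for a x by simp
    thus ?thesis unfolding pole_form_of_real * r_def .
  qed
  also have "r * (- 2 * r / (C + r * S) ^ 2) / (3 / (C + r * S) ^ 2) = - 2 * r ^ 2 / 3"
    using pos by (simp add: power2_eq_square)
  finally show ?thesis by (simp add: rel C_def S_def r_def)
qed

text \<open>Written in \<open>Y\<close>, the parameter is a Moebius transform of the unit circle.
  This makes the values of both rational functions along the path a matter of polynomial algebra in
  \<open>c\<close> and \<open>Y\<close>.\<close>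

lemma cubic_param_eq:
  fixes \<theta> :: real
  defines "c \<equiv> Complex (1 / 2) (sqrt 3 / 2)" and "Y \<equiv> cis (2 * \<theta>)"
  assumes "0 < \<theta>" "\<theta> < pi / 6"
  shows "c * Y - 1 \<noteq> 0" "of_real (cubic_param \<theta>) = (c - Y) / (c * Y - 1)"
proof -
  define C S r where "C = complex_of_real (cos \<theta>)" and "S = complex_of_real (sin \<theta>)" and "r = complex_of_real (sqrt 3)"
  have "C ^ 2 + S ^ 2 = of_real (cos \<theta> ^ 2 + sin \<theta> ^ 2)" by (simp only: C_def S_def of_real_add of_real_power)
  also have "\<dots> = 1" by (simp only: sin_cos_squared_add2 of_real_1)
  finally have rel1: "C ^ 2 + S ^ 2 = 1" .
  have "r ^ 2 = of_real (sqrt 3 ^ 2)" by (simp only: r_def of_real_power)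
  hence rel2: "r ^ 2 = 3" by simp
  have i2: "\<i> ^ 2 = - 1" by simp
  have Y: "Y = (C + \<i> * S) ^ 2"
    by (simp add: Y_def C_def S_def complex_eq_iff cos_double sin_double power2_eq_square)
  have c: "2 * c = 1 + \<i> * r"
    by (simp add: c_def r_def complex_eq_iff)
  have pos: "C + r * S \<noteq> 0"
  proof -
    have "C + r * S = of_real (cos \<theta> + sqrt 3 * sin \<theta>)" by (simp add: C_def S_def r_def)
    thus ?thesis using cubic_param_denominator_pos[OF assms(3,4)]
      by (metis less_irrefl of_real_eq_0_iff)
  qed
  have eq: "(c - Y) * (C + r * S) = (C - r * S) * (c * Y - 1)"
  proof -
    \<comment> \<open>Doubling allows \<open>2 * c\<close> to be replaced by
      \<open>1 + \<i> * r\<close>; the identity then follows from the three quadratic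
      relations.\<close>
    have "2 * ((c - Y) * (C + r * S)) - 2 * ((C - r * S) * (c * Y - 1)) = 0"
      unfolding Y using c rel1 rel2 i2 by algebra
    thus ?thesis by simp
  qed
  \<comment> \<open>A zero of the denominator would force \<open>c = Y\<close> through
    \<open>eq\<close>, which happens only at the excluded endpoint \<open>pi / 6\<close>.\<close>
  show nz: "c * Y - 1 \<noteq> 0"
  proof
    assume *: "c * Y - 1 = 0"
    hence "c = Y" using eq pos by simp
    hence "Im c = Im Y" by simp
    hence "sin (2 * \<theta>) = sin (pi / 3)" by (simp add: c_def Y_def sin_60)
    moreover have "sin (2 * \<theta>) < sin (pi / 3)"
      using assms by (intro sin_monotone_2pi) auto
    ultimately show False by simp
  qed
  have "of_real (cubic_param \<theta>) = (C - r * S) / (C + r * S)"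
    by (simp add: cubic_param_def C_def S_def r_def)
  thus "of_real (cubic_param \<theta>) = (c - Y) / (c * Y - 1)"
    by (simp only: frac_eq_eq[OF pos nz] eq)
qed

text \<open>The Moebius map takes 1, infinity and 0 to 1, \<open>omega\<close> and
  \<open>omega ^ 2\<close>. So the first difference vanishes at \<open>Y = 1\<close>, the second has
  constant numerator, and the third has numerator proportional to \<open>Y\<close>.\<close>

lemma cubic_param_differences:
  fixes \<theta> :: real
  defines "c \<equiv> Complex (1 / 2) (sqrt 3 / 2)" and "Y \<equiv> cis (2 * \<theta>)" and "t \<equiv> complex_of_real (cubic_param \<theta>)"
  assumes \<theta>: "0 < \<theta>" "\<theta> < pi / 6"
  shows "t - 1 = (1 + c) * (1 - Y) / (c * Y - 1)" "t - omega = c * (1 + c) / (c * Y - 1)"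
    "t - omega ^ 2 = Y * (c ^ 2 - 1) / (c * Y - 1)"
proof -
  have nz: "c * Y - 1 \<noteq> 0" and t: "t = (c - Y) / (c * Y - 1)"
    using cubic_param_eq[OF \<theta>] by (auto simp: c_def Y_def t_def)
  have c: "c ^ 2 = c - 1" by (simp add: c_def complex_eq_iff power2_eq_square)
  have w: "omega = c ^ 2" unfolding c by (simp add: omega_def c_def complex_eq_iff)
  show "t - 1 = (1 + c) * (1 - Y) / (c * Y - 1)"
    using nz by (simp add: t field_simps)
  show "t - omega = c * (1 + c) / (c * Y - 1)"
    unfolding t w using nz c by (simp add: divide_simps) algebra
  show "t - omega ^ 2 = Y * (c ^ 2 - 1) / (c * Y - 1)"
    unfolding t w using nz c by (simp add: divide_simps) algebra
qed

lemma circle_path_cubic_param: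
  assumes \<theta>: "0 < \<theta>" "\<theta> < pi / 6"
  shows "circle_path (of_real (cubic_param \<theta>)) = of_real ((2 * sin \<theta>) ^ 2)"
proof -
  define c Y where "c = Complex (1 / 2) (sqrt 3 / 2)" and "Y = cis (2 * \<theta>)"
  have nz: "c * Y - 1 \<noteq> 0" using cubic_param_eq[OF \<theta>] by (simp add: c_def Y_def)
  have c: "c ^ 2 = c - 1" by (simp add: c_def complex_eq_iff power2_eq_square)
  have c1: "1 + c \<noteq> 0" "c \<noteq> 0" "c ^ 2 - 1 \<noteq> 0" unfolding c by (auto simp: c_def complex_eq_iff)
  have Y0: "Y \<noteq> 0" by (simp add: Y_def)
  have "circle_path (of_real (cubic_param \<theta>)) = ((1 + c) * (1 - Y)) ^ 2 / ((c * (1 + c)) * (Y * (c ^ 2 - 1)))"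
  proof -
    have "((1 + c) * (1 - Y) / n) ^ 2 / ((c * (1 + c) / n) * (Y * (c ^ 2 - 1) / n)) =
        ((1 + c) * (1 - Y)) ^ 2 / ((c * (1 + c)) * (Y * (c ^ 2 - 1)))" if "n \<noteq> 0" for n
      using that by (simp add: power2_eq_square)
    from this[OF nz] show ?thesis
      unfolding circle_path_def power2_commute[of 1] cubic_param_differences[OF \<theta>] c_def Y_def .
  qed
  also have "\<dots> = - ((1 - Y) ^ 2 / Y)"
    using c1 Y0 c by (simp add: divide_simps) algebra
  also have "\<dots> = 2 - Y - cnj Y"
  proof -
    have "Y * cnj Y = 1" by (simp add: Y_def cis_cnj cis_mult)
    thus ?thesis using Y0 by (simp add: field_simps power2_eq_square)
  qed
  also have "\<dots> = of_real ((2 * sin \<theta>) ^ 2)"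
    by (simp add: Y_def complex_eq_iff cos_double_sin power2_eq_square)
  finally show ?thesis .
qed

lemma arc_path_cubic_param:
  assumes \<theta>: "0 < \<theta>" "\<theta> < pi / 6"
  shows "arc_path (of_real (cubic_param \<theta>)) = cis (- 2 * \<theta>) * (1 - cis (- 2 * \<theta>))"
proof -
  define c Y where "c = Complex (1 / 2) (sqrt 3 / 2)" and "Y = cis (2 * \<theta>)"
  have nz: "c * Y - 1 \<noteq> 0" using cubic_param_eq[OF \<theta>] by (simp add: c_def Y_def)
  have c: "c ^ 2 = c - 1" by (simp add: c_def complex_eq_iff power2_eq_square)
  have c1: "1 + c \<noteq> 0" "c \<noteq> 0" "c ^ 2 - 1 \<noteq> 0" unfolding c by (auto simp: c_def complex_eq_iff)
  have Y0: "Y \<noteq> 0" by (simp add: Y_def)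
  have "arc_path (of_real (cubic_param \<theta>)) = ((1 + c) * (1 - Y)) * (c * (1 + c)) / (Y * (c ^ 2 - 1)) ^ 2"
    using nz cubic_param_differences[OF \<theta>]
    by (simp add: arc_path_def c_def[symmetric] Y_def[symmetric] power2_eq_square)
  also have "\<dots> = (Y - 1) / Y ^ 2"
    using c1 Y0 c by (simp add: divide_simps) algebra
  also have "\<dots> = (1 / Y) * (1 - 1 / Y)"
    using Y0 by (simp add: field_simps power2_eq_square)
  also have "1 / Y = cis (- 2 * \<theta>)" by (simp add: Y_def cis_inverse divide_inverse)
  finally show ?thesis .
qed

text \<open>In the variable \<theta> the integrand is the pullback of the derivative of
  \<open>F\<close>, divided by 2 i. Hence only the two limits of \<open>F\<close> along the path
  matter.\<close>

lemma integral_multi_L_circle: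
  assumes A: "A \<noteq> []" "0 \<notin> set A" "hd A \<ge> 2"
  shows "complex_of_real (LBINT \<theta>:{0..pi/6}. multi_L A ((2 * sin \<theta>) ^ 2)) \<in> (*) \<i> ` MPL_space (Suc (sum_list A)) 3"
proof -
  \<comment> \<open>The coefficients are an arbitrary choice, as only the power \<open>l ^ 0\<close>
    enters.\<close>
  obtain l where l: "l 0 = 0" "\<And>z. norm z < 1 \<Longrightarrow> (l has_field_derivative pole_form 1 1 1 z) (at z)"
    using polylog_span_log_form[of 1 1 1] by metis
  obtain F v where v: "v \<in> MPL_space (Suc (sum_list A)) 3"
    and F: "\<And>t::real. 0 < t \<Longrightarrow> t < 1 \<Longrightarrow> (F has_field_derivative
         pole_form 0 (- 1) 1 t * polylog (ones A) (circle_path t)) (at (of_real t))"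
    and F0: "((\<lambda>t::real. F t) \<longlongrightarrow> 0) (at_right 0)" and F1: "((\<lambda>t::real. F t) \<longlongrightarrow> v) (at_left 1)"
    using circle.iterated_integral_value[OF l A(2), where m = 0] by auto
  define L where "L \<theta> = polylog (ones A) (of_real ((2 * sin \<theta>) ^ 2))" for \<theta> :: real
  have range: "0 \<le> (2 * sin \<theta>) ^ 2" "(2 * sin \<theta>) ^ 2 < 1" if "0 < \<theta>" "\<theta> < pi / 6" for \<theta>
    using sin_cos_bounds[OF that] power_strict_mono[of "2 * sin \<theta>" 1 2] by auto
  obtain M where M: "\<And>z. norm z < 1 \<Longrightarrow> norm (polylog (ones A) z) \<le> M"
    using norm_polylog_ones_bounded[of A] A by auto
  \<comment> \<open>\<open>cubic_param\<close> runs from 1 down to 0, so \<open>F\<close> tends to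
    \<open>v\<close> at the lower end and to 0 at the upper end, which gives the sign.\<close>
  have "(LBINT \<theta>:{0..pi/6}. 2 * \<i> * L \<theta>) = 0 - v"
  proof (rule integral_eq_limit_difference)
    fix \<theta> :: real assume \<theta>: "0 < \<theta>" "\<theta> < pi / 6"
    have "((\<lambda>x. complex_of_real (cubic_param x)) has_vector_derivative
         of_real (- 2 * sqrt 3 / (cos \<theta> + sqrt 3 * sin \<theta>) ^ 2)) (at \<theta>)"
      using deriv_cubic_param[OF \<theta>] by (intro has_vector_derivative_of_real) (simp add: has_real_derivative_iff_has_vector_derivative)
    from field_vector_diff_chain_at[OF this F[OF cubic_param_bounds[OF \<theta>]]]
    have "((\<lambda>x. F (of_real (cubic_param x))) has_vector_derivative
       (pole_form 0 (- 1) 1 (of_real (cubic_param \<theta>)) * of_real (- 2 * sqrt 3 / (cos \<theta> + sqrt 3 * sin \<theta>) ^ 2)) *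
          polylog (ones A) (circle_path (of_real (cubic_param \<theta>)))) (at \<theta>)"
      by (simp add: o_def mult_ac)
    thus "((\<lambda>x. F (of_real (cubic_param x))) has_vector_derivative 2 * \<i> * L \<theta>) (at \<theta>)"
      unfolding pole_form_cubic_param[OF \<theta>] circle_path_cubic_param[OF \<theta>] L_def .
    have "norm (complex_of_real ((2 * sin \<theta>) ^ 2)) < 1" using range[OF \<theta>] by (simp only: norm_of_real abs_of_nonneg)
    from M[OF this] show "norm (2 * \<i> * L \<theta>) \<le> 2 * M"
      by (simp add: L_def norm_mult)
  next
    have "isCont L \<theta>" if \<theta>: "0 < \<theta>" "\<theta> < pi / 6" for \<theta>
    proof -
      have "norm (complex_of_real ((2 * sin \<theta>) ^ 2)) < 1" using range[OF \<theta>] by (simp only: norm_of_real abs_of_nonneg)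
      hence "isCont (polylog (ones A)) (of_real ((2 * sin \<theta>) ^ 2))"
        by (rule DERIV_isCont[OF has_field_derivative_polylog, rotated]) (use A in simp)
      moreover have "isCont (\<lambda>\<theta>. complex_of_real ((2 * sin \<theta>) ^ 2)) \<theta>"
        by (intro continuous_intros)
      ultimately show ?thesis unfolding L_def[abs_def]
        using isCont_o2[of \<theta> "\<lambda>\<theta>. complex_of_real ((2 * sin \<theta>) ^ 2)" "polylog (ones A)"] by blast
    qed
    thus "continuous_on {0<..<pi/6} (\<lambda>\<theta>. 2 * \<i> * L \<theta>)"
      by (intro continuous_intros) (simp add: continuous_on_eq_continuous_at)
    show "((\<lambda>x. F (of_real (cubic_param x))) \<longlongrightarrow> v) (at_right 0)"
      by (rule filterlim_compose[OF F1 filterlim_cubic_param_0])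
    show "((\<lambda>x. F (of_real (cubic_param x))) \<longlongrightarrow> 0) (at_left (pi/6))"
      by (rule filterlim_compose[OF F0 filterlim_cubic_param_pi_6])
  qed auto
  moreover have "(LBINT \<theta>:{0..pi/6}. 2 * \<i> * L \<theta>) = (LBINT \<theta>:{0..pi/6}. 2 * \<i> * of_real (multi_L A ((2 * sin \<theta>) ^ 2)))"
  proof (rule set_integral_cong_Ioo)
    fix \<theta> :: real assume \<theta>: "0 < \<theta>" "\<theta> < pi / 6"
    show "2 * \<i> * L \<theta> = 2 * \<i> * of_real (multi_L A ((2 * sin \<theta>) ^ 2))"
      using multi_L_eq_polylog[OF A(1,2) range[OF \<theta>]] by (simp add: L_def)
  qed
  ultimately have "2 * \<i> * of_real (LBINT \<theta>:{0..pi/6}. multi_L A ((2 * sin \<theta>) ^ 2)) = - v"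
    by (simp add: set_integral_complex_of_real)
  hence "of_real (LBINT \<theta>:{0..pi/6}. multi_L A ((2 * sin \<theta>) ^ 2)) = \<i> * (of_rat (1 / 2) * v)"
    by (simp add: of_rat_divide field_simps complex_eq_iff)
  thus ?thesis using MPL_space_scale[OF v, of "1 / 2"] by blast
qed

section \<open>The integral over large angles\<close>

text \<open>A star-shaped domain on which the polylogarithm in q (1 - q) is analytic and both q and
  1 - q have positive real part, so that principal logarithms apply. It contains the open arc, the
  open part of the line that is used, and the real segment, but not the corners
  \<open>e^(-i pi/3)\<close> and 1.\<close>

definition lens :: "complex set"
  where "lens = {q. norm (q * (1 - q)) < 1 \<and> 0 < Re q \<and> Re q < 1}"

text \<open>The branch of log (q (1 - q)) that is real on the real segment and on the line Re q =
  1/2.\<close>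

definition log_lens :: "complex \<Rightarrow> complex"
  where "log_lens q = Ln q + Ln (1 - q)"

definition lens_integrand :: "nat \<Rightarrow> nat list \<Rightarrow> complex \<Rightarrow> complex"
  where "lens_integrand m A q = log_lens q ^ m * polylog (ones A) (q * (1 - q)) / q"

lemma open_lens: "open lens"
  unfolding lens_def by (intro open_Collect_conj open_Collect_less continuous_intros)

text \<open>Centred at 1/2, q (1 - q) is 1/4 - (q - 1/2)^2. Shrinking towards the centre by
  \<open>u\<close> therefore replaces it by its convex combination with 1/4, of weight
  \<open>u ^ 2\<close>, and the disc condition survives.\<close>

lemma starlike_lens: "starlike lens"
  unfolding starlike_def
proof (intro bexI[of _ "1/2"] ballI subsetI)
  show "1 / 2 \<in> lens" by (simp add: lens_def norm_mult)
  fix x y assume x: "x \<in> lens" and "y \<in> closed_segment (1 / 2) x"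
  then obtain u where u: "0 \<le> u" "u \<le> 1" and y: "y = (1 - u) *\<^sub>R (1 / 2) + u *\<^sub>R x"
    by (auto simp: closed_segment_def)
  have "y * (1 - y) = of_real ((1 - u ^ 2) / 4) + of_real (u ^ 2) * (x * (1 - x))"
    unfolding y scaleR_conv_of_real by (simp add: field_simps power2_eq_square)
  also have "norm \<dots> \<le> norm (complex_of_real ((1 - u ^ 2) / 4)) + norm (of_real (u ^ 2) * (x * (1 - x)))"
    by (rule norm_triangle_ineq)
  also have "\<dots> = (1 - u ^ 2) / 4 + u ^ 2 * norm (x * (1 - x))"
    using u unfolding norm_mult norm_of_real by (simp add: power_le_one)
  also have "\<dots> < 1"
  proof (cases "u = 0")
    case False
    have "u ^ 2 * norm (x * (1 - x)) < u ^ 2 * 1"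
      using x False by (intro mult_strict_left_mono) (auto simp: lens_def)
    moreover have "u ^ 2 \<le> 1" using u by (simp add: power_le_one)
    ultimately show ?thesis by (simp add: field_simps)
  qed auto
  finally have "norm (y * (1 - y)) < 1" .
  moreover have "0 < Re y \<and> Re y < 1"
  proof (cases "u = 0")
    case False
    have "u * (Re x - 1 / 2) < u * (1 / 2)" "u * (- 1 / 2) < u * (Re x - 1 / 2)"
      using x u False by (intro mult_strict_left_mono; simp add: lens_def)+
    moreover have "Re y = 1 / 2 + u * (Re x - 1 / 2)" by (simp add: y algebra_simps)
    ultimately show ?thesis using u by linarith
  qed (simp add: y)
  ultimately show "y \<in> lens" by (simp add: lens_def)
qed

lemma lens_not_nonpos:
  assumes "q \<in> lens"
  shows "q \<notin> \<real>\<^sub>\<le>\<^sub>0" "1 - q \<notin> \<real>\<^sub>\<le>\<^sub>0"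
  using assms by (auto simp: lens_def complex_nonpos_Reals_iff)

lemma lens_integrand_differentiable:
  assumes "q \<in> lens" "0 \<notin> set A"
  shows "lens_integrand m A field_differentiable (at q)"
proof -
  have q0: "q \<noteq> 0" using assms by (auto simp: lens_def)
  have "polylog (ones A) field_differentiable (at (q * (1 - q)))"
    using has_field_derivative_polylog[of "ones A" "q * (1 - q)"] assms
    by (auto simp: field_differentiable_def lens_def)
  moreover have "(\<lambda>q. q * (1 - q)) field_differentiable (at q)"
    by (intro derivative_intros)
  ultimately have "(polylog (ones A) \<circ> (\<lambda>q. q * (1 - q))) field_differentiable (at q)"
    by (intro field_differentiable_compose)
  moreover have "(\<lambda>q. Ln q) field_differentiable (at q)"
    by (rule field_differentiable_at_Ln[OF lens_not_nonpos(1)[OF assms(1)]])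
  moreover have "(Ln \<circ> (\<lambda>q. 1 - q)) field_differentiable (at q)"
    by (intro field_differentiable_compose derivative_intros field_differentiable_at_Ln lens_not_nonpos assms)
  ultimately show ?thesis
    unfolding lens_integrand_def[abs_def] log_lens_def o_def using q0
    by (intro derivative_intros) auto
qed

text \<open>A single-valued primitive replaces the deformation of the contour: the integrals along
  line, segment and arc all become differences of values of one function.\<close>

lemma lens_primitive:
  assumes "0 \<notin> set A"
  obtains \<Phi> where "\<And>q. q \<in> lens \<Longrightarrow> (\<Phi> has_field_derivative lens_integrand m A q) (at q)"
proof -
  have "continuous_on lens (lens_integrand m A)"
    using lens_integrand_differentiable[OF _ assms] field_differentiable_imp_continuous_at
    by (intro continuous_at_imp_continuous_on) blast
  from holomorphic_starlike_primitive[OF this starlike_lens open_lens, of "{}"]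
  show ?thesis using lens_integrand_differentiable[OF _ assms] that by auto
qed

lemma norm_Ln_le: "q \<noteq> 0 \<Longrightarrow> norm (Ln q) \<le> \<bar>ln (norm q)\<bar> + 4"
proof -
  assume "q \<noteq> 0"
  hence "\<bar>Im (Ln q)\<bar> \<le> pi" "Re (Ln q) = ln (norm q)"
    using mpi_less_Im_Ln[of q] Im_Ln_le_pi[of q] by (auto simp: abs_le_iff)
  thus ?thesis using cmod_le[of "Ln q"] pi_less_4 by linarith
qed

text \<open>In the region between line, segment and arc, \<open>norm q\<close> is at least 1/2 and
  \<open>norm (1 - q) \<le> norm q\<close>, so only the logarithm of \<open>1 - q\<close> can be
  large. The parameter \<open>d\<close> bounds the distance from 1 from below.\<close>

lemma norm_lens_integrand_le:
  assumes "0 \<notin> set A" "A = [] \<or> hd A \<ge> 2"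
  shows "\<exists>M\<ge>0. \<forall>q d. q \<in> lens \<longrightarrow> Re q \<ge> 1 / 2 \<longrightarrow> norm q \<le> 1 \<longrightarrow> 0 < d \<longrightarrow> d \<le> norm (1 - q) \<longrightarrow>
    norm (lens_integrand m A q) \<le> M * (9 - ln d) ^ m"
proof -
  obtain M where M: "\<And>z. norm z < 1 \<Longrightarrow> norm (polylog (ones A) z) \<le> M"
    using norm_polylog_ones_bounded[OF assms] by auto
  have M0: "M \<ge> 0" using order_trans[OF norm_ge_zero M[of 0]] by simp
  have "norm (lens_integrand m A q) \<le> 2 * M * (9 - ln d) ^ m"
    if q: "q \<in> lens" "Re q \<ge> 1 / 2" "norm q \<le> 1" and d: "0 < d" "d \<le> norm (1 - q)" for q d
  proof -
    have q0: "q \<noteq> 0" "1 - q \<noteq> 0" using q(1) by (auto simp: lens_def)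
    have nq: "1 / 2 \<le> norm q" using q(2) complex_Re_le_cmod[of q] by linarith
    have "norm (1 - q) ^ 2 \<le> norm q ^ 2"
      unfolding cmod_power2 using q(2) by (simp add: power2_eq_square algebra_simps)
    hence n1: "norm (1 - q) \<le> 1" using q(3) power2_le_imp_le[of "norm (1 - q)" "norm q"] by simp
    have "ln (1 / 2) \<le> ln (norm q)" using nq q0 by (intro ln_mono) auto
    moreover have "ln (1 / 2 :: real) \<ge> - 1" using ln_2_less_1 by (simp add: ln_div)
    moreover have "ln (norm q) \<le> 0" using q(3) q0 by simp
    ultimately have a: "\<bar>ln (norm q)\<bar> \<le> 1" by linarith
    have "ln d \<le> ln (norm (1 - q))" using d by (intro ln_mono) auto
    moreover have "ln (norm (1 - q)) \<le> 0" using n1 q0 by simp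
    ultimately have b: "\<bar>ln (norm (1 - q))\<bar> \<le> - ln d" by linarith
    have "norm (log_lens q) \<le> norm (Ln q) + norm (Ln (1 - q))"
      unfolding log_lens_def by (rule norm_triangle_ineq)
    \<comment> \<open>The 9 is 1 for the logarithm of \<open>norm q\<close> plus 4 for each of the
      two imaginary parts, which are at most pi.\<close>
    also have "\<dots> \<le> 9 - ln d" using norm_Ln_le[OF q0(1)] norm_Ln_le[OF q0(2)] a b by linarith
    finally have c: "norm (log_lens q) \<le> 9 - ln d" .
    have "norm (lens_integrand m A q) = norm (log_lens q) ^ m * norm (polylog (ones A) (q * (1 - q))) / norm q"
      by (simp add: lens_integrand_def norm_mult norm_divide norm_power)
    also have "\<dots> \<le> (9 - ln d) ^ m * M / (1 / 2)"
      using c nq M0 M[of "q * (1 - q)"] q(1) order_trans[OF norm_ge_zero c]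
      by (intro frac_le mult_mono power_mono) (auto simp: lens_def)
    finally show ?thesis by (simp add: mult_ac)
  qed
  thus ?thesis using M0 by (intro exI[of _ "2 * M"]) auto
qed

lemma lens_primitive_increment:
  assumes \<Phi>: "\<And>q. q \<in> lens \<Longrightarrow> (\<Phi> has_field_derivative f q) (at q)"
    and S: "closed_segment p q \<subseteq> lens" and B: "\<And>x. x \<in> closed_segment p q \<Longrightarrow> norm (f x) \<le> B"
  shows "norm (\<Phi> p - \<Phi> q) \<le> B * norm (p - q)"
  by (rule field_differentiable_bound[of "closed_segment p q" \<Phi> f])
     (use assms in \<open>auto intro: has_field_derivative_at_within\<close>)

lemma ln_power_le_inverse_sqrt:
  assumes "0 < s" "s \<le> 1 / 2"
  shows "(9 - ln (2 * s ^ 2)) ^ m \<le> 4 ^ m * fact m * exp (9 / 4) / sqrt s"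
proof -
  \<comment> \<open>The quarter is chosen so that \<open>exp y\<close> is a constant over
    \<open>sqrt s\<close>; comparing \<open>y ^ m / fact m\<close> with the exponential series then
    bounds any power of the logarithm.\<close>
  define y where "y = (9 - 2 * ln s) / 4"
  have ls: "ln s \<le> 0" using assms by simp
  have y0: "y \<ge> 0" using ls by (simp add: y_def)
  have "ln (2 * s ^ 2) = ln 2 + 2 * ln s" using assms by (simp add: ln_mult ln_realpow)
  moreover have "ln (2 * s ^ 2) \<le> 0"
  proof -
    have "s ^ 2 \<le> (1 / 2) ^ 2" using assms by (intro power_mono) auto
    hence "2 * s ^ 2 \<le> 1" by (simp add: power2_eq_square)
    thus ?thesis using assms by simp
  qed
  ultimately have "(9 - ln (2 * s ^ 2)) ^ m \<le> (4 * y) ^ m"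
    by (intro power_mono) (auto simp: y_def)
  also have "\<dots> = 4 ^ m * fact m * (y ^ m / fact m)" by (simp add: power_mult_distrib)
  also have "y ^ m / fact m \<le> exp y"
  proof -
    have "(\<Sum>n\<in>{m}. y ^ n /\<^sub>R fact n) \<le> (suminf (\<lambda>n. y ^ n /\<^sub>R fact n))"
      by (rule sum_le_suminf) (use summable_exp_generic[of y] y0 in auto)
    thus ?thesis by (simp add: exp_def divide_inverse mult.commute)
  qed
  also have "exp y = exp (9 / 4) / sqrt s"
  proof -
    have "y = 9 / 4 - ln (sqrt s)" using assms by (simp add: y_def ln_sqrt)
    thus ?thesis using assms by (simp add: exp_diff)
  qed
  finally show ?thesis by (simp add: mult_left_mono)
qed

text \<open>At the corners \<open>e^(-i pi/3)\<close> and \<open>1\<close> of the region between line, segment and arc the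
  primitive need not be defined, but its increments along short vertical or horizontal segments
  near the corner vanish in the limit.\<close>

lemma tendsto_corner:
  assumes \<Phi>: "\<And>q. q \<in> lens \<Longrightarrow> (\<Phi> has_field_derivative lens_integrand m A q) (at q)"
    and A: "0 \<notin> set A" "A = [] \<or> hd A \<ge> 2"
  shows "((\<lambda>\<theta>. \<Phi> (Complex (1 / 2) (- sin (2 * \<theta>))) - \<Phi> (cis (- 2 * \<theta>))) \<longlongrightarrow> 0) (at_left (pi / 6))"
proof -
  obtain M where M: "M \<ge> 0" "\<And>q d. q \<in> lens \<Longrightarrow> Re q \<ge> 1 / 2 \<Longrightarrow> norm q \<le> 1 \<Longrightarrow> 0 < d \<Longrightarrow> d \<le> norm (1 - q) \<Longrightarrow>
    norm (lens_integrand m A q) \<le> M * (9 - ln d) ^ m"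
    using norm_lens_integrand_le[OF A, of m] by blast
  have "((\<lambda>\<theta>. (M * (9 - ln (1 / 2)) ^ m) * (cos (2 * \<theta>) - 1 / 2)) \<longlongrightarrow> 
          (M * (9 - ln (1 / 2)) ^ m) * (cos (2 * (pi / 6)) - 1 / 2)) (at_left (pi / 6))"
    by (intro tendsto_intros)
  hence lim: "((\<lambda>\<theta>. (M * (9 - ln (1 / 2)) ^ m) * (cos (2 * \<theta>) - 1 / 2)) \<longlongrightarrow> 0) (at_left (pi / 6))"
    by (simp add: cos_60)
  have "eventually (\<lambda>\<theta>. \<theta> \<in> {pi/12<..<pi/6}) (at_left (pi / 6))"
    by (rule eventually_at_left_real) simp
  hence "\<forall>\<^sub>F \<theta> in at_left (pi / 6). norm (\<Phi> (Complex (1 / 2) (- sin (2 * \<theta>))) - \<Phi> (cis (- 2 * \<theta>))) \<le>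
      (M * (9 - ln (1 / 2)) ^ m) * (cos (2 * \<theta>) - 1 / 2)"
  proof eventually_elim
    case (elim \<theta>)
    define x y where "x = cos (2 * \<theta>)" and "y = sin (2 * \<theta>)"
    have xy: "x ^ 2 + y ^ 2 = 1" by (simp add: x_def y_def)
    have x: "1 / 2 < x" "x < 1"
      using elim cos_monotone_0_pi[of "2 * \<theta>" "pi / 3"] cos_monotone_0_pi[of 0 "2 * \<theta>"]
      by (auto simp: x_def cos_60)
    have y: "1 / 2 < y" "y < sqrt 3 / 2"
      using elim sin_monotone_2pi[of "2 * \<theta>" "pi / 3"] sin_monotone_2pi[of "pi / 6" "2 * \<theta>"]
      by (auto simp: y_def sin_60 sin_30)
    have y2: "y ^ 2 < 3 / 4"
      using power_strict_mono[of y "sqrt 3 / 2" 2] y by (simp add: power_divide)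
    \<comment> \<open>The horizontal segment from the line to the arc stays at distance at least
      \<open>y > 1 / 2\<close> from 1. The integrand is bounded on it while its length
      \<open>x - 1 / 2\<close> shrinks to 0.\<close>
    have seg: "s \<in> lens \<and> 1 / 2 \<le> Re s \<and> norm s \<le> 1 \<and> 1 / 2 \<le> norm (1 - s)"
      if "s \<in> closed_segment (Complex (1 / 2) (- y)) (Complex x (- y))" for s
    proof -
      from that obtain r where r: "0 \<le> r" "r \<le> 1"
        and s: "s = (1 - r) *\<^sub>R (Complex (1 / 2) (- y)) + r *\<^sub>R (Complex x (- y))"
        by (auto simp: closed_segment_def)
      define u where "u = (1 - r) * (1 / 2) + r * x"
      have s': "s = Complex u (- y)" by (simp add: s u_def complex_eq_iff algebra_simps diff_divide_distrib)
      have "u = 1 / 2 + r * (x - 1 / 2)" by (simp add: u_def algebra_simps diff_divide_distrib)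
      moreover have "0 \<le> r * (x - 1 / 2)" "r * (x - 1 / 2) \<le> 1 * (x - 1 / 2)"
        using r x by (auto intro!: mult_nonneg_nonneg mult_right_mono)
      ultimately have u: "1 / 2 \<le> u" "u \<le> x" by auto
      have "u ^ 2 \<le> x ^ 2" using u by (intro power_mono) auto
      hence ns: "norm s ^ 2 \<le> 1" using xy by (simp add: s' cmod_power2)
      have "(1 - u) ^ 2 \<le> (1 / 2) ^ 2" using u x by (intro power_mono) auto
      hence ns1: "norm (1 - s) ^ 2 < 1" using y2 by (simp add: s' cmod_power2 power_divide)
      have n: "norm s \<le> 1" "norm (1 - s) < 1"
        using ns ns1 power2_le_imp_le[of "norm s" 1] power2_less_imp_less[of "norm (1 - s)" 1] by auto
      have "norm (s * (1 - s)) < 1"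
        unfolding norm_mult using n mult_left_le_one_le[of "norm (1 - s)" "norm s"] by simp
      moreover have "y \<le> norm (1 - s)" using abs_Im_le_cmod[of "1 - s"] y by (simp add: s')
      ultimately show ?thesis using u x y n by (auto simp: lens_def s')
    qed
    have "norm (\<Phi> (Complex (1 / 2) (- y)) - \<Phi> (Complex x (- y))) \<le> (M * (9 - ln (1 / 2)) ^ m) * norm (Complex (1 / 2) (- y) - Complex x (- y))"
      by (rule lens_primitive_increment[OF \<Phi>]) (use seg M(2)[where d = "1 / 2"] in auto)
    moreover have "norm (Complex (1 / 2) (- y) - Complex x (- y)) = x - 1 / 2"
      using x by (simp add: cmod_def)
    moreover have "cis (- 2 * \<theta>) = Complex x (- y)" by (simp add: x_def y_def complex_eq_iff)
    ultimately show ?case by (simp add: x_def y_def)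
  qed
  thus ?thesis using lim by (rule Lim_null_comparison)
qed


text \<open>The vertical segment has length at most \<open>2 * sin \<theta>\<close>, but the
  integrand is no longer bounded: the segment keeps only the distance
  \<open>2 * sin \<theta> ^ 2\<close> from 1. The power of the logarithm costs at most
  \<open>1 / sqrt (sin \<theta>)\<close>, and \<open>sqrt (sin \<theta>)\<close> is left
  over.\<close>

lemma tendsto_corner_one:
  assumes \<Phi>: "\<And>q. q \<in> lens \<Longrightarrow> (\<Phi> has_field_derivative lens_integrand m A q) (at q)"
    and A: "0 \<notin> set A" "A = [] \<or> hd A \<ge> 2"
  shows "((\<lambda>\<theta>. \<Phi> (of_real (cos (2 * \<theta>))) - \<Phi> (cis (- 2 * \<theta>))) \<longlongrightarrow> 0) (at_right 0)"
proof -
  obtain M where M: "M \<ge> 0" "\<And>q d. q \<in> lens \<Longrightarrow> Re q \<ge> 1 / 2 \<Longrightarrow> norm q \<le> 1 \<Longrightarrow> 0 < d \<Longrightarrow> d \<le> norm (1 - q) \<Longrightarrow>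
    norm (lens_integrand m A q) \<le> M * (9 - ln d) ^ m"
    using norm_lens_integrand_le[OF A, of m] by blast
  define K where "K = 2 * M * (4 ^ m * fact m * exp (9 / 4))"
  have "((\<lambda>\<theta>. K * sqrt (sin \<theta>)) \<longlongrightarrow> K * sqrt (sin 0)) (at_right 0)"
    by (intro tendsto_intros)
  hence lim: "((\<lambda>\<theta>. K * sqrt (sin \<theta>)) \<longlongrightarrow> 0) (at_right 0)" by simp
  have "eventually (\<lambda>\<theta>. \<theta> \<in> {0<..<pi/6}) (at_right 0)"
    by (rule eventually_at_right_real) simp
  hence "\<forall>\<^sub>F \<theta> in at_right 0. norm (\<Phi> (of_real (cos (2 * \<theta>))) - \<Phi> (cis (- 2 * \<theta>))) \<le> K * sqrt (sin \<theta>)"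
  proof eventually_elim
    case (elim \<theta>)
    define x y where "x = cos (2 * \<theta>)" and "y = sin (2 * \<theta>)"
    have sc: "0 < sin \<theta>" "sin \<theta> < 1 / 2" using sin_cos_bounds[of \<theta>] elim by auto
    have xy: "x ^ 2 + y ^ 2 = 1" by (simp add: x_def y_def)
    have x': "x = 1 - 2 * sin \<theta> ^ 2" by (simp add: x_def cos_double_sin)
    have s2: "sin \<theta> ^ 2 < 1 / 4" using power_strict_mono[of "sin \<theta>" "1 / 2" 2] sc by (simp add: power_divide)
    have x: "1 / 2 < x" "x < 1" using s2 sc by (auto simp: x')
    have y: "0 < y" "y \<le> 2 * sin \<theta>"
    proof -
      show "0 < y" unfolding y_def using elim by (intro sin_gt_zero) auto
      have "sin \<theta> * cos \<theta> \<le> sin \<theta> * 1" using sc by (intro mult_left_mono) auto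
      thus "y \<le> 2 * sin \<theta>" by (simp add: y_def sin_double)
    qed
    have seg: "s \<in> lens \<and> 1 / 2 \<le> Re s \<and> norm s \<le> 1 \<and> 2 * sin \<theta> ^ 2 \<le> norm (1 - s)"
      if "s \<in> closed_segment (of_real x) (Complex x (- y))" for s
    proof -
      from that obtain r where r: "0 \<le> r" "r \<le> 1"
        and s: "s = (1 - r) *\<^sub>R (of_real x) + r *\<^sub>R (Complex x (- y))"
        by (auto simp: closed_segment_def)
      have s': "s = Complex x (- (r * y))" by (simp add: s complex_eq_iff algebra_simps)
      have "r * y \<le> 1 * y" using r y by (intro mult_right_mono) auto
      hence ry: "(r * y) ^ 2 \<le> y ^ 2" using r y by (intro power_mono) auto
      hence ns: "norm s ^ 2 \<le> 1" using xy by (simp add: s' cmod_power2)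
      have "norm (1 - s) ^ 2 \<le> (1 - x) ^ 2 + y ^ 2" using ry by (simp add: s' cmod_power2)
      also have "\<dots> = 2 - 2 * x" using xy by (simp add: power2_eq_square algebra_simps)
      also have "\<dots> < 1" using x by simp
      finally have n: "norm s \<le> 1" "norm (1 - s) < 1"
        using ns power2_le_imp_le[of "norm s" 1] power2_less_imp_less[of "norm (1 - s)" 1] by auto
      have "norm (s * (1 - s)) < 1"
        unfolding norm_mult using n mult_left_le_one_le[of "norm (1 - s)" "norm s"] by simp
      moreover have "2 * sin \<theta> ^ 2 \<le> norm (1 - s)"
        using complex_Re_le_cmod[of "1 - s"] by (simp add: s' x')
      ultimately show ?thesis using x n by (auto simp: lens_def s')
    qed
    have "norm (\<Phi> (of_real x) - \<Phi> (Complex x (- y))) \<le> (M * (9 - ln (2 * sin \<theta> ^ 2)) ^ m) * norm (of_real x - Complex x (- y))"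
      by (rule lens_primitive_increment[OF \<Phi>]) (use seg M(2)[where d = "2 * sin \<theta> ^ 2"] sc in auto)
    also have "norm (of_real x - Complex x (- y)) = y"
      using y by (simp add: cmod_def)
    also have "(M * (9 - ln (2 * sin \<theta> ^ 2)) ^ m) * y \<le> (M * (4 ^ m * fact m * exp (9 / 4) / sqrt (sin \<theta>))) * (2 * sin \<theta>)"
      using M(1) y sc ln_power_le_inverse_sqrt[of "sin \<theta>" m] by (intro mult_mono mult_left_mono) auto
    also have "\<dots> = K * (sin \<theta> / sqrt (sin \<theta>))" by (simp add: K_def)
    also have "sin \<theta> / sqrt (sin \<theta>) = sqrt (sin \<theta>)" using sc by (simp add: real_div_sqrt)
    finally have "norm (\<Phi> (of_real x) - \<Phi> (Complex x (- y))) \<le> K * sqrt (sin \<theta>)" .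
    moreover have "cis (- 2 * \<theta>) = Complex x (- y)" by (simp add: x_def y_def complex_eq_iff)
    ultimately show ?case unfolding x_def[symmetric] by simp
  qed
  thus ?thesis using lim by (rule Lim_null_comparison)
qed

text \<open>From 1 - e^(-2 i \<theta>) = 2 sin \<theta> e^(i (pi/2 - \<theta>)). Both arguments lie
  in the principal range, and their sum pi/2 - 3 \<theta> vanishes at pi/6.\<close>

lemma log_lens_arc:
  assumes "0 < \<theta>" "\<theta> < pi / 6"
  shows "log_lens (cis (- 2 * \<theta>)) = of_real (ln (2 * sin \<theta>)) + \<i> * of_real (pi / 2 - 3 * \<theta>)"
    "cis (- 2 * \<theta>) * (1 - cis (- 2 * \<theta>)) = exp (of_real (ln (2 * sin \<theta>)) + \<i> * of_real (pi / 2 - 3 * \<theta>))"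
proof -
  have s: "sin \<theta> > 0" using sin_cos_bounds[OF assms] by simp
  have e1: "cis (- 2 * \<theta>) = exp (\<i> * of_real (- 2 * \<theta>))" by (simp only: cis_conv_exp)
  have e2: "1 - cis (- 2 * \<theta>) = exp (of_real (ln (2 * sin \<theta>)) + \<i> * of_real (pi / 2 - \<theta>))"
  proof -
    have "exp (of_real (ln (2 * sin \<theta>)) + \<i> * of_real (pi / 2 - \<theta>)) = of_real (2 * sin \<theta>) * cis (pi / 2 - \<theta>)"
      using s by (simp only: exp_add cis_conv_exp exp_of_real exp_ln)
    also have "cis (pi / 2 - \<theta>) = Complex (sin \<theta>) (cos \<theta>)"
      by (simp add: complex_eq_iff cos_diff sin_diff)
    finally show ?thesis
      by (simp add: complex_eq_iff cos_double_sin sin_double power2_eq_square)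
  qed
  have "Ln (cis (- 2 * \<theta>)) = \<i> * of_real (- 2 * \<theta>)"
    unfolding e1 using assms by (intro Ln_exp) auto
  moreover have "Ln (1 - cis (- 2 * \<theta>)) = of_real (ln (2 * sin \<theta>)) + \<i> * of_real (pi / 2 - \<theta>)"
    unfolding e2 using assms by (intro Ln_exp) auto
  ultimately show "log_lens (cis (- 2 * \<theta>)) = of_real (ln (2 * sin \<theta>)) + \<i> * of_real (pi / 2 - 3 * \<theta>)"
    unfolding log_lens_def by (simp add: algebra_simps)
  have "cis (- 2 * \<theta>) * (1 - cis (- 2 * \<theta>)) = 
    exp (\<i> * of_real (- 2 * \<theta>) + (of_real (ln (2 * sin \<theta>)) + \<i> * of_real (pi / 2 - \<theta>)))"
    unfolding e2 unfolding e1 by (simp only: exp_add)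
  also have "\<i> * of_real (- 2 * \<theta>) + (of_real (ln (2 * sin \<theta>)) + \<i> * of_real (pi / 2 - \<theta>)) =
    of_real (ln (2 * sin \<theta>)) + \<i> * complex_of_real (pi / 2 - 3 * \<theta>)"
    by (simp add: algebra_simps)
  finally show "cis (- 2 * \<theta>) * (1 - cis (- 2 * \<theta>)) = exp (of_real (ln (2 * sin \<theta>)) + \<i> * of_real (pi / 2 - 3 * \<theta>))" .
qed

lemma cis_in_lens:
  assumes "0 < \<theta>" "\<theta> < pi / 6"
  shows "cis (- 2 * \<theta>) \<in> lens"
proof -
  have s: "sin \<theta> > 0" "sin \<theta> < 1 / 2" using sin_cos_bounds[OF assms] by auto
  have "norm (cis (- 2 * \<theta>) * (1 - cis (- 2 * \<theta>))) = 2 * sin \<theta>"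
    unfolding log_lens_arc(2)[OF assms] norm_exp_eq_Re using s by simp
  moreover have "Re (cis (- 2 * \<theta>)) = 1 - 2 * sin \<theta> ^ 2" by (simp add: cos_double_sin)
  moreover have "sin \<theta> ^ 2 < 1 / 4" using power_strict_mono[of "sin \<theta>" "1 / 2" 2] s by (simp add: power_divide)
  moreover have "sin \<theta> ^ 2 > 0" using s by simp
  ultimately show ?thesis using s unfolding lens_def mem_Collect_eq by linarith
qed

lemma has_vector_derivative_cubic_param_compose:
  fixes f :: "complex \<Rightarrow> complex"
  assumes "0 < \<theta>" "\<theta> < pi / 6" "(f has_field_derivative D) (at (of_real (cubic_param \<theta>)))"
  shows "((\<lambda>x. f (of_real (cubic_param x))) has_vector_derivative
     of_real (- 2 * sqrt 3 / (cos \<theta> + sqrt 3 * sin \<theta>) ^ 2) * D) (at \<theta>)"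
proof -
  have "((\<lambda>x. complex_of_real (cubic_param x)) has_vector_derivative
       of_real (- 2 * sqrt 3 / (cos \<theta> + sqrt 3 * sin \<theta>) ^ 2)) (at \<theta>)"
    using deriv_cubic_param[OF assms(1,2)]
    by (intro has_vector_derivative_of_real) (simp add: has_real_derivative_iff_has_vector_derivative)
  from field_vector_diff_chain_at[OF this assms(3)] show ?thesis by (simp add: o_def)
qed

text \<open>Both sides are logarithms of \<open>arc_path\<close> along the path. Their derivatives
  agree, and both tend to 0 at \<open>pi / 6\<close>, where w = 0 and q (1 - q) = 1; so the powers
  of the logarithm in the integrand are iterated integrals based at w = 0.\<close>

lemma log_form_cubic_param:
  assumes l: "l 0 = 0" "\<And>z. norm z < 1 \<Longrightarrow> (l has_field_derivative pole_form 1 1 (- 2) z) (at z)"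
    and \<theta>: "0 < \<theta>" "\<theta> < pi / 6"
  shows "l (of_real (cubic_param \<theta>)) = log_lens (cis (- 2 * \<theta>))"
proof -
  define g where "g \<theta> = complex_of_real (ln (2 * sin \<theta>)) + \<i> * of_real (pi / 2 - 3 * \<theta>)" for \<theta>
  define w' where "w' \<theta> = complex_of_real (- 2 * sqrt 3 / (cos \<theta> + sqrt 3 * sin \<theta>) ^ 2)" for \<theta>
  have dg: "(g has_vector_derivative (of_real (cos \<theta> / sin \<theta>) - 3 * \<i>)) (at \<theta>)"
    if \<theta>: "0 < \<theta>" "\<theta> < pi / 6" for \<theta>
  proof -
    have "((\<lambda>\<theta>. ln (2 * sin \<theta>)) has_real_derivative cos \<theta> / sin \<theta>) (at \<theta>)"
      using sin_cos_bounds[OF \<theta>] by (auto intro!: derivative_eq_intros)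
    hence 1: "((\<lambda>\<theta>. complex_of_real (ln (2 * sin \<theta>))) has_vector_derivative of_real (cos \<theta> / sin \<theta>)) (at \<theta>)"
      by (intro has_vector_derivative_of_real) (simp add: has_real_derivative_iff_has_vector_derivative)
    have "((\<lambda>\<theta>. pi / 2 - 3 * \<theta>) has_real_derivative - 3) (at \<theta>)"
      by (auto intro!: derivative_eq_intros)
    hence "((\<lambda>\<theta>. complex_of_real (pi / 2 - 3 * \<theta>)) has_vector_derivative of_real (- 3)) (at \<theta>)"
      by (intro has_vector_derivative_of_real) (simp add: has_real_derivative_iff_has_vector_derivative)
    from has_vector_derivative_mult_right[OF this, of \<i>]
    have 2: "((\<lambda>\<theta>. \<i> * complex_of_real (pi / 2 - 3 * \<theta>)) has_vector_derivative \<i> * of_real (- 3)) (at \<theta>)" .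
    show ?thesis using has_vector_derivative_add[OF 1 2] by (simp add: g_def[abs_def] mult.commute)
  qed
  have arc: "arc_path (of_real (cubic_param \<theta>)) = exp (g \<theta>)" if "0 < \<theta>" "\<theta> < pi / 6" for \<theta>
    unfolding arc_path_cubic_param[OF that] log_lens_arc(2)[OF that] g_def ..
  \<comment> \<open>The derivative identity is not computed but read off by differentiating
    \<open>exp (g \<theta>) = arc_path\<close> in two ways.\<close>
  have key: "w' \<theta> * pole_form 1 1 (- 2) (of_real (cubic_param \<theta>)) = of_real (cos \<theta> / sin \<theta>) - 3 * \<i>"
    if \<theta>: "0 < \<theta>" "\<theta> < pi / 6" for \<theta>
  proof -
    have "(exp has_field_derivative exp (g \<theta>)) (at (g \<theta>))" by (rule DERIV_exp)
    from field_vector_diff_chain_at[OF dg[OF \<theta>] this]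
    have "((\<lambda>x. exp (g x)) has_vector_derivative (of_real (cos \<theta> / sin \<theta>) - 3 * \<i>) * exp (g \<theta>)) (at \<theta>)"
      by (simp add: o_def)
    hence 1: "((\<lambda>x. arc_path (of_real (cubic_param x))) has_vector_derivative (of_real (cos \<theta> / sin \<theta>) - 3 * \<i>) * exp (g \<theta>)) (at \<theta>)"
      by (rule has_vector_derivative_transform_within_open[of _ _ _ "{0<..<pi/6}"])
         (use \<theta> arc in auto)
    have 2: "((\<lambda>x. arc_path (of_real (cubic_param x))) has_vector_derivative
        w' \<theta> * (arc_path (of_real (cubic_param \<theta>)) * pole_form 1 1 (- 2) (of_real (cubic_param \<theta>)))) (at \<theta>)"
      unfolding w'_def
      by (intro has_vector_derivative_cubic_param_compose \<theta> arc.deriv_Z cubic_param_bounds)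
    have "w' \<theta> * (exp (g \<theta>) * pole_form 1 1 (- 2) (of_real (cubic_param \<theta>))) = (of_real (cos \<theta> / sin \<theta>) - 3 * \<i>) * exp (g \<theta>)"
      using vector_derivative_unique_at[OF 2 1] unfolding arc[OF \<theta>] .
    hence "exp (g \<theta>) * (w' \<theta> * pole_form 1 1 (- 2) (of_real (cubic_param \<theta>))) = exp (g \<theta>) * (of_real (cos \<theta> / sin \<theta>) - 3 * \<i>)"
      by (simp only: mult_ac)
    thus ?thesis by (simp only: mult_cancel_left exp_not_eq_zero simp_thms)
  qed
  have "\<exists>C. \<forall>\<theta>\<in>{0<..<pi/6}. l (of_real (cubic_param \<theta>)) - g \<theta> = C"
  proof (rule has_vector_derivative_zero_constant)
    fix \<theta> assume "\<theta> \<in> {0<..<pi/6}"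
    hence \<theta>: "0 < \<theta>" "\<theta> < pi / 6" by auto
    have "((\<lambda>x. l (of_real (cubic_param x))) has_vector_derivative w' \<theta> * pole_form 1 1 (- 2) (of_real (cubic_param \<theta>))) (at \<theta>)"
      unfolding w'_def
      using cubic_param_bounds[OF \<theta>] by (intro has_vector_derivative_cubic_param_compose \<theta> l) auto
    from has_vector_derivative_diff[OF this dg[OF \<theta>]]
    show "((\<lambda>x. l (of_real (cubic_param x)) - g x) has_vector_derivative 0) (at \<theta> within {0<..<pi/6})"
      unfolding key[OF \<theta>] by (simp add: has_vector_derivative_at_within)
  qed auto
  then obtain C where C: "\<And>\<theta>. 0 < \<theta> \<Longrightarrow> \<theta> < pi / 6 \<Longrightarrow> l (of_real (cubic_param \<theta>)) - g \<theta> = C" by auto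
  have "C = 0"
  proof -
    have "isCont l 0" using l(2)[of 0] DERIV_isCont by auto
    hence "(l \<longlongrightarrow> l (complex_of_real 0)) (at (complex_of_real 0))" by (simp add: isCont_def)
    moreover have "filterlim (\<lambda>\<theta>. complex_of_real (cubic_param \<theta>)) (nhds (of_real 0)) (at_left (pi / 6))"
      using filterlim_cubic_param_pi_6 by (intro tendsto_of_real) (simp add: filterlim_at)
    ultimately have "((\<lambda>\<theta>. l (of_real (cubic_param \<theta>))) \<longlongrightarrow> l (of_real 0)) (at_left (pi / 6))"
      using \<open>isCont l 0\<close> by (intro isCont_tendsto_compose[of _ l]) auto
    moreover have "(g \<longlongrightarrow> of_real (ln (2 * sin (pi / 6))) + \<i> * of_real (pi / 2 - 3 * (pi / 6))) (at_left (pi / 6))"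
      unfolding g_def by (intro tendsto_intros) (auto simp: sin_30)
    hence "(g \<longlongrightarrow> 0) (at_left (pi / 6))" by (simp add: sin_30)
    ultimately have "((\<lambda>\<theta>. l (of_real (cubic_param \<theta>)) - g \<theta>) \<longlongrightarrow> l (of_real 0) - 0) (at_left (pi / 6))"
      by (rule tendsto_diff)
    moreover have "eventually (\<lambda>\<theta>. \<theta> \<in> {0<..<pi/6}) (at_left (pi / 6))"
      by (rule eventually_at_left_real) simp
    hence "eventually (\<lambda>\<theta>. l (of_real (cubic_param \<theta>)) - g \<theta> = C) (at_left (pi / 6))"
      by eventually_elim (use C in auto)
    ultimately have "((\<lambda>\<theta>. C) \<longlongrightarrow> l (of_real 0) - 0) (at_left (pi / 6))"
      by (rule Lim_transform_eventually)
    thus ?thesis using l(1) by (simp add: tendsto_const_iff)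
  qed
  thus ?thesis using C[OF \<theta>] unfolding log_lens_arc(1)[OF \<theta>] g_def by simp
qed

text \<open>Along q = e^(-2 i \<theta>) one has dq / q = -2 i d\<theta>, while the form behind
  \<open>F\<close> pulls back to 2 i d\<theta>. The sum of the two primitives is thus a constant
  \<open>C\<close>, and the limits of \<open>F\<close> yield those of \<open>\<Phi>\<close> at
  corners where \<open>\<Phi>\<close> itself need not be defined.\<close>

lemma lens_primitive_arc:
  assumes \<Phi>: "\<And>q. q \<in> lens \<Longrightarrow> (\<Phi> has_field_derivative lens_integrand m A q) (at q)"
    and A: "0 \<notin> set A"
  shows "\<exists>C v. v \<in> MPL_space (m + 1 + sum_list A) 3 \<and>
    ((\<lambda>\<theta>. \<Phi> (cis (- 2 * \<theta>))) \<longlongrightarrow> C) (at_left (pi / 6)) \<and> ((\<lambda>\<theta>. \<Phi> (cis (- 2 * \<theta>))) \<longlongrightarrow> C - v) (at_right 0)"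
proof -
  obtain l where l: "l 0 = 0" "\<And>z. norm z < 1 \<Longrightarrow> (l has_field_derivative pole_form 1 1 (- 2) z) (at z)"
    using polylog_span_log_form[of 1 1 "- 2"] by metis
  obtain F v where v: "v \<in> MPL_space (m + 1 + sum_list A) 3"
    and F: "\<And>t::real. 0 < t \<Longrightarrow> t < 1 \<Longrightarrow> (F has_field_derivative
         l t ^ m * pole_form 0 (- 1) 1 t * polylog (ones A) (arc_path t)) (at (of_real t))"
    and F0: "((\<lambda>t::real. F t) \<longlongrightarrow> 0) (at_right 0)" and F1: "((\<lambda>t::real. F t) \<longlongrightarrow> v) (at_left 1)"
    using arc.iterated_integral_value[OF l A, where m = m] by blast
  have "\<exists>C. \<forall>\<theta>\<in>{0<..<pi/6}. F (of_real (cubic_param \<theta>)) + \<Phi> (cis (- 2 * \<theta>)) = C"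
  proof (rule has_vector_derivative_zero_constant)
    fix \<theta> assume "\<theta> \<in> {0<..<pi/6}"
    hence \<theta>: "0 < \<theta>" "\<theta> < pi / 6" by auto
    define q where "q = cis (- 2 * \<theta>)"
    have q0: "q \<noteq> 0" by (simp add: q_def)
    define I where "I = log_lens q ^ m * polylog (ones A) (q * (1 - q))"
    have "((\<lambda>x. F (of_real (cubic_param x))) has_vector_derivative
        of_real (- 2 * sqrt 3 / (cos \<theta> + sqrt 3 * sin \<theta>) ^ 2) *
        (l (of_real (cubic_param \<theta>)) ^ m * pole_form 0 (- 1) 1 (of_real (cubic_param \<theta>)) *
           polylog (ones A) (arc_path (of_real (cubic_param \<theta>))))) (at \<theta>)"
      by (intro has_vector_derivative_cubic_param_compose \<theta> F cubic_param_bounds)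
    also have "of_real (- 2 * sqrt 3 / (cos \<theta> + sqrt 3 * sin \<theta>) ^ 2) *
        (l (of_real (cubic_param \<theta>)) ^ m * pole_form 0 (- 1) 1 (of_real (cubic_param \<theta>)) *
           polylog (ones A) (arc_path (of_real (cubic_param \<theta>)))) =
        (pole_form 0 (- 1) 1 (of_real (cubic_param \<theta>)) * of_real (- 2 * sqrt 3 / (cos \<theta> + sqrt 3 * sin \<theta>) ^ 2)) *
        (l (of_real (cubic_param \<theta>)) ^ m * polylog (ones A) (arc_path (of_real (cubic_param \<theta>))))"
      by (simp only: mult_ac)
    also have "\<dots> = 2 * \<i> * I"
    proof -
      have "l (of_real (cubic_param \<theta>)) = log_lens (cis (- 2 * \<theta>))"
        by (rule log_form_cubic_param) (use l \<theta> in auto)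
      thus ?thesis
        unfolding pole_form_cubic_param[OF \<theta>] arc_path_cubic_param[OF \<theta>] I_def q_def by simp
    qed
    finally have dF: "((\<lambda>x. F (of_real (cubic_param x))) has_vector_derivative 2 * \<i> * I) (at \<theta>)" .
    have "((\<lambda>z. exp (\<i> * (- 2 * z))) has_field_derivative (\<i> * - 2) * exp (\<i> * (- 2 * of_real \<theta>))) (at (of_real \<theta>))"
      by (auto intro!: derivative_eq_intros)
    hence "((\<lambda>x. exp (\<i> * (- 2 * of_real x))) has_vector_derivative (\<i> * - 2) * exp (\<i> * (- 2 * of_real \<theta>))) (at \<theta>)"
      by (rule has_vector_derivative_real_field)
    hence dq: "((\<lambda>x. cis (- 2 * x)) has_vector_derivative (\<i> * - 2) * q) (at \<theta>)"
      by (simp add: q_def cis_conv_exp mult_ac)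
    have "(\<Phi> has_field_derivative lens_integrand m A q) (at (cis (- 2 * \<theta>)))"
      unfolding q_def by (intro \<Phi> cis_in_lens \<theta>)
    from field_vector_diff_chain_at[OF dq this]
    have "((\<lambda>x. \<Phi> (cis (- 2 * x))) has_vector_derivative (\<i> * - 2) * q * lens_integrand m A q) (at \<theta>)"
      by (simp add: o_def)
    from has_vector_derivative_add[OF dF this]
    have "((\<lambda>x. F (of_real (cubic_param x)) + \<Phi> (cis (- 2 * x))) has_vector_derivative 0) (at \<theta>)"
      using q0 by (simp add: lens_integrand_def I_def mult_ac)
    thus "((\<lambda>x. F (of_real (cubic_param x)) + \<Phi> (cis (- 2 * x))) has_vector_derivative 0) (at \<theta> within {0<..<pi/6})"
      by (rule has_vector_derivative_at_within)
  qed auto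
  then obtain C where C: "\<And>\<theta>. 0 < \<theta> \<Longrightarrow> \<theta> < pi / 6 \<Longrightarrow> C - F (of_real (cubic_param \<theta>)) = \<Phi> (cis (- 2 * \<theta>))"
    by (metis add_diff_cancel_left' greaterThanLessThan_iff)
  have "((\<lambda>\<theta>. C - F (of_real (cubic_param \<theta>))) \<longlongrightarrow> C - 0) (at_left (pi / 6))"
    by (intro tendsto_intros filterlim_compose[OF F0 filterlim_cubic_param_pi_6])
  moreover have "eventually (\<lambda>\<theta>. \<theta> \<in> {0<..<pi/6}) (at_left (pi / 6))"
    by (rule eventually_at_left_real) simp
  hence "eventually (\<lambda>\<theta>. C - F (of_real (cubic_param \<theta>)) = \<Phi> (cis (- 2 * \<theta>))) (at_left (pi / 6))"
    by eventually_elim (rule C, auto)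
  ultimately have 1: "((\<lambda>\<theta>. \<Phi> (cis (- 2 * \<theta>))) \<longlongrightarrow> C - 0) (at_left (pi / 6))"
    by (rule Lim_transform_eventually)
  have "((\<lambda>\<theta>. C - F (of_real (cubic_param \<theta>))) \<longlongrightarrow> C - v) (at_right 0)"
    by (intro tendsto_intros filterlim_compose[OF F1 filterlim_cubic_param_0])
  moreover have "eventually (\<lambda>\<theta>. \<theta> \<in> {0<..<pi/6}) (at_right 0)"
    by (rule eventually_at_right_real) simp
  hence "eventually (\<lambda>\<theta>. C - F (of_real (cubic_param \<theta>)) = \<Phi> (cis (- 2 * \<theta>))) (at_right 0)"
    by eventually_elim (rule C, auto)
  ultimately have 2: "((\<lambda>\<theta>. \<Phi> (cis (- 2 * \<theta>))) \<longlongrightarrow> C - v) (at_right 0)"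
    by (rule Lim_transform_eventually)
  show ?thesis using 1 2 v by auto
qed

lemma polylog_ones_of_real:
  assumes "0 \<notin> set A" "\<bar>x\<bar> < 1"
  shows "Im (polylog (ones A) (of_real x)) = 0"
proof -
  have "map (\<lambda>(a, y). (a, cnj y)) (ones A) = ones A" by (simp add: ones_def)
  hence "cnj (nested_term (ones A) n) = nested_term (ones A) n" for n
    by (simp add: cnj_nested_term)
  moreover have "(\<lambda>n. nested_term (ones A) n * of_real x ^ n) sums polylog (ones A) (of_real x)"
    using assms by (intro polylog_sums) auto
  ultimately have "cnj (polylog (ones A) (of_real x)) = polylog (ones A) (of_real x)"
    using sums_cnj[of "\<lambda>n. nested_term (ones A) n * of_real x ^ n" "polylog (ones A) (of_real x)"]
    by (simp add: sums_iff)
  thus ?thesis by (simp add: complex_eq_iff)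
qed

lemma lens_primitive_real_segment:
  assumes \<Phi>: "\<And>q. q \<in> lens \<Longrightarrow> (\<Phi> has_field_derivative lens_integrand m A q) (at q)"
    and A: "0 \<notin> set A" and x: "0 < x" "x < 1"
  shows "Im (\<Phi> (of_real x)) = Im (\<Phi> (1 / 2))"
proof -
  have bd: "0 < x * (1 - x) \<and> x * (1 - x) < 1" if "0 < x" "x < 1" for x :: real
  proof -
    have "x * (1 - x) < x * 1" using that by (intro mult_strict_left_mono) auto
    moreover have "0 < x * (1 - x)" using that by (intro mult_pos_pos) auto
    ultimately show ?thesis using that by linarith
  qed
  have "\<exists>C. \<forall>x\<in>{0<..<1}. Im (\<Phi> (of_real x)) = C"
  proof (rule has_vector_derivative_zero_constant)
    fix x :: real assume "x \<in> {0<..<1}"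
    hence x: "0 < x" "x < 1" by auto
    have "norm (complex_of_real x * (1 - of_real x)) = \<bar>x * (1 - x)\<bar>"
      by (metis norm_of_real of_real_1 of_real_diff of_real_mult)
    hence "complex_of_real x \<in> lens" using x bd[OF x] by (auto simp: lens_def)
    from has_vector_derivative_real_field[OF \<Phi>[OF this]]
    have "((\<lambda>x. Im (\<Phi> (of_real x))) has_vector_derivative Im (lens_integrand m A (of_real x))) (at x)"
      by (rule bounded_linear.has_vector_derivative[OF bounded_linear_Im])
    moreover have "Im (lens_integrand m A (of_real x)) = 0"
    proof -
      have "Ln (complex_of_real x) = of_real (ln x)" "Ln (1 - complex_of_real x) = of_real (ln (1 - x))"
        using x Ln_of_real[of x] Ln_of_real[of "1 - x"] by auto
      hence "log_lens (of_real x) = of_real (ln x + ln (1 - x))" by (simp add: log_lens_def)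
      moreover have "polylog (ones A) (of_real x * (1 - of_real x)) = of_real (Re (polylog (ones A) (of_real (x * (1 - x)))))"
        using polylog_ones_of_real[OF A, of "x * (1 - x)"] bd[OF x] by (simp add: complex_eq_iff)
      ultimately have "lens_integrand m A (of_real x) = of_real ((ln x + ln (1 - x)) ^ m * Re (polylog (ones A) (of_real (x * (1 - x)))) / x)"
        by (simp add: lens_integrand_def)
      thus ?thesis by simp
    qed
    ultimately show "((\<lambda>x. Im (\<Phi> (of_real x))) has_vector_derivative 0) (at x within {0<..<1})"
      by (simp add: has_vector_derivative_at_within)
  qed auto
  then obtain C where C: "\<And>x. 0 < x \<Longrightarrow> x < 1 \<Longrightarrow> Im (\<Phi> (of_real x)) = C" by auto
  from C[OF x] C[of "1 / 2"] show ?thesis by simp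
qed

lemma sin_cos_bounds':
  assumes "pi / 6 < \<theta>" "\<theta> < pi / 2"
  shows "1 / 2 < sin \<theta>" "sin \<theta> < 1" "0 < cos \<theta>" "cos \<theta> < sqrt 3 / 2"
proof -
  show "1 / 2 < sin \<theta>" using sin_monotone_2pi[of "pi / 6" \<theta>] assms by (simp add: sin_30)
  show "sin \<theta> < 1" using sin_monotone_2pi[of \<theta> "pi / 2"] assms by simp
  show "0 < cos \<theta>" using assms by (intro cos_gt_zero_pi) auto
  show "cos \<theta> < sqrt 3 / 2" using cos_monotone_0_pi[of "pi / 6" \<theta>] assms by (simp add: cos_30)
qed

text \<open>This is e^(i (\<theta> - pi/2)) / (2 sin \<theta>), the point of the line Re q = 1/2
  with argument \<theta> - pi/2. Hence dq / q = (i - cot \<theta>) d\<theta>, and since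
  \<open>1 - q\<close> is the conjugate of \<open>q\<close>, the product q (1 - q) is the square of
  the modulus.\<close>

definition vertical_param :: "real \<Rightarrow> complex"
  where "vertical_param \<theta> = Complex (1 / 2) (- (cos \<theta> / sin \<theta>) / 2)"

lemma vertical_param:
  assumes "pi / 6 < \<theta>" "\<theta> < pi / 2"
  shows "vertical_param \<theta> * (1 - vertical_param \<theta>) = of_real ((1 / (2 * sin \<theta>)) ^ 2)"
    and "vertical_param \<theta> \<in> lens"
    and "log_lens (vertical_param \<theta>) = of_real (- 2 * ln (2 * sin \<theta>))"
    and "(vertical_param has_vector_derivative vertical_param \<theta> * (\<i> - of_real (cos \<theta> / sin \<theta>))) (at \<theta>)"
proof -
  note s = sin_cos_bounds'[OF assms]
  define q where "q = vertical_param \<theta>"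
  have s0: "sin \<theta> > 0" using s by linarith
  have sc: "(cos \<theta>) ^ 2 = 1 - (sin \<theta>) ^ 2" by (simp add: cos_squared_eq)
  have n2: "1 / 4 + (cos \<theta> / sin \<theta> / 2) ^ 2 = (1 / (2 * sin \<theta>)) ^ 2"
    using s0 by (simp add: power_divide power_mult_distrib sc field_simps)
  have q1: "1 - q = cnj q" by (simp add: q_def vertical_param_def complex_eq_iff)
  show prod: "vertical_param \<theta> * (1 - vertical_param \<theta>) = of_real ((1 / (2 * sin \<theta>)) ^ 2)"
  proof -
    have "q * (1 - q) = of_real (norm q ^ 2)" unfolding q1 by (simp only: complex_norm_square)
    also have "norm q ^ 2 = 1 / 4 + (cos \<theta> / sin \<theta> / 2) ^ 2"
      by (simp add: q_def vertical_param_def cmod_power2 power_divide)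
    finally show ?thesis unfolding n2 q_def .
  qed
  have "(1 / (2 * sin \<theta>)) ^ 2 < 1 ^ 2" using s s0 by (intro power_strict_mono) auto
  hence "norm (q * (1 - q)) < 1" unfolding q_def prod norm_of_real by simp
  thus lens: "vertical_param \<theta> \<in> lens" by (simp add: lens_def q_def) (simp add: vertical_param_def)
  have "norm q ^ 2 = (1 / (2 * sin \<theta>)) ^ 2"
    unfolding n2[symmetric] by (simp add: q_def vertical_param_def cmod_power2 power_divide)
  hence nq: "norm q = 1 / (2 * sin \<theta>)" using s0 by (subst (asm) power2_eq_iff_nonneg) auto
  have "q \<notin> \<real>\<^sub>\<le>\<^sub>0" using lens_not_nonpos(1)[OF lens] by (simp add: q_def)
  hence "log_lens q = Ln q + cnj (Ln q)"
    unfolding log_lens_def q1 by (simp add: cnj_Ln)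
  also have "\<dots> = of_real (2 * Re (Ln q))" by (simp add: complex_eq_iff)
  also have "Re (Ln q) = ln (norm q)" using lens by (intro Re_Ln) (auto simp: lens_def q_def)
  also have "\<dots> = - ln (2 * sin \<theta>)" using s0 by (simp add: nq ln_div)
  finally show "log_lens (vertical_param \<theta>) = of_real (- 2 * ln (2 * sin \<theta>))" by (simp add: q_def)
  have "((\<lambda>\<theta>. - (cos \<theta> / sin \<theta>) / 2) has_real_derivative 
      - ((- sin \<theta> * sin \<theta> - cos \<theta> * cos \<theta>) / (sin \<theta> * sin \<theta>)) / 2) (at \<theta>)"
    using s0 by (intro DERIV_cdivide DERIV_minus DERIV_divide DERIV_sin DERIV_cos) auto
  hence "((\<lambda>\<theta>. complex_of_real (- (cos \<theta> / sin \<theta>) / 2)) has_vector_derivative 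
      of_real (- ((- sin \<theta> * sin \<theta> - cos \<theta> * cos \<theta>) / (sin \<theta> * sin \<theta>)) / 2)) (at \<theta>)"
    by (intro has_vector_derivative_of_real) (simp add: has_real_derivative_iff_has_vector_derivative)
  from has_vector_derivative_add[OF has_vector_derivative_const[of "1 / 2"] has_vector_derivative_mult_right[OF this, of \<i>]]
  have d: "((\<lambda>\<theta>. 1 / 2 + \<i> * complex_of_real (- (cos \<theta> / sin \<theta>) / 2)) has_vector_derivative 
      \<i> * of_real (- ((- sin \<theta> * sin \<theta> - cos \<theta> * cos \<theta>) / (sin \<theta> * sin \<theta>)) / 2)) (at \<theta>)"
    by simp
  have e1: "(\<lambda>\<theta>. 1 / 2 + \<i> * complex_of_real (- (cos \<theta> / sin \<theta>) / 2)) = vertical_param"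
    by (rule ext) (simp add: vertical_param_def complex_eq_iff)
  have e2: "\<i> * complex_of_real (- ((- sin \<theta> * sin \<theta> - cos \<theta> * cos \<theta>) / (sin \<theta> * sin \<theta>)) / 2) =
      vertical_param \<theta> * (\<i> - of_real (cos \<theta> / sin \<theta>))"
  proof -
    have n: "- sin \<theta> * sin \<theta> - cos \<theta> * cos \<theta> = - 1"
      using sin_cos_squared_add3[of \<theta>] by linarith
    have "cos \<theta> * cos \<theta> = 1 - sin \<theta> * sin \<theta>" using sin_cos_squared_add3[of \<theta>] by linarith
    hence "1 / 2 + cos \<theta> / sin \<theta> / 2 * (cos \<theta> / sin \<theta>) = 1 / (sin \<theta> * sin \<theta>) / 2"
      using s0 by (simp add: field_simps)
    thus ?thesis unfolding n by (simp add: vertical_param_def complex_eq_iff)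
  qed
  show "(vertical_param has_vector_derivative vertical_param \<theta> * (\<i> - of_real (cos \<theta> / sin \<theta>))) (at \<theta>)"
    using d unfolding e1 e2 .
qed

text \<open>The corner estimate is indexed by the angle of the arc point at the same height. The
  line point at \<theta> has imaginary part - cot \<theta> / 2, so this angle is half the arcsine of
  cot \<theta> / 2.\<close>

lemma filterlim_arcsin_cot:
  "filterlim (\<lambda>\<theta>. arcsin (cos \<theta> / sin \<theta> / 2) / 2) (at_left (pi / 6)) (at_right (pi / 6))"
  unfolding filterlim_at
proof
  have v: "cos (pi / 6) / sin (pi / 6) / 2 = sqrt 3 / 2" by (simp add: cos_30 sin_30)
  have as: "arcsin (sqrt 3 / 2) = pi / 3"
    using arcsin_sin[of "pi / 3"] by (simp add: sin_60)
  have "sqrt 3 < sqrt 4" by (rule real_sqrt_less_mono) simp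
  hence s3: "sqrt 3 / 2 < 1" "- 1 < sqrt 3 / 2"
    by (auto intro: less_le_trans[of _ 0])
  have "((\<lambda>\<theta>. cos \<theta> / sin \<theta> / 2) \<longlongrightarrow> cos (pi / 6) / sin (pi / 6) / 2) (at_right (pi / 6))"
    by (intro tendsto_intros) (auto simp: sin_30)
  hence "((\<lambda>\<theta>. arcsin (cos \<theta> / sin \<theta> / 2)) \<longlongrightarrow> arcsin (sqrt 3 / 2)) (at_right (pi / 6))"
    unfolding v using s3 by (intro isCont_tendsto_compose[of _ arcsin] isCont_arcsin) auto
  hence "((\<lambda>\<theta>. arcsin (cos \<theta> / sin \<theta> / 2) / 2) \<longlongrightarrow> pi / 3 / 2) (at_right (pi / 6))"
    unfolding as by (intro tendsto_intros) auto
  thus "((\<lambda>\<theta>. arcsin (cos \<theta> / sin \<theta> / 2) / 2) \<longlongrightarrow> pi / 6) (at_right (pi / 6))" by simp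
  have "eventually (\<lambda>\<theta>. \<theta> \<in> {pi/6<..<pi/2}) (at_right (pi / 6))"
    by (rule eventually_at_right_real) simp
  thus "\<forall>\<^sub>F \<theta> in at_right (pi / 6). arcsin (cos \<theta> / sin \<theta> / 2) / 2 \<in> {..<pi / 6} \<and> arcsin (cos \<theta> / sin \<theta> / 2) / 2 \<noteq> pi / 6"
  proof eventually_elim
    case (elim \<theta>)
    hence \<theta>: "pi / 6 < \<theta>" "\<theta> < pi / 2" by auto
    note s = sin_cos_bounds'[OF \<theta>]
    have "cos \<theta> / sin \<theta> < (sqrt 3 / 2) / (1 / 2)" using s by (intro frac_less) auto
    hence "cos \<theta> / sin \<theta> / 2 < sqrt 3 / 2" by simp
    moreover have "0 < cos \<theta> / sin \<theta>" using s by simp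
    ultimately have "arcsin (cos \<theta> / sin \<theta> / 2) < arcsin (sqrt 3 / 2)"
      using s3 by (intro arcsin_less_arcsin) auto
    thus ?case by (simp add: as)
  qed
qed

text \<open>The imaginary part of \<open>\<Phi>\<close> is followed around the region: it tends to
  \<open>Im C\<close> at the lower corner of the line, to \<open>Im (C - v)\<close> at 1, and the
  latter equals its value at 1/2 because it is constant on the segment. The integral is therefore
  \<open>- Im v\<close> up to a power of -2.\<close>

lemma integral_polylog_arc:
  assumes A: "0 \<notin> set A" "A = [] \<or> hd A \<ge> 2"
  shows "complex_of_real (LBINT \<theta>:{pi/6..pi/2}. Re (polylog (ones A) (of_real ((1 / (2 * sin \<theta>)) ^ 2))) * ln (2 * sin \<theta>) ^ m)
    \<in> (*) \<i> ` MPL_space (m + 1 + sum_list A) 3"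
proof -
  obtain \<Phi> where \<Phi>: "\<And>q. q \<in> lens \<Longrightarrow> (\<Phi> has_field_derivative lens_integrand m A q) (at q)"
    using lens_primitive[OF A(1), of m] by blast
  obtain C v where v: "v \<in> MPL_space (m + 1 + sum_list A) 3"
    and C: "((\<lambda>\<theta>. \<Phi> (cis (- 2 * \<theta>))) \<longlongrightarrow> C) (at_left (pi / 6))"
      "((\<lambda>\<theta>. \<Phi> (cis (- 2 * \<theta>))) \<longlongrightarrow> C - v) (at_right 0)"
    using lens_primitive_arc[OF \<Phi> A(1)] by blast
  have half: "1 / 2 \<in> lens" by (simp add: lens_def norm_mult)
  have corner1: "Im (\<Phi> (1 / 2)) = Im (C - v)"
  proof -
    have "((\<lambda>\<theta>. (\<Phi> (of_real (cos (2 * \<theta>))) - \<Phi> (cis (- 2 * \<theta>))) + \<Phi> (cis (- 2 * \<theta>))) \<longlongrightarrow> 0 + (C - v)) (at_right 0)"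
      by (intro tendsto_add tendsto_corner_one[OF \<Phi> A] C)
    hence "((\<lambda>\<theta>. Im (\<Phi> (of_real (cos (2 * \<theta>))))) \<longlongrightarrow> Im (C - v)) (at_right 0)"
      by (intro tendsto_Im) simp
    moreover have "eventually (\<lambda>\<theta>. \<theta> \<in> {0<..<pi/6}) (at_right 0)"
      by (rule eventually_at_right_real) simp
    hence "eventually (\<lambda>\<theta>. Im (\<Phi> (of_real (cos (2 * \<theta>)))) = Im (\<Phi> (1 / 2))) (at_right 0)"
    proof eventually_elim
      case (elim \<theta>)
      have "cos (pi / 3) < cos (2 * \<theta>)" "cos (2 * \<theta>) < cos 0"
        using elim by (intro cos_monotone_0_pi; simp)+
      thus ?case by (intro lens_primitive_real_segment[OF \<Phi> A(1)]) (auto simp: cos_60)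
    qed
    ultimately have "((\<lambda>\<theta>::real. Im (\<Phi> (1 / 2))) \<longlongrightarrow> Im (C - v)) (at_right 0)"
      by (rule Lim_transform_eventually)
    thus ?thesis by (simp add: tendsto_const_iff)
  qed
  define f where "f \<theta> = Re (polylog (ones A) (of_real ((1 / (2 * sin \<theta>)) ^ 2))) * ln (2 * sin \<theta>) ^ m" for \<theta>
  obtain M where M: "\<And>z. norm z < 1 \<Longrightarrow> norm (polylog (ones A) z) \<le> M"
    using norm_polylog_ones_bounded[OF A] by auto
  have range: "\<bar>(1 / (2 * sin \<theta>)) ^ 2\<bar> < 1" if \<theta>: "pi / 6 < \<theta>" "\<theta> < pi / 2" for \<theta>
  proof -
    have "(1 / (2 * sin \<theta>)) ^ 2 < 1 ^ 2"
      using sin_cos_bounds'[OF \<theta>] by (intro power_strict_mono) auto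
    thus ?thesis by simp
  qed
  have "(LBINT \<theta>:{pi/6..pi/2}. (- 2) ^ m * f \<theta>) = Im (\<Phi> (1 / 2)) - Im C"
  proof (rule integral_eq_limit_difference)
    fix \<theta> :: real assume \<theta>: "pi / 6 < \<theta>" "\<theta> < pi / 2"
    note s = sin_cos_bounds'[OF \<theta>]
    note q = vertical_param[OF \<theta>]
    have q0: "vertical_param \<theta> \<noteq> 0" by (simp add: vertical_param_def complex_eq_iff)
    have "polylog (ones A) (of_real ((1 / (2 * sin \<theta>)) ^ 2)) = of_real (Re (polylog (ones A) (of_real ((1 / (2 * sin \<theta>)) ^ 2))))"
      using polylog_ones_of_real[OF A(1) range[OF \<theta>]] by (simp only: complex_eq_iff Re_complex_of_real Im_complex_of_real)
    \<comment> \<open>The factor \<open>(- 2) ^ m\<close> appears because the logarithm of q (1 - q)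
      on the line is \<open>- 2 * ln (2 * sin \<theta>)\<close>.\<close>
    hence I: "log_lens (vertical_param \<theta>) ^ m * polylog (ones A) (vertical_param \<theta> * (1 - vertical_param \<theta>)) = of_real ((- 2) ^ m * f \<theta>)"
      unfolding q(1,3) f_def by (simp only: of_real_mult of_real_power power_mult_distrib mult_ac)
    from field_vector_diff_chain_at[OF q(4) \<Phi>[OF q(2)]]
    have "((\<lambda>\<theta>. \<Phi> (vertical_param \<theta>)) has_vector_derivative
       vertical_param \<theta> * (\<i> - of_real (cos \<theta> / sin \<theta>)) * lens_integrand m A (vertical_param \<theta>)) (at \<theta>)"
      by (simp add: o_def)
    also have "vertical_param \<theta> * (\<i> - of_real (cos \<theta> / sin \<theta>)) * lens_integrand m A (vertical_param \<theta>) =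
       (\<i> - of_real (cos \<theta> / sin \<theta>)) * of_real ((- 2) ^ m * f \<theta>)"
      unfolding lens_integrand_def I using q0 by simp
    finally have "((\<lambda>\<theta>. Im (\<Phi> (vertical_param \<theta>))) has_vector_derivative
       Im ((\<i> - of_real (cos \<theta> / sin \<theta>)) * of_real ((- 2) ^ m * f \<theta>))) (at \<theta>)"
      by (rule bounded_linear.has_vector_derivative[OF bounded_linear_Im])
    \<comment> \<open>The rest of the integrand is real, so the imaginary part selects i from i -
      cot \<theta> and leaves exactly d\<theta>.\<close>
    also have "Im ((\<i> - of_real (cos \<theta> / sin \<theta>)) * of_real ((- 2) ^ m * f \<theta>)) = (- 2) ^ m * f \<theta>"
      unfolding times_complex.sel minus_complex.sel Re_complex_of_real Im_complex_of_real by simp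
    finally show "((\<lambda>\<theta>. Im (\<Phi> (vertical_param \<theta>))) has_vector_derivative (- 2) ^ m * f \<theta>) (at \<theta>)" .
    have "\<bar>Re (polylog (ones A) (of_real ((1 / (2 * sin \<theta>)) ^ 2)))\<bar> \<le> M"
      using range[OF \<theta>] by (intro order_trans[OF abs_Re_le_cmod] M) (simp only: norm_of_real)
    moreover have "\<bar>ln (2 * sin \<theta>)\<bar> \<le> 1"
      using s ln_le_minus_one[of "2 * sin \<theta>"] ln_ge_zero[of "2 * sin \<theta>"] by auto
    ultimately have "\<bar>f \<theta>\<bar> \<le> M * 1 ^ m"
      unfolding f_def abs_mult power_abs by (intro mult_mono power_mono) auto
    thus "norm ((- 2) ^ m * f \<theta>) \<le> 2 ^ m * M"
      by (simp add: abs_mult power_abs)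
  next
    show "continuous_on {pi/6<..<pi/2} (\<lambda>\<theta>. (- 2) ^ m * f \<theta>)"
    proof (intro continuous_intros continuous_at_imp_continuous_on ballI)
      fix \<theta> assume "\<theta> \<in> {pi/6<..<pi/2}"
      hence \<theta>: "pi / 6 < \<theta>" "\<theta> < pi / 2" by auto
      note s = sin_cos_bounds'[OF \<theta>]
      have "norm (complex_of_real ((1 / (2 * sin \<theta>)) ^ 2)) < 1" using range[OF \<theta>] by (simp only: norm_of_real)
      hence "isCont (polylog (ones A)) (of_real ((1 / (2 * sin \<theta>)) ^ 2))"
        by (rule DERIV_isCont[OF has_field_derivative_polylog, rotated]) (use A in simp)
      moreover have "isCont (\<lambda>\<theta>. complex_of_real ((1 / (2 * sin \<theta>)) ^ 2)) \<theta>"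
        using s by (intro continuous_intros) auto
      ultimately have "isCont (\<lambda>\<theta>. polylog (ones A) (of_real ((1 / (2 * sin \<theta>)) ^ 2))) \<theta>"
        using isCont_o2[of \<theta> "\<lambda>\<theta>. complex_of_real ((1 / (2 * sin \<theta>)) ^ 2)" "polylog (ones A)"] by blast
      thus "isCont f \<theta>" unfolding f_def[abs_def] using s by (intro continuous_intros) auto
    qed
    have "((\<lambda>\<theta>. (\<Phi> (Complex (1 / 2) (- sin (2 * \<theta>))) - \<Phi> (cis (- 2 * \<theta>))) + \<Phi> (cis (- 2 * \<theta>))) \<longlongrightarrow> 0 + C) (at_left (pi / 6))"
      by (intro tendsto_add tendsto_corner[OF \<Phi> A] C)
    hence "((\<lambda>\<theta>. \<Phi> (Complex (1 / 2) (- sin (2 * \<theta>)))) \<longlongrightarrow> C) (at_left (pi / 6))" by simp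
    from filterlim_compose[OF this filterlim_arcsin_cot]
    have "((\<lambda>\<theta>. \<Phi> (Complex (1 / 2) (- sin (2 * (arcsin (cos \<theta> / sin \<theta> / 2) / 2))))) \<longlongrightarrow> C) (at_right (pi / 6))" .
    moreover have "eventually (\<lambda>\<theta>. \<theta> \<in> {pi/6<..<pi/2}) (at_right (pi / 6))"
      by (rule eventually_at_right_real) simp
    hence "\<forall>\<^sub>F \<theta> in at_right (pi / 6). \<Phi> (Complex (1 / 2) (- sin (2 * (arcsin (cos \<theta> / sin \<theta> / 2) / 2)))) = \<Phi> (vertical_param \<theta>)"
    proof eventually_elim
      case (elim \<theta>)
      hence s: "1 / 2 < sin \<theta>" "0 < cos \<theta>" using sin_cos_bounds'[of \<theta>] by auto
      have "cos \<theta> / sin \<theta> \<le> 1 / (1 / 2)" using s by (intro frac_le) auto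
      moreover have "0 < cos \<theta> / sin \<theta>" using s by simp
      ultimately have "sin (arcsin (cos \<theta> / sin \<theta> / 2)) = cos \<theta> / sin \<theta> / 2"
        by (intro sin_arcsin) auto
      thus ?case by (simp add: vertical_param_def)
    qed
    ultimately have "((\<lambda>\<theta>. \<Phi> (vertical_param \<theta>)) \<longlongrightarrow> C) (at_right (pi / 6))"
      by (rule Lim_transform_eventually)
    thus "((\<lambda>\<theta>. Im (\<Phi> (vertical_param \<theta>))) \<longlongrightarrow> Im C) (at_right (pi / 6))"
      by (rule tendsto_Im)
    have "(vertical_param \<longlongrightarrow> Complex (1 / 2) (- (cos (pi / 2) / sin (pi / 2)) / 2)) (at_left (pi / 2))"
      unfolding vertical_param_def[abs_def] by (intro tendsto_intros tendsto_Complex) auto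
    moreover have "Complex (1 / 2) 0 = 1 / 2" by (simp add: complex_eq_iff)
    ultimately have "(vertical_param \<longlongrightarrow> 1 / 2) (at_left (pi / 2))" by simp
    moreover have "isCont \<Phi> (1 / 2)" using \<Phi>[OF half] DERIV_isCont by blast
    ultimately have "((\<lambda>\<theta>. \<Phi> (vertical_param \<theta>)) \<longlongrightarrow> \<Phi> (1 / 2)) (at_left (pi / 2))"
      by (intro isCont_tendsto_compose[of _ \<Phi>])
    thus "((\<lambda>\<theta>. Im (\<Phi> (vertical_param \<theta>))) \<longlongrightarrow> Im (\<Phi> (1 / 2))) (at_left (pi / 2))"
      by (rule tendsto_Im)
  qed auto
  hence "(- 2) ^ m * (LBINT \<theta>:{pi/6..pi/2}. f \<theta>) = - Im v"
    by (simp add: corner1)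
  hence "(LBINT \<theta>:{pi/6..pi/2}. f \<theta>) = - Im v / (- 2) ^ m"
    by (simp add: field_simps)
  hence "complex_of_real (LBINT \<theta>:{pi/6..pi/2}. f \<theta>) = of_real (- 1 / (- 2) ^ m) * of_real (Im v)"
    by simp
  \<comment> \<open>\<open>v - cnj v\<close> is 2 i times \<open>Im v\<close>; closure of the space
    under conjugation puts the imaginary part into i times the space.\<close>
  also have "complex_of_real (Im v) = \<i> * (of_rat (- 1 / 2) * (v + of_rat (- 1) * cnj v))"
    by (simp add: complex_eq_iff of_rat_divide of_rat_minus)
  also have "complex_of_real (- 1 / (- 2) ^ m) = of_rat (- 1 / (- 2) ^ m)"
    by (simp add: of_rat_divide of_rat_power of_rat_minus)
  finally have "complex_of_real (LBINT \<theta>:{pi/6..pi/2}. f \<theta>) =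
      \<i> * (of_rat (- 1 / (- 2) ^ m) * (of_rat (- 1 / 2) * (v + of_rat (- 1) * cnj v)))"
    by (simp only: mult_ac)
  moreover have "of_rat (- 1 / (- 2) ^ m) * (of_rat (- 1 / 2) * (v + of_rat (- 1) * cnj v)) \<in> MPL_space (m + 1 + sum_list A) 3"
    by (intro MPL_space_scale MPL_space_add v MPL_space_cnj) auto
  ultimately show ?thesis unfolding f_def by blast
qed

section \<open>Mean values of powers of the logarithm\<close>

fun binom_poly :: "nat \<Rightarrow> real poly" where
  "binom_poly 0 = 1"
| "binom_poly (Suc n) = smult (1 / real (Suc n)) (binom_poly n * [:- real n, 1:])"

lemma coeff_times_linear:
  fixes p :: "real poly"
  shows "coeff (p * [:a, 1:]) j = (if j = 0 then 0 else coeff p (j - 1)) + a * coeff p j"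
  by (cases j) (simp_all add: algebra_simps)

lemma coeff_binom_poly_Suc:
  "real (Suc n) * coeff (binom_poly (Suc n)) j =
     (if j = 0 then 0 else coeff (binom_poly n) (j - 1)) - real n * coeff (binom_poly n) j"
  unfolding binom_poly.simps coeff_smult coeff_times_linear by simp

text \<open>The recursion combines two earlier coefficients with weights 1 and \<open>n\<close>,
  divided by \<open>n + 1\<close>, so the bound 1 is inherited; all coefficient series are then
  dominated by a geometric one.\<close>

lemma abs_coeff_binom_poly_le: "\<bar>coeff (binom_poly n) j\<bar> \<le> 1"
proof (induction n arbitrary: j)
  case 0
  show ?case by (simp add: coeff_1)
next
  case (Suc n)
  have "real (Suc n) * \<bar>coeff (binom_poly (Suc n)) j\<bar> = \<bar>(if j = 0 then 0 else coeff (binom_poly n) (j - 1)) - real n * coeff (binom_poly n) j\<bar>"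
    unfolding coeff_binom_poly_Suc[symmetric] abs_mult by simp
  also have "\<dots> \<le> 1 + real n * 1"
    using Suc[of "j - 1"] Suc[of j]
    by (intro order_trans[OF abs_triangle_ineq4] add_mono) (auto simp: abs_mult intro!: mult_left_mono mult_left_le)
  finally have "real (Suc n) * \<bar>coeff (binom_poly (Suc n)) j\<bar> \<le> real (Suc n) * 1" by simp
  thus ?case by (rule mult_left_le_imp_le) simp
qed

definition log_series :: "nat \<Rightarrow> complex \<Rightarrow> complex"
  where "log_series j z = suminf (\<lambda>n. of_real (coeff (binom_poly n) j) * z ^ n)"

lemma log_series_sums:
  assumes "norm z < 1"
  shows "(\<lambda>n. of_real (coeff (binom_poly n) j) * z ^ n) sums log_series j z"
  unfolding log_series_def
  by (intro summable_sums summable_norm_cancel[OF summable_norm_bounded_coeff_power[of _ 1]])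
     (use assms abs_coeff_binom_poly_le in auto)

lemma coeff_binom_poly_0: "coeff (binom_poly n) 0 = (if n = 0 then 1 else 0)"
proof (induction n)
  case (Suc n)
  have "real (Suc n) * coeff (binom_poly (Suc n)) 0 = 0"
    unfolding coeff_binom_poly_Suc Suc by simp
  thus ?case by (simp only: mult_eq_0_iff) simp
qed (simp add: coeff_1)

text \<open>Read as an identity of power series, the coefficient recursion says that
  \<open>1 + z\<close> times the derivative of the series for \<open>Suc j\<close> is the series for
  \<open>j\<close>.\<close>

lemma has_field_derivative_log_series:
  assumes "norm z < 1"
  shows "(log_series (Suc j) has_field_derivative log_series j z / (1 + z)) (at z)"
proof -
  define c where "c j n = complex_of_real (coeff (binom_poly n) j)" for j n
  have c1: "norm (c j n) \<le> 1" for j n using abs_coeff_binom_poly_le by (simp add: c_def)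
  have sm: "summable (\<lambda>n. c j n * w ^ n)" if "norm w < 1" for j w
    using log_series_sums[OF that, of j] by (auto simp: c_def sums_iff)
  define D where "D = suminf (\<lambda>n. diffs (c (Suc j)) n * z ^ n)"
  have der: "(log_series (Suc j) has_field_derivative D) (at z)"
    unfolding log_series_def[abs_def] D_def c_def[symmetric]
    by (rule termdiffs_strong'[where K = 1]) (use sm assms in \<open>auto simp: c_def\<close>)
  have smD: "(\<lambda>n. diffs (c (Suc j)) n * z ^ n) sums D"
    unfolding D_def by (intro summable_sums termdiff_converges[of _ 1]) (use assms sm in auto)
  have "(\<lambda>n. of_nat n * c (Suc j) n * z ^ (n - Suc 0)) sums D"
    using diffs_equiv[OF sums_summable[OF smD]] by (simp add: D_def)
  from sums_mult[OF this, of z] have zD: "(\<lambda>n. z * (of_nat n * c (Suc j) n * z ^ (n - Suc 0))) sums (z * D)" .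
  have eq: "z * (of_nat n * c (Suc j) n * z ^ (n - Suc 0)) = of_nat n * c (Suc j) n * z ^ n" for n
    by (cases n) auto
  have "(\<lambda>n. diffs (c (Suc j)) n * z ^ n + of_nat n * c (Suc j) n * z ^ n) sums (D + z * D)"
    using sums_add[OF smD zD] unfolding eq .
  moreover have "diffs (c (Suc j)) n * z ^ n + of_nat n * c (Suc j) n * z ^ n = c j n * z ^ n" for n
  proof -
    have "real (Suc n) * coeff (binom_poly (Suc n)) (Suc j) = coeff (binom_poly n) j - real n * coeff (binom_poly n) (Suc j)"
      using coeff_binom_poly_Suc[of n "Suc j"] by simp
    hence "complex_of_real (real (Suc n) * coeff (binom_poly (Suc n)) (Suc j)) = of_real (coeff (binom_poly n) j - real n * coeff (binom_poly n) (Suc j))"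
      by (rule arg_cong)
    hence "diffs (c (Suc j)) n = c j n - of_nat n * c (Suc j) n"
      unfolding diffs_def c_def by (simp only: of_real_mult of_real_diff of_real_of_nat_eq)
    thus ?thesis by (simp only: distrib_right[symmetric] diff_add_cancel)
  qed
  ultimately have "(\<lambda>n. c j n * z ^ n) sums (D + z * D)" by simp
  moreover have "(\<lambda>n. c j n * z ^ n) sums log_series j z" using log_series_sums[OF assms] by (simp add: c_def)
  ultimately have "D + z * D = log_series j z" by (rule sums_unique2)
  hence "(1 + z) * D = log_series j z" by (simp add: algebra_simps)
  moreover have "1 + z \<noteq> 0" using assms by (metis add_eq_0_iff norm_minus_cancel norm_one less_irrefl)
  ultimately have "D = log_series j z / (1 + z)" by (simp add: field_simps)
  thus ?thesis using der by simp
qed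

lemma log_series_eq:
  assumes "norm z < 1"
  shows "log_series j z = Ln (1 + z) ^ j / fact j"
  using assms
proof (induction j arbitrary: z)
  case 0
  show ?case unfolding log_series_def
    by (subst suminf_finite[of "{0}"]) (auto simp: coeff_binom_poly_0)
next
  case (Suc j)
  have "\<exists>C. \<forall>z\<in>ball 0 1. log_series (Suc j) z - Ln (1 + z) ^ Suc j / fact (Suc j) = C"
  proof (rule has_field_derivative_zero_constant)
    fix z :: complex assume "z \<in> ball 0 1"
    hence z: "norm z < 1" by simp
    have nr: "1 + z \<notin> \<real>\<^sub>\<le>\<^sub>0"
      using z abs_Re_le_cmod[of z] by (auto simp: complex_nonpos_Reals_iff)
    have nz: "1 + z \<noteq> 0" using nr by auto
    have "((\<lambda>z. Ln (1 + z)) has_field_derivative 1 / (1 + z)) (at z)"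
      using nr by (auto intro!: derivative_eq_intros simp: divide_inverse)
    hence dl: "((\<lambda>z. Ln (1 + z) ^ Suc j) has_field_derivative of_nat (Suc j) * Ln (1 + z) ^ j * (1 / (1 + z))) (at z)"
      using DERIV_power[of "\<lambda>z. Ln (1 + z)" "1 / (1 + z)" z UNIV "Suc j"] by (simp add: mult_ac del: of_nat_Suc power_Suc)
    have "((\<lambda>z. log_series (Suc j) z - Ln (1 + z) ^ Suc j / fact (Suc j)) has_field_derivative
        log_series j z / (1 + z) - of_nat (Suc j) * Ln (1 + z) ^ j * (1 / (1 + z)) / fact (Suc j)) (at z)"
      by (intro DERIV_diff DERIV_cdivide has_field_derivative_log_series z dl)
    also have "log_series j z / (1 + z) - of_nat (Suc j) * Ln (1 + z) ^ j * (1 / (1 + z)) / fact (Suc j) = 0"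
      using nz by (simp add: Suc.IH[OF z] fact_Suc divide_simps del: of_nat_Suc)
    finally show "((\<lambda>z. log_series (Suc j) z - Ln (1 + z) ^ Suc j / fact (Suc j)) has_field_derivative 0) (at z within ball 0 1)"
      by (rule has_field_derivative_at_within)
  qed simp
  then obtain C where C: "\<And>z. norm z < 1 \<Longrightarrow> log_series (Suc j) z - Ln (1 + z) ^ Suc j / fact (Suc j) = C" by auto
  have "log_series (Suc j) 0 = of_real (coeff (binom_poly 0) (Suc j))"
    unfolding log_series_def by (subst suminf_finite[of "{0}"]) auto
  hence "C = 0" using C[of 0] by simp
  thus ?case using C[OF Suc.prems] by simp
qed

section \<open>Fourier integrals over the unit interval\<close>

abbreviation unit_interval :: "real measure"
  where "unit_interval \<equiv> restrict_space lborel {0..1}"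

lemma integral_unit_interval: "integral\<^sup>L unit_interval f = (LBINT x:{0..1}. f x)"
  for f :: "real \<Rightarrow> 'a::{banach, second_countable_topology}"
  by (subst integral_restrict_space) (auto simp: set_lebesgue_integral_def)

lemma emeasure_unit_interval: "emeasure unit_interval (space unit_interval) = 1"
  by (simp add: emeasure_restrict_space space_restrict_space)

lemma measure_unit_interval: "measure unit_interval (space unit_interval) = 1"
  using emeasure_unit_interval by (simp add: measure_def)

lemma integrable_unit_interval_continuous:
  fixes f :: "real \<Rightarrow> 'a::euclidean_space"
  assumes "continuous_on {0..1} f"
  shows "integrable unit_interval f"
proof -
  have "set_integrable lborel {0..1} f" by (rule borel_integrable_atLeastAtMost'[OF assms])
  thus ?thesis by (subst integrable_restrict_space) (auto simp: set_integrable_def)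
qed

definition e2pi :: "real \<Rightarrow> complex" where "e2pi t = cis (2 * pi * t)"

lemma continuous_on_e2pi [continuous_intros]: "continuous_on A f \<Longrightarrow> continuous_on A (\<lambda>x. e2pi (f x))"
  unfolding e2pi_def by (intro continuous_intros)

lemma norm_e2pi [simp]: "norm (e2pi t) = 1" by (simp add: e2pi_def)

lemma integral_e2pi_power:
  "(\<integral>t. e2pi t ^ m * cnj (e2pi t) ^ n \<partial>unit_interval) = (if m = n then 1 else 0)"
proof (cases "m = n")
  case True
  have "e2pi t ^ m * cnj (e2pi t) ^ n = 1" for t
    unfolding True power_mult_distrib[symmetric] by (simp add: e2pi_def cis_cnj cis_mult)
  moreover have "measure unit_interval (space unit_interval) = 1"
    by (rule measure_unit_interval)
  ultimately show ?thesis using True by simp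
next
  case False
  define k where "k = of_int (int m - int n) * 2 * pi"
  have k: "k \<noteq> 0" using False by (simp add: k_def)
  have eq: "e2pi t ^ m * cnj (e2pi t) ^ n = cis (k * t)" for t
    unfolding e2pi_def cis_cnj Complex.DeMoivre cis_mult by (simp add: k_def algebra_simps)
  define G where "G t = exp (\<i> * of_real k * of_real t) / (\<i> * of_real k)" for t :: real
  have "(LBINT t:{0..1}. cis (k * t)) = G 1 - G 0"
  proof (rule integral_eq_limit_difference)
    fix t :: real
    have "((\<lambda>z. exp (\<i> * of_real k * z) / (\<i> * of_real k)) has_field_derivative exp (\<i> * of_real k * of_real t)) (at (of_real t))"
      using k by (auto intro!: derivative_eq_intros)
    hence "(G has_vector_derivative exp (\<i> * of_real k * of_real t)) (at t)"
      unfolding G_def[abs_def] by (rule has_vector_derivative_real_field)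
    thus "(G has_vector_derivative cis (k * t)) (at t)" by (simp add: cis_conv_exp mult_ac)
    show "norm (cis (k * t)) \<le> 1" by simp
  next
    have "isCont G t" for t unfolding G_def[abs_def] using k by (intro continuous_intros) auto
    thus "(G \<longlongrightarrow> G 0) (at_right 0)" "(G \<longlongrightarrow> G 1) (at_left 1)"
      by (auto simp: isCont_def intro: filterlim_mono[OF _ _ at_le] tendsto_within_subset)
  qed (auto intro!: continuous_intros)
  also have "exp (\<i> * of_real k) = 1"
    unfolding k_def exp_eq_1 by (auto intro!: exI[of _ "int m - int n"] simp: mult_ac)
  hence "G 1 - G 0 = 0" by (simp add: G_def)
  finally show ?thesis using False by (simp add: eq integral_unit_interval)
qed

lemma integral_powser_e2pi:
  fixes c :: "nat \<Rightarrow> complex"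
  assumes c: "\<And>n. norm (c n) \<le> C" and a: "norm a < 1"
  shows "(\<integral>t. suminf (\<lambda>m. c m * (a * e2pi t) ^ m) * cnj (e2pi t) ^ n \<partial>unit_interval) = c n * a ^ n"
proof -
  define u where "u m t = c m * a ^ m * (e2pi t ^ m * cnj (e2pi t) ^ n)" for m t
  have nu: "norm (u m t) = norm (c m * a ^ m)" for m t by (simp add: u_def norm_mult norm_power)
  have sm: "summable (\<lambda>m. norm (c m * a ^ m))" by (rule summable_norm_bounded_coeff_power[OF c a])
  have "(\<lambda>m. integral\<^sup>L unit_interval (u m)) sums (\<integral>t. suminf (\<lambda>m. u m t) \<partial>unit_interval)"
  proof (rule sums_integral)
    show "integrable unit_interval (u m)" for m
      unfolding u_def by (intro integrable_unit_interval_continuous continuous_intros)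
    show "AE t in unit_interval. summable (\<lambda>m. norm (u m t))" using sm by (simp add: nu)
    show "summable (\<lambda>m. \<integral>t. norm (u m t) \<partial>unit_interval)"
      using sm measure_unit_interval by (simp add: nu)
  qed
  moreover have "integral\<^sup>L unit_interval (u m) = (if m = n then c n * a ^ n else 0)" for m
    unfolding u_def[abs_def] by (simp add: integral_e2pi_power)
  ultimately have "(\<lambda>m. if m = n then c n * a ^ n else 0) sums (\<integral>t. suminf (\<lambda>m. u m t) \<partial>unit_interval)" by simp
  moreover have "(\<lambda>m. if m = n then c n * a ^ n else 0) sums (c n * a ^ n)" using sums_single[of n "\<lambda>_. c n * a ^ n"] by simp
  ultimately have "(\<integral>t. suminf (\<lambda>m. u m t) \<partial>unit_interval) = c n * a ^ n" by (rule sums_unique2[symmetric, rotated])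
  moreover have "suminf (\<lambda>m. u m t) = suminf (\<lambda>m. c m * (a * e2pi t) ^ m) * cnj (e2pi t) ^ n" for t
  proof -
    have "summable (\<lambda>m. c m * (a * e2pi t) ^ m)"
      by (rule summable_norm_cancel[OF summable_norm_bounded_coeff_power[OF c]]) (use a in \<open>simp add: norm_mult\<close>)
    from suminf_mult2[OF this, of "cnj (e2pi t) ^ n"] show ?thesis
      by (simp add: u_def power_mult_distrib mult_ac)
  qed
  ultimately show ?thesis by simp
qed

lemma continuous_on_powser_e2pi:
  fixes c :: "nat \<Rightarrow> complex"
  assumes c: "\<And>n. norm (c n) \<le> C" and a: "norm a < 1"
  shows "continuous_on A (\<lambda>t. suminf (\<lambda>m. c m * (a * e2pi t) ^ m))"
proof -
  have "isCont (\<lambda>z. suminf (\<lambda>m. c m * z ^ m)) z" if z: "norm z < 1" for z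
  proof -
    have "((\<lambda>z. suminf (\<lambda>m. c m * z ^ m)) has_field_derivative suminf (\<lambda>n. diffs c n * z ^ n)) (at z)"
      by (rule termdiffs_strong'[where K = 1])
         (use z summable_norm_cancel[OF summable_norm_bounded_coeff_power[OF c]] in auto)
    thus ?thesis by (rule DERIV_isCont)
  qed
  hence "continuous_on (ball 0 1) (\<lambda>z. suminf (\<lambda>m. c m * z ^ m))"
    by (intro continuous_at_imp_continuous_on) auto
  moreover have "continuous_on A (\<lambda>t. a * e2pi t)" by (intro continuous_intros)
  moreover have "(\<lambda>t. a * e2pi t) ` A \<subseteq> ball 0 1" using a by (auto simp: norm_mult)
  ultimately show ?thesis by (rule continuous_on_compose2)
qed

text \<open>Only the conjugated factor is expanded into its series. Each term of the integral is
  then a Fourier coefficient of the other factor, which keeps the exchange of sum and integral to a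
  single series.\<close>

lemma parseval_e2pi:
  fixes c d :: "nat \<Rightarrow> complex"
  assumes c: "\<And>n. norm (c n) \<le> C" and d: "\<And>n. norm (d n) \<le> D" and a: "norm a < 1"
  shows "(\<lambda>n. c n * cnj (d n) * of_real (norm a ^ 2) ^ n) sums
    (\<integral>t. suminf (\<lambda>m. c m * (a * e2pi t) ^ m) * cnj (suminf (\<lambda>m. d m * (a * e2pi t) ^ m)) \<partial>unit_interval)"
proof -
  define f where "f t = suminf (\<lambda>m. c m * (a * e2pi t) ^ m)" for t
  define g where "g t = suminf (\<lambda>m. d m * (a * e2pi t) ^ m)" for t
  define u where "u n t = cnj (d n * a ^ n) * (f t * cnj (e2pi t) ^ n)" for n t
  have contf: "continuous_on A f" for A
    unfolding f_def by (rule continuous_on_powser_e2pi[OF c a])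
  have "compact (f ` {0..1})" by (intro compact_continuous_image contf) auto
  then obtain F where F: "\<And>t. t \<in> {0..1} \<Longrightarrow> norm (f t) \<le> F"
    by (metis bounded_iff compact_imp_bounded imageI)
  have nu: "norm (u n t) \<le> norm (d n * a ^ n) * F" if "t \<in> {0..1}" for n t
    using F[OF that] by (simp add: u_def norm_mult norm_power mult_left_mono)
  have sm: "summable (\<lambda>n. norm (d n * a ^ n))" by (rule summable_norm_bounded_coeff_power[OF d a])
  have intu: "integrable unit_interval (u n)" for n
    unfolding u_def by (intro integrable_unit_interval_continuous continuous_intros contf)
  have "(\<lambda>n. integral\<^sup>L unit_interval (u n)) sums (\<integral>t. suminf (\<lambda>n. u n t) \<partial>unit_interval)"
  proof (rule sums_integral[OF intu])
    have "summable (\<lambda>n. norm (u n t))" if "t \<in> {0..1}" for t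
      by (rule summable_comparison_test'[OF summable_mult2[OF sm, of F]]) (use nu[OF that] in auto)
    thus "AE t in unit_interval. summable (\<lambda>n. norm (u n t))"
      by (intro AE_I2) (auto simp: space_restrict_space)
    show "summable (\<lambda>n. \<integral>t. norm (u n t) \<partial>unit_interval)"
    proof (rule summable_comparison_test'[OF summable_mult2[OF sm, of F]])
      fix n :: nat
      have "(\<integral>t. norm (u n t) \<partial>unit_interval) \<le> (\<integral>t. norm (d n * a ^ n) * F \<partial>unit_interval)"
        using nu by (intro integral_mono intu integrable_norm integrable_unit_interval_continuous continuous_intros)
          (auto simp: space_restrict_space)
      thus "norm (\<integral>t. norm (u n t) \<partial>unit_interval) \<le> norm (d n * a ^ n) * F"
        using measure_unit_interval by simp
    qed
  qed
  moreover have "integral\<^sup>L unit_interval (u n) = c n * cnj (d n) * of_real (norm a ^ 2) ^ n" for n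
  proof -
    have "integral\<^sup>L unit_interval (u n) = cnj (d n * a ^ n) * (c n * a ^ n)"
      unfolding u_def[abs_def] f_def by (simp add: integral_powser_e2pi[OF c a])
    also have "\<dots> = c n * cnj (d n) * (a * cnj a) ^ n" by (simp add: power_mult_distrib mult_ac)
    finally show ?thesis by (simp only: complex_norm_square)
  qed
  moreover have "suminf (\<lambda>n. u n t) = f t * cnj (g t)" for t
  proof -
    have "(\<lambda>m. d m * (a * e2pi t) ^ m) sums g t"
      unfolding g_def by (intro summable_sums summable_norm_cancel[OF summable_norm_bounded_coeff_power[OF d]])
        (use a in \<open>simp add: norm_mult\<close>)
    hence "(\<lambda>m. f t * cnj (d m * (a * e2pi t) ^ m)) sums (f t * cnj (g t))"
      by (intro sums_mult) (subst sums_cnj, simp)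
    moreover have "f t * cnj (d m * (a * e2pi t) ^ m) = u m t" for m
      by (simp add: u_def power_mult_distrib mult_ac)
    ultimately show ?thesis by (simp add: sums_iff)
  qed
  ultimately show ?thesis by (simp add: f_def g_def)
qed

section \<open>Squares of binomial polynomials as sums over words\<close>

fun nested_coeff :: "nat list \<Rightarrow> nat \<Rightarrow> real" where
  "nested_coeff [] n = (if n = 0 then 1 else 0)"
| "nested_coeff (a # A) n = (\<Sum>m<n. nested_coeff A m) / real n ^ a"

lemma nested_term_ones: "nested_term (ones A) n = of_real (nested_coeff A n)"
  by (induction A arbitrary: n) (auto simp: of_real_sum)

definition words12 :: "nat \<Rightarrow> nat list set"
  where "words12 j = {A. set A \<subseteq> {1, 2} \<and> sum_list A = j}"

text \<open>The weights -2 and 1 of the letters 1 and 2 are the coefficients in (1 - s/i)^2 = 1 - 2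
  s/i + s^2/i^2; the letter records the power of s, and of 1/i, that is chosen.\<close>

definition word_weight :: "nat list \<Rightarrow> real"
  where "word_weight A = prod_list (map (\<lambda>a. if a = 1 then - 2 else 1) A)"

lemma word_weight_simps [simp]:
  "word_weight [] = 1" "word_weight (1 # A) = - 2 * word_weight A" "word_weight (Suc 0 # A) = - 2 * word_weight A"
  "word_weight (2 # A) = word_weight A"
  by (simp_all add: word_weight_def)

lemma finite_words12: "finite (words12 j)"
proof (rule finite_subset)
  have "length A \<le> sum_list A" if "set A \<subseteq> {1, 2}" for A :: "nat list"
    using that by (induction A) auto
  thus "words12 j \<subseteq> {A. set A \<subseteq> {1, 2} \<and> length A \<le> j}" by (auto simp: words12_def)
  show "finite {A :: nat list. set A \<subseteq> {1, 2} \<and> length A \<le> j}" by (rule finite_lists_length_le) auto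
qed

lemma words12_unfold:
  "words12 0 = {[]}" "words12 (Suc 0) = (#) 1 ` words12 0"
  "words12 (Suc (Suc j)) = (#) 1 ` words12 (Suc j) \<union> (#) 2 ` words12 j"
proof -
  have *: "A = [] \<or> (\<exists>B. A = 1 # B \<and> B \<in> words12 (j - 1) \<and> j \<ge> 1) \<or> (\<exists>B. A = 2 # B \<and> B \<in> words12 (j - 2) \<and> j \<ge> 2)"
    if "A \<in> words12 j" for A j
    using that by (cases A) (auto simp: words12_def)
  show "words12 0 = {[]}" using *[of _ 0] by (auto simp: words12_def)
  show "words12 (Suc 0) = (#) 1 ` words12 0"
  proof (intro equalityI subsetI)
    fix A assume "A \<in> words12 (Suc 0)"
    with *[OF this] show "A \<in> (#) 1 ` words12 0" by (auto simp: words12_def)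
  qed (auto simp: words12_def)
  show "words12 (Suc (Suc j)) = (#) 1 ` words12 (Suc j) \<union> (#) 2 ` words12 j"
  proof (intro equalityI subsetI)
    fix A assume "A \<in> words12 (Suc (Suc j))"
    with *[OF this] show "A \<in> (#) 1 ` words12 (Suc j) \<union> (#) 2 ` words12 j"
      by (auto simp: words12_def)
  qed (auto simp: words12_def)
qed

lemma sum_words12:
  "(\<Sum>A\<in>words12 j. f A) = (if j = 0 then f [] else 0) +
     (if j \<ge> 1 then \<Sum>A\<in>words12 (j - 1). f (1 # A) else 0) + 
     (if j \<ge> 2 then \<Sum>A\<in>words12 (j - 2). f (2 # A) else 0)" for f :: "nat list \<Rightarrow> real"
proof (cases j)
  case (Suc i)
  show ?thesis
  proof (cases i)
    case (Suc l)
    have "(\<Sum>A\<in>words12 j. f A) = (\<Sum>A\<in>(#) 1 ` words12 (Suc l). f A) + (\<Sum>A\<in>(#) 2 ` words12 l. f A)"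
      unfolding \<open>j = Suc i\<close> Suc words12_unfold(3)
      by (intro sum.union_disjoint finite_imageI finite_words12) auto
    thus ?thesis using \<open>j = Suc i\<close> Suc by (simp add: sum.reindex)
  qed (use Suc in \<open>simp add: words12_unfold\<close>)
qed (simp add: words12_unfold)

fun square_factor :: "nat \<Rightarrow> real poly" where
  "square_factor 0 = 1"
| "square_factor (Suc n) = square_factor n * [:1, - 2 / real (Suc n), 1 / real (Suc n) ^ 2:]"

text \<open>C(s, n + 1) is s / (n + 1) times the product of (s - i) / i over i from 1 to n, and the
  signs of these factors disappear on squaring.\<close>

lemma binom_poly_square:
  "binom_poly (Suc n) * binom_poly (Suc n) = smult (1 / real (Suc n) ^ 2) (monom 1 2 * square_factor n)"
proof (induction n)
  case 0
  show ?case by (simp add: monom_altdef power2_eq_square)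
next
  case (Suc n)
  define x where "x = real (Suc n)"
  have x: "x \<noteq> 0" by (simp add: x_def)
  \<comment> \<open>The new linear factor squared is \<open>x ^ 2\<close> times the new quadratic
    factor, and this \<open>x ^ 2\<close> cancels the denominator left by the previous step.\<close>
  have q: "[:- x, 1:] * [:- x, 1:] = smult (x ^ 2) [:1, - 2 / x, 1 / x ^ 2:]"
    using x by (simp add: power2_eq_square)
  have "binom_poly (Suc (Suc n)) * binom_poly (Suc (Suc n)) =
     smult (1 / real (Suc (Suc n)) ^ 2) ((binom_poly (Suc n) * binom_poly (Suc n)) * ([:- x, 1:] * [:- x, 1:]))"
    by (simp only: binom_poly.simps(2)[of "Suc n"] x_def mult_smult_left mult_smult_right smult_smult mult_ac
          power2_eq_square times_divide_times_eq mult_1)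
  also have "\<dots> = smult (1 / real (Suc (Suc n)) ^ 2) (smult (1 / x ^ 2 * x ^ 2) (monom 1 2 * (square_factor n * [:1, - 2 / x, 1 / x ^ 2:])))"
    unfolding q Suc x_def[symmetric] by (simp only: mult_smult_left mult_smult_right smult_smult mult_ac)
  also have "1 / x ^ 2 * x ^ 2 = 1" using x by simp
  finally show ?case by (simp only: square_factor.simps x_def smult_1_left)
qed

lemma coeff_times_quadratic:
  fixes p :: "real poly"
  shows "coeff (p * [:1, b, c:]) j = coeff p j + (if j \<ge> 1 then b * coeff p (j - 1) else 0) + (if j \<ge> 2 then c * coeff p (j - 2) else 0)"
proof -
  have "p * [:1, b, c:] = p + pCons 0 (smult b p + pCons 0 (smult c p))"
    by (simp add: algebra_simps)
  thus ?thesis by (cases j; cases "j - 1") (auto simp: numeral_2_eq_2)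
qed

text \<open>Expanding the product means choosing some of the indices 1 to n, listed in decreasing
  order, with a letter 1 or 2 for each. In the induction the new factor, having the largest index,
  either contributes nothing or becomes the head of the word.\<close>

lemma coeff_square_factor:
  "coeff (square_factor n) j = (\<Sum>A\<in>words12 j. word_weight A * (\<Sum>m<Suc n. nested_coeff A m))"
proof (induction n arbitrary: j)
  case 0
  have "word_weight A * (\<Sum>m<Suc 0. nested_coeff A m) = (if A = [] then 1 else 0)" for A
    by (cases A) auto
  hence "(\<Sum>A\<in>words12 j. word_weight A * (\<Sum>m<Suc 0. nested_coeff A m)) = (if [] \<in> words12 j then 1 else 0)"
    using finite_words12[of j] by (simp add: sum.delta)
  also have "\<dots> = (if j = 0 then 1 else 0)" by (auto simp: words12_def)
  finally show ?case by (simp add: coeff_1)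
next
  case (Suc n)
  have "(\<Sum>A\<in>words12 j. word_weight A * (\<Sum>m<Suc (Suc n). nested_coeff A m)) =
      coeff (square_factor n) j + (\<Sum>A\<in>words12 j. word_weight A * nested_coeff A (Suc n))"
    unfolding Suc by (simp add: sum.distrib distrib_left)
  also have "(\<Sum>A\<in>words12 j. word_weight A * nested_coeff A (Suc n)) =
    (if j \<ge> 1 then (\<Sum>A\<in>words12 (j - 1). - 2 / real (Suc n) * (word_weight A * (\<Sum>m<Suc n. nested_coeff A m))) else 0) +
    (if j \<ge> 2 then (\<Sum>A\<in>words12 (j - 2). 1 / real (Suc n) ^ 2 * (word_weight A * (\<Sum>m<Suc n. nested_coeff A m))) else 0)"
    unfolding sum_words12[of _ j] by (simp add: mult_ac del: of_nat_Suc sum.lessThan_Suc)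
  also have "\<dots> = (if j \<ge> 1 then - 2 / real (Suc n) * coeff (square_factor n) (j - 1) else 0) +
    (if j \<ge> 2 then 1 / real (Suc n) ^ 2 * coeff (square_factor n) (j - 2) else 0)"
    unfolding Suc sum_distrib_left ..
  finally show ?case unfolding square_factor.simps coeff_times_quadratic by simp
qed

lemma rho_indices_eq: "rho_indices (Suc (Suc k)) = (#) 2 ` words12 k"
proof (intro equalityI subsetI)
  fix A assume "A \<in> rho_indices (Suc (Suc k))"
  thus "A \<in> (#) 2 ` words12 k" by (cases A) (auto simp: rho_indices_def words12_def)
qed (auto simp: rho_indices_def words12_def)

lemma rho_indices_small: "rho_indices 0 = {}" "rho_indices (Suc 0) = {}"
proof -
  have "sum_list A \<ge> 2" if "A \<in> rho_indices k" for A k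
    using that by (cases A) (auto simp: rho_indices_def)
  moreover have "sum_list A = k" if "A \<in> rho_indices k" for A k
    using that by (simp add: rho_indices_def)
  ultimately have "\<not> k < 2" if "A \<in> rho_indices k" for A k
    using that by fastforce
  thus "rho_indices 0 = {}" "rho_indices (Suc 0) = {}" by fastforce+
qed

text \<open>At weight 0 the empty word is added, so that \<open>rho 0 = 1\<close> fits the same
  formula as the higher weights; at weight 1 there is no word, in accordance with
  \<open>rho 1 = 0\<close>.\<close>

definition rho_words :: "nat \<Rightarrow> nat list set"
  where "rho_words k = (if k = 0 then {[]} else rho_indices k)"

lemma finite_rho_words: "finite (rho_words k)"
  by (cases k; cases "k - 1") (auto simp: rho_words_def rho_indices_eq rho_indices_small finite_words12)

lemma rho_words_props:
  assumes "A \<in> rho_words k"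
  shows "0 \<notin> set A" "A = [] \<or> hd A \<ge> 2" "sum_list A = k" "k > 0 \<Longrightarrow> A \<noteq> []"
    "word_weight A = (- 1) ^ k * 4 ^ length A / 2 ^ k"
proof -
  show "0 \<notin> set A" using assms by (cases A) (auto simp: rho_words_def rho_indices_def split: if_splits)
  show "A = [] \<or> hd A \<ge> 2" "k > 0 \<Longrightarrow> A \<noteq> []" "sum_list A = k"
    using assms by (auto simp: rho_words_def rho_indices_def split: if_splits)
  \<comment> \<open>Letter by letter: for 1 the weight -2 is -4/2, and for 2 the weight 1 is 4/2^2
    with sign +1.\<close>
  have "word_weight A = (- 1) ^ sum_list A * 4 ^ length A / 2 ^ sum_list A" if "set A \<subseteq> {1, 2}" for A
    using that by (induction A) (auto simp: power_add)
  moreover have "set A \<subseteq> {1, 2}"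
    using assms by (cases A) (auto simp: rho_words_def rho_indices_def split: if_splits)
  ultimately show "word_weight A = (- 1) ^ k * 4 ^ length A / 2 ^ k"
    using \<open>sum_list A = k\<close> by simp
qed

text \<open>The factor s^2 / n^2 in the square is the compulsory head 2 of the words in
  \<open>rho_indices\<close>; the remaining letters come from the product of the quadratic
  factors.\<close>

lemma coeff_binom_poly_square:
  "coeff (binom_poly n * binom_poly n) k = (\<Sum>A\<in>rho_words k. word_weight A * nested_coeff A n)"
proof (cases n)
  case 0
  have "word_weight A * nested_coeff A 0 = (if A = [] then 1 else 0)" for A
    by (cases A) auto
  hence "(\<Sum>A\<in>rho_words k. word_weight A * nested_coeff A n) = (if [] \<in> rho_words k then 1 else 0)"
    using finite_rho_words[of k] 0 by (simp add: sum.delta)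
  also have "\<dots> = (if k = 0 then 1 else 0)" by (auto simp: rho_words_def rho_indices_def)
  finally show ?thesis by (simp add: 0 coeff_1)
next
  case (Suc m)
  have *: "coeff (binom_poly n * binom_poly n) k = 1 / real (Suc m) ^ 2 * (if k \<ge> 2 then coeff (square_factor m) (k - 2) else 0)"
    unfolding Suc binom_poly_square by (simp add: coeff_monom_mult)
  show ?thesis
  proof (cases "k \<ge> 2")
    case True
    then obtain j where j: "k = Suc (Suc j)" by (metis add_2_eq_Suc le_Suc_ex)
    have "(\<Sum>A\<in>rho_words k. word_weight A * nested_coeff A n) = (\<Sum>A\<in>words12 j. word_weight (2 # A) * nested_coeff (2 # A) n)"
      by (simp add: rho_words_def j rho_indices_eq sum.reindex)
    also have "\<dots> = 1 / real (Suc m) ^ 2 * coeff (square_factor m) j"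
      unfolding coeff_square_factor Suc
      by (subst sum_distrib_left) (auto simp del: of_nat_Suc sum.lessThan_Suc intro!: sum.cong)
    finally show ?thesis using * j by simp
  next
    case False
    hence "k = 0 \<or> k = Suc 0" by auto
    thus ?thesis using * by (auto simp: rho_words_def rho_indices_small Suc)
  qed
qed

lemma rho_expand:
  assumes "0 \<le> X" "X < 1"
  shows "rho k X = fact k / 2 ^ k * (\<Sum>A\<in>rho_words k. word_weight A * Re (polylog (ones A) (of_real (X ^ 2))))"
proof -
  have X: "0 \<le> X ^ 2" "X ^ 2 < 1" using assms power_strict_mono[of X 1 2] by auto
  consider "k = 0" | "k = 1" | "k \<ge> 2" by linarith
  thus ?thesis
  proof cases
    case 3
    have "(\<Sum>A\<in>rho_words k. word_weight A * Re (polylog (ones A) (of_real (X ^ 2)))) =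
       (\<Sum>A\<in>rho_indices k. (- 1) ^ k / 2 ^ k * (4 ^ length A * multi_L A (X ^ 2)))"
    proof (rule sum.cong)
      show "rho_words k = rho_indices k" using 3 by (simp add: rho_words_def)
      fix A assume "A \<in> rho_indices k"
      hence A: "A \<in> rho_words k" using 3 by (simp add: rho_words_def)
      have "complex_of_real (multi_L A (X ^ 2)) = polylog (ones A) (of_real (X ^ 2))"
        using rho_words_props[OF A] X 3 by (intro multi_L_eq_polylog) auto
      hence "multi_L A (X ^ 2) = Re (polylog (ones A) (of_real (X ^ 2)))" by (metis Re_complex_of_real)
      thus "word_weight A * Re (polylog (ones A) (of_real (X ^ 2))) = (- 1) ^ k / 2 ^ k * (4 ^ length A * multi_L A (X ^ 2))"
        by (simp only: rho_words_props(5)[OF A]) simp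
    qed
    also have "fact k / 2 ^ k * \<dots> = (- 1) ^ k * fact k / 4 ^ k * (\<Sum>A\<in>rho_indices k. 4 ^ length A * multi_L A (X ^ 2))"
      unfolding sum_distrib_left[symmetric] by (simp add: power_mult_distrib[symmetric])
    finally show ?thesis using 3 by (simp add: rho_def)
  qed (auto simp: rho_def rho_words_def rho_indices_small)
qed

text \<open>The real logarithm is half the sum of \<open>Ln (1 + a * e2pi t)\<close> and its
  conjugate. In the binomial expansion the factorials combine into divided powers, which are the
  series whose coefficients are known.\<close>

lemma integral_ln_norm_power:
  assumes a: "norm a < 1"
  shows "(\<integral>t. ln (norm (1 + a * e2pi t)) ^ k \<partial>unit_interval) = rho k (norm a)"
proof -
  define d where "d j n = complex_of_real (coeff (binom_poly n) j)" for j n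
  have d1: "norm (d j n) \<le> 1" for j n using abs_coeff_binom_poly_le by (simp add: d_def)
  have d': "cnj (d j n) = d j n" for j n by (simp add: d_def)
  define f where "f j t = suminf (\<lambda>m. d j m * (a * e2pi t) ^ m)" for j t
  have f: "f j t = Ln (1 + a * e2pi t) ^ j / fact j" for j t
    using log_series_eq[of "a * e2pi t" j] a by (simp add: f_def d_def log_series_def norm_mult)
  have contf: "continuous_on A (f j)" for A j
    unfolding f_def by (rule continuous_on_powser_e2pi[OF d1 a])
  have expand: "complex_of_real (ln (norm (1 + a * e2pi t)) ^ k) = fact k / 2 ^ k * (\<Sum>j\<le>k. f j t * cnj (f (k - j) t))" for t
  proof -
    define l where "l = Ln (1 + a * e2pi t)"
    have "1 + a * e2pi t \<noteq> 0"
      using a by (metis add_eq_0_iff norm_minus_cancel norm_one less_irrefl norm_mult norm_e2pi mult.right_neutral)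
    hence "ln (norm (1 + a * e2pi t)) = Re l" by (simp add: l_def)
    hence "complex_of_real (ln (norm (1 + a * e2pi t)) ^ k) = ((l + cnj l) / 2) ^ k"
      by (simp add: complex_add_cnj)
    also have "\<dots> = (\<Sum>j\<le>k. of_nat (k choose j) * l ^ j * cnj l ^ (k - j)) / 2 ^ k"
      by (simp add: power_divide binomial_ring)
    also have "(\<Sum>j\<le>k. of_nat (k choose j) * l ^ j * cnj l ^ (k - j)) = fact k * (\<Sum>j\<le>k. f j t * cnj (f (k - j) t))"
      unfolding sum_distrib_left
    proof (rule sum.cong[OF refl])
      fix j assume "j \<in> {..k}"
      hence "of_nat (k choose j) = (fact k / (fact j * fact (k - j)) :: complex)"
        by (intro binomial_fact) auto
      thus "of_nat (k choose j) * l ^ j * cnj l ^ (k - j) = fact k * (f j t * cnj (f (k - j) t))"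
        by (simp add: f l_def[symmetric])
    qed
    finally show ?thesis by simp
  qed
  define J where "J j = (\<integral>t. f j t * cnj (f (k - j) t) \<partial>unit_interval)" for j
  have J: "(\<lambda>n. d j n * d (k - j) n * of_real (norm a ^ 2) ^ n) sums J j" for j
    using parseval_e2pi[of "d j" 1 "d (k - j)" 1, OF d1 d1 a] unfolding d' f_def J_def .
  have "(\<lambda>n. \<Sum>j\<le>k. d j n * d (k - j) n * of_real (norm a ^ 2) ^ n) sums (\<Sum>j\<le>k. J j)"
    by (rule sums_sum) (rule J)
  \<comment> \<open>For fixed \<open>n\<close> the sum over \<open>j\<close> is a Cauchy product of
    coefficients, namely the coefficient of s^k in the square of
    \<open>binom_poly n\<close>.\<close>
  moreover have "(\<Sum>j\<le>k. d j n * d (k - j) n * of_real (norm a ^ 2) ^ n) =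
      (\<Sum>A\<in>rho_words k. of_real (word_weight A) * (nested_term (ones A) n * of_real (norm a ^ 2) ^ n))" for n
  proof -
    have "(\<Sum>j\<le>k. d j n * d (k - j) n * of_real (norm a ^ 2) ^ n) = of_real (coeff (binom_poly n * binom_poly n) k) * of_real (norm a ^ 2) ^ n"
      unfolding coeff_mult d_def of_real_sum sum_distrib_right by (simp only: of_real_mult)
    also have "\<dots> = (\<Sum>A\<in>rho_words k. of_real (word_weight A) * (nested_term (ones A) n * of_real (norm a ^ 2) ^ n))"
      unfolding coeff_binom_poly_square of_real_sum sum_distrib_right nested_term_ones by (simp only: of_real_mult mult_ac)
    finally show ?thesis .
  qed
  ultimately have 1: "(\<lambda>n. \<Sum>A\<in>rho_words k. of_real (word_weight A) * (nested_term (ones A) n * of_real (norm a ^ 2) ^ n)) sums (\<Sum>j\<le>k. J j)"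
    by simp
  have na: "norm (complex_of_real (norm a ^ 2)) < 1"
    using a power_strict_mono[of "norm a" 1 2] by (simp only: norm_of_real) simp
  have 2: "(\<lambda>n. \<Sum>A\<in>rho_words k. of_real (word_weight A) * (nested_term (ones A) n * of_real (norm a ^ 2) ^ n)) sums
     (\<Sum>A\<in>rho_words k. of_real (word_weight A) * polylog (ones A) (of_real (norm a ^ 2)))"
    using na rho_words_props(1) by (intro sums_sum sums_mult polylog_sums) auto
  have 3: "(\<Sum>j\<le>k. J j) = (\<Sum>A\<in>rho_words k. of_real (word_weight A) * polylog (ones A) (of_real (norm a ^ 2)))"
    by (rule sums_unique2[OF 1 2])
  have "complex_of_real (\<integral>t. ln (norm (1 + a * e2pi t)) ^ k \<partial>unit_interval) =
     (\<integral>t. fact k / 2 ^ k * (\<Sum>j\<le>k. f j t * cnj (f (k - j) t)) \<partial>unit_interval)"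
    unfolding expand[symmetric] by (rule integral_complex_of_real[symmetric])
  also have "\<dots> = fact k / 2 ^ k * (\<Sum>j\<le>k. J j)"
    unfolding J_def
    by (subst Bochner_Integration.integral_sum[symmetric])
       (auto intro!: integrable_unit_interval_continuous continuous_intros contf)
  finally have "(\<integral>t. ln (norm (1 + a * e2pi t)) ^ k \<partial>unit_interval) =
     Re (fact k / 2 ^ k * (\<Sum>A\<in>rho_words k. of_real (word_weight A) * polylog (ones A) (of_real (norm a ^ 2))))"
    unfolding 3 by (metis Re_complex_of_real)
  also have "fact k / 2 ^ k * (\<Sum>A\<in>rho_words k. of_real (word_weight A) * polylog (ones A) (of_real (norm a ^ 2))) =
     of_real (fact k / 2 ^ k) * (\<Sum>A\<in>rho_words k. of_real (word_weight A) * polylog (ones A) (of_real (norm a ^ 2)))"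
    by simp
  also have "Re \<dots> = fact k / 2 ^ k * (\<Sum>A\<in>rho_words k. word_weight A * Re (polylog (ones A) (of_real (norm a ^ 2))))"
    by (simp only: Re_sum times_complex.sel Re_complex_of_real Im_complex_of_real) simp
  also have "\<dots> = rho k (norm a)" using rho_expand[of "norm a" k] a by simp
  finally show ?thesis .
qed

section \<open>The Mahler measure\<close>

text \<open>The mean of \<open>ln (norm (b + e2pi t)) ^ k\<close> for \<open>norm b = r\<close>.
  When \<open>r > 1\<close> the factor \<open>b\<close> is taken out and the binomial theorem
  applied, which leaves a means formula with the radius \<open>1 / r\<close>.\<close>

definition inner_mean :: "nat \<Rightarrow> real \<Rightarrow> real"
  where "inner_mean k r = (if r < 1 then rho k r
    else (\<Sum>j=0..k. real (k choose j) * (rho j (1 / r) * ln r ^ (k - j))))"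

lemma integrable_ln_norm_power:
  assumes "norm a < 1"
  shows "integrable unit_interval (\<lambda>t. ln (norm (1 + a * e2pi t)) ^ k)"
proof (rule integrable_unit_interval_continuous)
  have "1 + a * e2pi t \<noteq> 0" for t
    using assms by (metis add_eq_0_iff norm_minus_cancel norm_one less_irrefl norm_mult norm_e2pi mult.right_neutral)
  thus "continuous_on {0..1} (\<lambda>t. ln (norm (1 + a * e2pi t)) ^ k)"
    by (intro continuous_intros) auto
qed

lemma integral_ln_norm_add_e2pi:
  assumes "norm b \<noteq> 1"
  shows "integrable unit_interval (\<lambda>t. ln (norm (b + e2pi t)) ^ k)"
    and "(\<integral>t. ln (norm (b + e2pi t)) ^ k \<partial>unit_interval) = inner_mean k (norm b)"
proof -
  have "integrable unit_interval (\<lambda>t. ln (norm (b + e2pi t)) ^ k) \<and>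
     (\<integral>t. ln (norm (b + e2pi t)) ^ k \<partial>unit_interval) = inner_mean k (norm b)"
  proof (cases "norm b < 1")
    case True
    \<comment> \<open>Conjugating and multiplying by a point of the unit circle preserves the norm
      and moves the small coefficient to the variable.\<close>
    have "norm (b + e2pi t) = norm (1 + cnj b * e2pi t)" for t
    proof -
      have "norm (b + e2pi t) = norm (cnj (b + e2pi t) * e2pi t)" by (simp add: norm_mult del: complex_cnj_add)
      also have "cnj (b + e2pi t) * e2pi t = 1 + cnj b * e2pi t"
        by (simp add: distrib_right e2pi_def cis_cnj cis_mult)
      finally show ?thesis .
    qed
    thus ?thesis
      using integral_ln_norm_power[of "cnj b" k] integrable_ln_norm_power[of "cnj b" k] True
      by (simp add: inner_mean_def)
  next
    case False
    hence b: "norm b > 1" using assms by simp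
    define a where "a = 1 / b"
    have a: "norm a < 1" using b by (auto simp: a_def norm_divide divide_less_eq)
    have b0: "b \<noteq> 0" using b by auto
    have "ln (norm (b + e2pi t)) ^ k = (\<Sum>j=0..k. real (k choose j) * ln (norm b) ^ (k - j) * ln (norm (1 + a * e2pi t)) ^ j)" for t
    proof -
      have "1 + a * e2pi t \<noteq> 0"
        using a by (metis add_eq_0_iff norm_minus_cancel norm_one less_irrefl norm_mult norm_e2pi mult.right_neutral)
      moreover have "b + e2pi t = b * (1 + a * e2pi t)" using b0 by (simp add: a_def field_simps)
      ultimately have "ln (norm (b + e2pi t)) = ln (norm (1 + a * e2pi t)) + ln (norm b)"
        using b0 by (simp add: norm_mult ln_mult)
      thus ?thesis by (simp add: binomial_ring atMost_atLeast0 mult_ac)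
    qed
    moreover have "integrable unit_interval (\<lambda>t. \<Sum>j=0..k. real (k choose j) * ln (norm b) ^ (k - j) * ln (norm (1 + a * e2pi t)) ^ j)"
      by (intro Bochner_Integration.integrable_sum integrable_mult_right integrable_ln_norm_power a)
    moreover have "(\<integral>t. (\<Sum>j=0..k. real (k choose j) * ln (norm b) ^ (k - j) * ln (norm (1 + a * e2pi t)) ^ j) \<partial>unit_interval)
       = (\<Sum>j=0..k. real (k choose j) * ln (norm b) ^ (k - j) * rho j (norm a))"
      by (subst Bochner_Integration.integral_sum)
         (auto intro!: integrable_mult_right integrable_ln_norm_power a simp: integral_ln_norm_power[OF a])
    moreover have "norm a = 1 / norm b" by (simp add: a_def norm_divide)
    ultimately show ?thesis using False by (simp add: inner_mean_def mult_ac)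
  qed
  thus "integrable unit_interval (\<lambda>t. ln (norm (b + e2pi t)) ^ k)"
    "(\<integral>t. ln (norm (b + e2pi t)) ^ k \<partial>unit_interval) = inner_mean k (norm b)" by auto
qed

lemma rho_bounded: "\<exists>B\<ge>0. \<forall>X. 0 \<le> X \<longrightarrow> X < 1 \<longrightarrow> \<bar>rho k X\<bar> \<le> B"
proof -
  have "\<exists>M. \<forall>z. norm z < 1 \<longrightarrow> norm (polylog (ones A) z) \<le> M" if "A \<in> rho_words k" for A
    using norm_polylog_ones_bounded rho_words_props[OF that] by blast
  then obtain M where M: "\<And>A z. A \<in> rho_words k \<Longrightarrow> norm z < 1 \<Longrightarrow> norm (polylog (ones A) z) \<le> M A" by metis
  define B where "B = \<bar>fact k / 2 ^ k\<bar> * (\<Sum>A\<in>rho_words k. \<bar>word_weight A\<bar> * M A)"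
  have "\<bar>rho k X\<bar> \<le> B" if X: "0 \<le> X" "X < 1" for X
  proof -
    have "X ^ 2 < 1" using power_strict_mono[of X 1 2] X by simp
    hence n: "norm (complex_of_real (X ^ 2)) < 1" by (simp only: norm_of_real) simp
    have "\<bar>\<Sum>A\<in>rho_words k. word_weight A * Re (polylog (ones A) (of_real (X ^ 2)))\<bar> \<le> (\<Sum>A\<in>rho_words k. \<bar>word_weight A\<bar> * M A)"
      by (rule order_trans[OF sum_abs sum_mono])
         (auto simp: abs_mult simp del: of_real_power intro!: mult_left_mono order_trans[OF abs_Re_le_cmod M] n)
    thus ?thesis unfolding rho_expand[OF X] B_def abs_mult by (intro mult_left_mono) auto
  qed
  moreover have "0 \<le> B" using calculation[of 0] by force
  ultimately show ?thesis by blast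
qed

lemma continuous_on_rho: "continuous_on {0..<1} (rho k)"
proof -
  have "continuous_on {0..<1} (\<lambda>X. fact k / 2 ^ k * (\<Sum>A\<in>rho_words k. word_weight A * Re (polylog (ones A) (of_real (X ^ 2)))))"
  proof (intro continuous_intros)
    fix A assume A: "A \<in> rho_words k"
    have "continuous_on (ball 0 1) (polylog (ones A))"
      using has_field_derivative_polylog[of "ones A"] rho_words_props(1)[OF A] DERIV_isCont
      by (intro continuous_at_imp_continuous_on) fastforce
    moreover have "continuous_on {0..<1} (\<lambda>X::real. complex_of_real (X ^ 2))" by (intro continuous_intros)
    moreover have "(\<lambda>X::real. complex_of_real (X ^ 2)) ` {0..<1} \<subseteq> ball 0 1"
      using power_strict_mono[of _ 1 2] by (auto simp del: of_real_power)
    ultimately show "continuous_on {0..<1} (\<lambda>X::real. polylog (ones A) (complex_of_real (X ^ 2)))"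
      by (rule continuous_on_compose2)
  qed
  thus ?thesis by (rule continuous_on_eq) (simp add: rho_expand)
qed

text \<open>The interval up to 2 covers all values of \<open>norm (1 + e2pi s)\<close>. There every
  \<open>rho j\<close> stays bounded and \<open>ln r \<le> r - 1 \<le> 1\<close> controls the
  logarithms.\<close>

lemma inner_mean_bounded: "\<exists>B\<ge>0. \<forall>r. 0 \<le> r \<longrightarrow> r \<le> 2 \<longrightarrow> r \<noteq> 1 \<longrightarrow> \<bar>inner_mean k r\<bar> \<le> B"
proof -
  obtain B where B: "\<And>j. B j \<ge> 0" "\<And>j X. 0 \<le> X \<Longrightarrow> X < 1 \<Longrightarrow> \<bar>rho j X\<bar> \<le> B j" using rho_bounded by metis
  define C where "C = B k + (\<Sum>j=0..k. real (k choose j) * (B j * 1 ^ (k - j)))"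
  have C: "0 \<le> (\<Sum>j=0..k. real (k choose j) * (B j * 1 ^ (k - j)))" using B by (intro sum_nonneg) auto
  have "\<bar>inner_mean k r\<bar> \<le> C" if r: "0 \<le> r" "r \<le> 2" "r \<noteq> 1" for r
  proof (cases "r < 1")
    case True
    thus ?thesis using B(2)[of r k] r C by (simp add: inner_mean_def C_def)
  next
    case False
    hence r1: "r > 1" using r by simp
    have ln: "\<bar>ln r\<bar> \<le> 1" using ln_le_minus_one[of r] ln_ge_zero[of r] r r1 by auto
    have "\<bar>inner_mean k r\<bar> \<le> (\<Sum>j=0..k. \<bar>real (k choose j) * (rho j (1 / r) * ln r ^ (k - j))\<bar>)"
      using False by (simp add: inner_mean_def sum_abs)
    also have "\<dots> \<le> (\<Sum>j=0..k. real (k choose j) * (B j * 1 ^ (k - j)))"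
      unfolding abs_mult power_abs using r1 ln B
      by (intro sum_mono mult_mono power_mono) auto
    also have "\<dots> \<le> C" using B by (simp add: C_def)
    finally show ?thesis .
  qed
  moreover have "C \<ge> 0" using B C by (simp add: C_def)
  ultimately show ?thesis by blast
qed

text \<open>Makes an upper bound for the support sufficient when a concrete polynomial is
  evaluated.\<close>

lemma laurent_eval_superset:
  assumes "finite S" "Poly_Mapping.keys P \<subseteq> S"
  shows "laurent_eval P z = (\<Sum>e\<in>S. Poly_Mapping.lookup P e * (\<Prod>i\<in>UNIV. z i powi Poly_Mapping.lookup e i))"
  unfolding laurent_eval_def using assms
  by (intro sum.mono_neutral_left) (auto simp: in_keys_iff)

lemma laurent_eval_linear:
  "laurent_eval (1 + laurent_var 1 + laurent_var 2 :: 2 laurent_poly) z = 1 + z 1 + z 2"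
proof -
  define e1 e2 :: "2 \<Rightarrow>\<^sub>0 int" where "e1 = Poly_Mapping.single 1 1" and "e2 = Poly_Mapping.single 2 1"
  have ne: "(1::2) \<noteq> 2" by simp
  have "Poly_Mapping.lookup e1 1 = 1" "Poly_Mapping.lookup e1 2 = 0" "Poly_Mapping.lookup e2 1 = 0" "Poly_Mapping.lookup e2 2 = 1"
    using ne by (auto simp: e1_def e2_def lookup_single when_def)
  note l = this
  have d: "e1 \<noteq> e2" "e1 \<noteq> 0" "e2 \<noteq> 0" using l by auto
  have P: "(1 + laurent_var 1 + laurent_var 2 :: 2 laurent_poly) =
     Poly_Mapping.single 0 1 + Poly_Mapping.single e1 1 + Poly_Mapping.single e2 1"
    by (simp add: laurent_var_def e1_def e2_def)
  have keys: "Poly_Mapping.keys (Poly_Mapping.single 0 1 + Poly_Mapping.single e1 1 + Poly_Mapping.single e2 1 :: 2 laurent_poly) \<subseteq> {0, e1, e2}"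
    by (rule order_trans[OF Poly_Mapping.keys_add]) (use Poly_Mapping.keys_add in fastforce)
  have p: "(\<Prod>i\<in>UNIV. z i powi Poly_Mapping.lookup e i) = z 1 powi Poly_Mapping.lookup e 1 * z 2 powi Poly_Mapping.lookup e 2" for e
    using ne by (simp add: UNIV_2)
  show ?thesis
    unfolding P by (subst laurent_eval_superset[OF _ keys])
      (use d in \<open>auto simp: lookup_add lookup_single lookup_one when_def p l\<close>)
qed

lemma norm_one_plus_e2pi: "norm (1 + e2pi s) = 2 * \<bar>cos (pi * s)\<bar>"
proof -
  have "norm (1 + e2pi s) ^ 2 = (2 * \<bar>cos (pi * s)\<bar>) ^ 2"
  proof -
    have "norm (1 + e2pi s) ^ 2 = (1 + cos (2 * (pi * s))) ^ 2 + sin (2 * (pi * s)) ^ 2"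
      by (simp add: cmod_power2 e2pi_def mult.assoc)
    also have "\<dots> = 2 + 2 * cos (2 * (pi * s))"
      using sin_cos_squared_add2[of "2 * (pi * s)"] by (simp add: power2_eq_square algebra_simps)
    also have "\<dots> = (2 * \<bar>cos (pi * s)\<bar>) ^ 2"
      by (simp add: cos_double_cos power_mult_distrib)
    finally show ?thesis .
  qed
  thus ?thesis by (subst (asm) power2_eq_iff_nonneg) auto
qed

text \<open>The two exceptional parameters are those for which the polynomial, as a function of the
  second variable, has its zero on the unit circle.\<close>

lemma norm_one_plus_e2pi_ne_1:
  assumes "0 \<le> s" "s \<le> 1" "s \<noteq> 1 / 3" "s \<noteq> 2 / 3"
  shows "norm (1 + e2pi s) \<noteq> 1"
proof
  assume "norm (1 + e2pi s) = 1"
  hence "cos (pi * s) = 1 / 2 \<or> cos (pi * s) = - 1 / 2" by (auto simp: norm_one_plus_e2pi)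
  hence "cos (pi * s) = cos (pi / 3) \<or> cos (pi * s) = cos (2 * pi / 3)" by (simp add: cos_60 cos_120)
  moreover have "0 \<le> pi * s" "pi * s \<le> pi" using assms by (auto intro: mult_left_le)
  ultimately have "pi * s = pi / 3 \<or> pi * s = 2 * pi / 3"
    using cos_inj_pi[of "pi * s" "pi / 3"] cos_inj_pi[of "pi * s" "2 * pi / 3"] by auto
  thus False using assms by (auto simp: field_simps)
qed

lemma exp_eq_e2pi: "exp (2 * of_real pi * \<i> * of_real t) = e2pi t"
  by (simp add: e2pi_def cis_conv_exp mult_ac)

text \<open>Fubini requires integrability over the square although the logarithm is unbounded near
  the zeros. It comes from Tonelli: the inner integral of the absolute value is bounded, off a null
  set, by a mean of an even power, and such means are values of
  \<open>inner_mean (2 * k)\<close>.\<close>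

lemma mahler_eq_inner_mean:
  "mahler k (1 + laurent_var 1 + laurent_var 2 :: 2 laurent_poly) =
     (LBINT s:{0..1}. inner_mean k (2 * \<bar>cos (pi * s)\<bar>))"
proof -
  define U where "U = unit_interval"
  have fin: "finite_measure U"
    using emeasure_unit_interval by (intro finite_measureI) (simp add: U_def)
  interpret U: finite_measure U by (rule fin)
  interpret P: product_sigma_finite "\<lambda>_::2. U" by unfold_locales
  define g where "g s y = ln (norm (1 + e2pi s + e2pi y))" for s y
  define F where "F t = g (t 1) (t 2) ^ k" for t :: "2 \<Rightarrow> real"
  have em [measurable]: "e2pi \<in> borel_measurable U"
    unfolding U_def by (intro measurable_restrict_space1 borel_measurable_continuous_onI continuous_intros)
       (auto intro!: borel_measurable_continuous_onI continuous_intros)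
  have Fm [measurable]: "F \<in> borel_measurable (Pi\<^sub>M {1, 2} (\<lambda>_::2. U))"
    unfolding F_def g_def by measurable
  have ins: "{1, 2} = insert (2::2) {1}" by auto
  have ne: "(2::2) \<notin> {1}" by simp
  have spU: "space U = {0..1}" by (simp add: U_def space_restrict_space)
  have gm2: "(\<lambda>(s, y). g s y) \<in> borel_measurable (U \<Otimes>\<^sub>M U)"
    unfolding g_def case_prod_beta by measurable
  have gm: "(\<lambda>y. g s y ^ j) \<in> borel_measurable U" for s j
    unfolding g_def by measurable
  obtain B where B: "B \<ge> 0" "\<And>r. 0 \<le> r \<Longrightarrow> r \<le> 2 \<Longrightarrow> r \<noteq> 1 \<Longrightarrow> \<bar>inner_mean (2 * k) r\<bar> \<le> B"
    using inner_mean_bounded by metis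
  have inner: "integrable U (\<lambda>y. g s y ^ j)" "(\<integral>y. g s y ^ j \<partial>U) = inner_mean j (2 * \<bar>cos (pi * s)\<bar>)"
    if "s \<in> space U" "s \<notin> {1 / 3, 2 / 3}" for s j
    using integral_ln_norm_add_e2pi[of "1 + e2pi s" j] norm_one_plus_e2pi_ne_1[of s] that
    by (simp_all add: U_def g_def spU[unfolded U_def] norm_one_plus_e2pi)
  have nn_inner: "(\<integral>\<^sup>+ y. ennreal (norm (g s y ^ k)) \<partial>U) \<le> ennreal (1 + B)"
    if s: "s \<in> space U" "s \<notin> {1 / 3, 2 / 3}" for s
  proof -
    \<comment> \<open>An even power is nonnegative, so its integral is covered by the mean value
      formula without absolute values.\<close>
    have "norm (x ^ k) \<le> 1 + x ^ (2 * k)" for x :: real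
    proof -
      have "0 \<le> (\<bar>x ^ k\<bar> - 1 / 2) ^ 2" by simp
      hence "\<bar>x ^ k\<bar> \<le> 1 + \<bar>x ^ k\<bar> ^ 2" unfolding power2_diff by (simp add: power2_eq_square)
      thus ?thesis by (simp add: power_mult[symmetric] mult.commute)
    qed
    hence "(\<integral>\<^sup>+ y. ennreal (norm (g s y ^ k)) \<partial>U) \<le> (\<integral>\<^sup>+ y. ennreal (1 + g s y ^ (2 * k)) \<partial>U)"
      by (intro nn_integral_mono ennreal_leI)
    also have "\<dots> = ennreal (\<integral>y. 1 + g s y ^ (2 * k) \<partial>U)"
      by (intro nn_integral_eq_integral Bochner_Integration.integrable_add inner s) 
         (auto simp: power_mult)
    also have "(\<integral>y. 1 + g s y ^ (2 * k) \<partial>U) = 1 + inner_mean (2 * k) (2 * \<bar>cos (pi * s)\<bar>)"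
      using inner[OF s, of "2 * k"] measure_unit_interval
      by (subst Bochner_Integration.integral_add) (auto simp: U_def[symmetric])
    also have "\<dots> \<le> 1 + B"
      using B(2)[of "2 * \<bar>cos (pi * s)\<bar>"] norm_one_plus_e2pi_ne_1[of s] s spU by (auto simp: norm_one_plus_e2pi)
    finally show ?thesis by (simp add: ennreal_leI)
  qed
  have null: "AE s in U. s \<notin> {1 / 3, 2 / 3}"
  proof -
    have "AE s in lborel. s \<notin> {1 / 3, 2 / 3 :: real}"
      by (rule AE_not_in) (simp add: finite_imp_null_set_lborel)
    thus ?thesis unfolding U_def by (subst AE_restrict_space_iff) auto
  qed
  have Fint: "integrable (Pi\<^sub>M {1, 2} (\<lambda>_::2. U)) F"
  proof (rule integrableI_bounded[OF Fm])
    have "(\<integral>\<^sup>+ x. ennreal (norm (F x)) \<partial>Pi\<^sub>M {1, 2} (\<lambda>_::2. U)) = 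
       (\<integral>\<^sup>+ x. (\<integral>\<^sup>+ y. ennreal (norm (F (x(2 := y)))) \<partial>U) \<partial>Pi\<^sub>M {1} (\<lambda>_::2. U))"
      unfolding ins by (rule P.product_nn_integral_insert) (use ne Fm in \<open>auto simp: ins\<close>)
    also have "\<dots> = (\<integral>\<^sup>+ x. (\<integral>\<^sup>+ y. ennreal (norm (g (x 1) y ^ k)) \<partial>U) \<partial>Pi\<^sub>M {1} (\<lambda>_::2. U))"
      by (simp add: F_def)
    also have "\<dots> = (\<integral>\<^sup>+ s. (\<integral>\<^sup>+ y. ennreal (norm (g s y ^ k)) \<partial>U) \<partial>U)"
      by (rule P.product_nn_integral_singleton, rule U.borel_measurable_nn_integral)
         (use gm2 in \<open>auto simp: case_prod_beta\<close>)
    also have "\<dots> \<le> (\<integral>\<^sup>+ s. ennreal (1 + B) \<partial>U)"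
    proof (rule nn_integral_mono_AE)
      show "AE s in U. (\<integral>\<^sup>+ y. ennreal (norm (g s y ^ k)) \<partial>U) \<le> ennreal (1 + B)"
        using null AE_space by eventually_elim (rule nn_inner)
    qed
    also have "\<dots> < \<infinity>" by (simp add: ennreal_mult_less_top U.emeasure_eq_measure)
    finally show "(\<integral>\<^sup>+ x. ennreal (norm (F x)) \<partial>Pi\<^sub>M {1, 2} (\<lambda>_::2. U)) < \<infinity>" .
  qed
  have "mahler k (1 + laurent_var 1 + laurent_var 2 :: 2 laurent_poly) = integral\<^sup>L (Pi\<^sub>M {1, 2} (\<lambda>_::2. U)) F"
    unfolding mahler_def laurent_eval_linear exp_eq_e2pi UNIV_2 U_def F_def g_def ..
  also have "\<dots> = (\<integral>x. (\<integral>y. F (x(2 := y)) \<partial>U) \<partial>Pi\<^sub>M {1} (\<lambda>_::2. U))"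
    unfolding ins by (rule P.product_integral_insert) (use ne Fint in \<open>auto simp: ins\<close>)
  also have "\<dots> = (\<integral>x. (\<integral>y. g (x 1) y ^ k \<partial>U) \<partial>Pi\<^sub>M {1} (\<lambda>_::2. U))"
    by (simp add: F_def)
  also have "\<dots> = (\<integral>s. (\<integral>y. g s y ^ k \<partial>U) \<partial>U)"
    by (rule P.product_integral_singleton, rule U.borel_measurable_lebesgue_integral)
       (use gm2 in \<open>auto simp: case_prod_beta\<close>)
  also have "\<dots> = (\<integral>s. inner_mean k (2 * \<bar>cos (pi * s)\<bar>) \<partial>U)"
  proof (rule integral_discrete_difference[where X = "{1 / 3, 2 / 3}"])
    fix s :: real assume "s \<in> {1 / 3, 2 / 3}"
    thus "{s} \<in> sets U" "emeasure U {s} = 0" by (auto simp: U_def sets_restrict_space emeasure_restrict_space)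
  qed (auto simp: inner)
  finally show ?thesis by (simp add: U_def integral_unit_interval)
qed

lemma set_integral_sum_mult:
  fixes f :: "'i \<Rightarrow> real \<Rightarrow> real"
  assumes "\<And>i. i \<in> I \<Longrightarrow> set_integrable lborel S (f i)"
  shows "(LBINT x:S. (\<Sum>i\<in>I. c i * f i x)) = (\<Sum>i\<in>I. c i * (LBINT x:S. f i x))"
proof -
  have "(LBINT x:S. (\<Sum>i\<in>I. c i * f i x)) = (\<integral>x. (\<Sum>i\<in>I. c i * (indicator S x *\<^sub>R f i x)) \<partial>lborel)"
    by (simp add: set_lebesgue_integral_def sum_distrib_left mult_ac)
  also have "\<dots> = (\<Sum>i\<in>I. c i * (LBINT x:S. f i x))"
    using assms by (subst Bochner_Integration.integral_sum)
      (auto simp: set_lebesgue_integral_def set_integrable_def)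
  finally show ?thesis .
qed

lemma set_integrable_Icc_iff_Ioo:
  fixes f :: "real \<Rightarrow> 'a::{banach, second_countable_topology}"
  shows "set_integrable lborel {a..b} f \<longleftrightarrow> set_integrable lborel {a<..<b} f"
  by (rule set_integrable_discrete_difference[where X = "{a, b}"]) auto

lemma set_integrable_rho_small: "set_integrable lborel {0..pi/6} (\<lambda>\<theta>. rho k (2 * sin \<theta>))"
proof -
  obtain B where B: "\<And>X. 0 \<le> X \<Longrightarrow> X < 1 \<Longrightarrow> \<bar>rho k X\<bar> \<le> B" using rho_bounded by blast
  show ?thesis
    unfolding set_integrable_Icc_iff_Ioo
  proof (rule set_integrable_bounded_open_interval)
    show "continuous_on {0<..<pi/6} (\<lambda>\<theta>. rho k (2 * sin \<theta>))"
      by (rule continuous_on_compose2[OF continuous_on_rho])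
         (use sin_cos_bounds in \<open>fastforce intro!: continuous_intros\<close>)+
    show "norm (rho k (2 * sin \<theta>)) \<le> B" if "0 < \<theta>" "\<theta> < pi / 6" for \<theta>
      using B[of "2 * sin \<theta>"] sin_cos_bounds[OF that] by simp
  qed
qed

lemma set_integrable_rho_large:
  "set_integrable lborel {pi/6..pi/2} (\<lambda>\<theta>. rho j (1 / (2 * sin \<theta>)) * ln (2 * sin \<theta>) ^ m)"
proof -
  obtain B where B: "B \<ge> 0" "\<And>X. 0 \<le> X \<Longrightarrow> X < 1 \<Longrightarrow> \<bar>rho j X\<bar> \<le> B" using rho_bounded by blast
  show ?thesis
    unfolding set_integrable_Icc_iff_Ioo
  proof (rule set_integrable_bounded_open_interval)
    have "continuous_on {pi/6<..<pi/2} (\<lambda>\<theta>. rho j (1 / (2 * sin \<theta>)))"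
    proof (rule continuous_on_compose2[OF continuous_on_rho])
      show "continuous_on {pi / 6<..<pi / 2} (\<lambda>\<theta>. 1 / (2 * sin \<theta>))"
        using sin_cos_bounds' by (intro continuous_intros) force
      show "(\<lambda>\<theta>. 1 / (2 * sin \<theta>)) ` {pi / 6<..<pi / 2} \<subseteq> {0..<1}"
      proof safe
        fix \<theta> :: real assume "\<theta> \<in> {pi / 6<..<pi / 2}"
        thus "1 / (2 * sin \<theta>) \<in> {0..<1}" using sin_cos_bounds'[of \<theta>] by auto
      qed
    qed
    moreover have "continuous_on {pi/6<..<pi/2} (\<lambda>\<theta>. ln (2 * sin \<theta>) ^ m)"
      using sin_cos_bounds' by (intro continuous_intros) force
    ultimately show "continuous_on {pi/6<..<pi/2} (\<lambda>\<theta>. rho j (1 / (2 * sin \<theta>)) * ln (2 * sin \<theta>) ^ m)"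
      by (rule continuous_on_mult)
    show "norm (rho j (1 / (2 * sin \<theta>)) * ln (2 * sin \<theta>) ^ m) \<le> B * 1 ^ m" if "pi / 6 < \<theta>" "\<theta> < pi / 2" for \<theta>
    proof -
      note s = sin_cos_bounds'[OF that]
      have "\<bar>ln (2 * sin \<theta>)\<bar> \<le> 1"
        using s ln_le_minus_one[of "2 * sin \<theta>"] ln_ge_zero[of "2 * sin \<theta>"] by auto
      moreover have "\<bar>rho j (1 / (2 * sin \<theta>))\<bar> \<le> B"
        using s by (intro B) auto
      ultimately show ?thesis
        unfolding real_norm_def abs_mult power_abs using B by (intro mult_mono power_mono) auto
    qed
  qed
qed

text \<open>After the substitution the integrand \<open>\<phi>\<close> is even and changes its
  formula at \<open>pi / 6\<close>, where \<open>2 * sin \<theta>\<close> passes 1. The points 0,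
  \<open>pi / 6\<close> and \<open>pi / 2\<close> are added or removed freely as null sets.\<close>

lemma pi_mahler_eq:
  "pi * mahler k (1 + laurent_var 1 + laurent_var 2 :: 2 laurent_poly) =
     2 * (LBINT \<theta>:{0..pi/6}. rho k (2 * sin \<theta>)) +
     2 * (\<Sum>j=0..k. real (k choose j) *
       (LBINT \<theta>:{pi/6..pi/2}. rho j (1 / (2 * sin \<theta>)) * (ln (2 * sin \<theta>)) ^ (k - j)))"
proof -
  define \<phi> where "\<phi> \<theta> = inner_mean k (2 * \<bar>sin \<theta>\<bar>)" for \<theta>
  have small: "\<phi> \<theta> = rho k (2 * sin \<theta>)" if "0 < \<theta>" "\<theta> < pi / 6" for \<theta>
    using sin_cos_bounds[OF that] by (simp add: \<phi>_def inner_mean_def)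
  have large: "\<phi> \<theta> = (\<Sum>j=0..k. real (k choose j) * (rho j (1 / (2 * sin \<theta>)) * ln (2 * sin \<theta>) ^ (k - j)))"
    if "pi / 6 < \<theta>" "\<theta> < pi / 2" for \<theta>
    using sin_cos_bounds'[OF that] by (simp add: \<phi>_def inner_mean_def)
  have i1: "set_integrable lborel {0<..<pi/6} \<phi>"
    using set_integrable_rho_small[of k] unfolding set_integrable_Icc_iff_Ioo
    by (rule set_integrable_cong[THEN iffD1, rotated -1]) (auto simp: small)
  have i2: "set_integrable lborel {pi/6<..<pi/2} \<phi>"
  proof -
    have "set_integrable lborel {pi/6<..<pi/2} (\<lambda>\<theta>. rho j (1 / (2 * sin \<theta>)) * ln (2 * sin \<theta>) ^ m)" for j m
      using set_integrable_rho_large unfolding set_integrable_Icc_iff_Ioo .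
    hence "set_integrable lborel {pi/6<..<pi/2} (\<lambda>\<theta>. \<Sum>j=0..k. real (k choose j) * (rho j (1 / (2 * sin \<theta>)) * ln (2 * sin \<theta>) ^ (k - j)))"
      unfolding set_integrable_def scaleR_sum_right
      by (intro Bochner_Integration.integrable_sum) (simp add: mult.left_commute)
    thus ?thesis by (rule set_integrable_cong[THEN iffD1, rotated -1]) (auto simp: large)
  qed
  have U: "{0<..<pi/6} \<inter> {pi/6<..<pi/2} = {}" by auto
  have i3: "set_integrable lborel ({0<..<pi/6} \<union> {pi/6<..<pi/2}) \<phi>"
    by (intro set_integrable_Un i1 i2) auto
  have i4: "set_integrable lborel {0<..pi/2} \<phi>"
    using i3 by (rule set_integrable_discrete_difference[where X = "{pi/6, pi/2}", THEN iffD1, rotated -1]) (auto intro: less_trans[of _ "pi/6"])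
  have eq1: "(LBINT \<theta>:{0<..pi/2}. \<phi> \<theta>) = (LBINT \<theta>:{0<..<pi/6} \<union> {pi/6<..<pi/2}. \<phi> \<theta>)"
    by (rule set_integral_discrete_difference[where X = "{pi/6, pi/2}"]) (auto intro: less_trans[of _ "pi/6"])
  have eq2: "(LBINT \<theta>:{0<..pi/2}. \<phi> \<theta>) = (LBINT \<theta>:{0..pi/6}. rho k (2 * sin \<theta>)) +
     (\<Sum>j=0..k. real (k choose j) * (LBINT \<theta>:{pi/6..pi/2}. rho j (1 / (2 * sin \<theta>)) * (ln (2 * sin \<theta>)) ^ (k - j)))"
  proof -
    have "(LBINT \<theta>:{0<..<pi/6}. \<phi> \<theta>) = (LBINT \<theta>:{0..pi/6}. rho k (2 * sin \<theta>))"
      unfolding set_integral_Icc_eq_Ioo by (rule set_lebesgue_integral_cong) (auto simp: small)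
    moreover have "(LBINT \<theta>:{pi/6<..<pi/2}. \<phi> \<theta>) =
      (LBINT \<theta>:{pi/6..pi/2}. (\<Sum>j=0..k. real (k choose j) * (rho j (1 / (2 * sin \<theta>)) * ln (2 * sin \<theta>) ^ (k - j))))"
      unfolding set_integral_Icc_eq_Ioo by (rule set_lebesgue_integral_cong) (auto simp: large)
    moreover have "\<dots> = (\<Sum>j=0..k. real (k choose j) * (LBINT \<theta>:{pi/6..pi/2}. rho j (1 / (2 * sin \<theta>)) * (ln (2 * sin \<theta>)) ^ (k - j)))"
      by (intro set_integral_sum_mult set_integrable_rho_large)
    ultimately show ?thesis unfolding eq1 set_integral_Un[OF U i1 i2] by simp
  qed
  have even: "\<phi> (- \<theta>) = \<phi> \<theta>" for \<theta> by (simp add: \<phi>_def)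
  have ind: "indicator {- pi/2..<0} (0 + - 1 * \<theta>) = (indicator {0<..pi/2} \<theta> :: real)" for \<theta>
    by (auto simp: indicator_def)
  have neg: "(LBINT \<theta>:{- pi/2..<0}. \<phi> \<theta>) = (LBINT \<theta>:{0<..pi/2}. \<phi> \<theta>)"
    unfolding set_lebesgue_integral_def
    by (subst lborel_integral_real_affine[where c = "- 1" and t = 0]) (simp_all only: ind, simp_all add: even)
  have i5: "set_integrable lborel {- pi/2..<0} \<phi>"
  proof -
    have ind': "indicator {0<..pi/2} (0 + - 1 * \<theta>) = (indicator {- pi/2..<0} \<theta> :: real)" for \<theta>
      by (auto simp: indicator_def)
    have "integrable lborel (\<lambda>\<theta>. indicator {0<..pi/2} (0 + - 1 * \<theta>) *\<^sub>R \<phi> (0 + - 1 * \<theta>))"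
      using i4 unfolding set_integrable_def by (rule lborel_integrable_real_affine) simp
    thus ?thesis unfolding ind' set_integrable_def by (simp add: even)
  qed
  have "mahler k (1 + laurent_var 1 + laurent_var 2 :: 2 laurent_poly) =
     (\<integral>s. indicator {0..1} s *\<^sub>R inner_mean k (2 * \<bar>cos (pi * s)\<bar>) \<partial>lborel)"
    unfolding mahler_eq_inner_mean set_lebesgue_integral_def ..
  \<comment> \<open>The substitution \<open>s = 1 / 2 + \<theta> / pi\<close> turns the cosine into
    minus a sine, and its Jacobian cancels the factor pi in the claim.\<close>
  also have "\<dots> = \<bar>1 / pi\<bar> *\<^sub>R (\<integral>\<theta>. indicator {0..1} (1 / 2 + 1 / pi * \<theta>) *\<^sub>R inner_mean k (2 * \<bar>cos (pi * (1 / 2 + 1 / pi * \<theta>))\<bar>) \<partial>lborel)"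
    by (rule lborel_integral_real_affine) simp
  also have "(\<lambda>\<theta>. indicator {0..1} (1 / 2 + 1 / pi * \<theta>) *\<^sub>R inner_mean k (2 * \<bar>cos (pi * (1 / 2 + 1 / pi * \<theta>))\<bar>)) =
      (\<lambda>\<theta>. indicator {- pi/2..pi/2} \<theta> *\<^sub>R \<phi> \<theta>)"
  proof
    fix \<theta> :: real
    have "pi * (1 / 2 + 1 / pi * \<theta>) = pi / 2 + \<theta>" by (simp add: field_simps)
    hence "cos (pi * (1 / 2 + 1 / pi * \<theta>)) = - sin \<theta>" by (simp add: cos_add)
    moreover have "indicator {0..1} (1 / 2 + 1 / pi * \<theta>) = (indicator {- pi/2..pi/2} \<theta> :: real)"
      by (auto simp: indicator_def field_simps)
    ultimately show "indicator {0..1} (1 / 2 + 1 / pi * \<theta>) *\<^sub>R inner_mean k (2 * \<bar>cos (pi * (1 / 2 + 1 / pi * \<theta>))\<bar>) =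
      indicator {- pi/2..pi/2} \<theta> *\<^sub>R \<phi> \<theta>" by (simp add: \<phi>_def)
  qed
  also have "(\<integral>\<theta>. indicator {- pi/2..pi/2} \<theta> *\<^sub>R \<phi> \<theta> \<partial>lborel) = (LBINT \<theta>:{- pi/2..<0} \<union> {0<..pi/2}. \<phi> \<theta>)"
    unfolding set_lebesgue_integral_def[symmetric]
    by (rule set_integral_discrete_difference[where X = "{0}"]) auto
  also have "\<dots> = (LBINT \<theta>:{- pi/2..<0}. \<phi> \<theta>) + (LBINT \<theta>:{0<..pi/2}. \<phi> \<theta>)"
    by (rule set_integral_Un[OF _ i5 i4]) auto
  finally have "pi * mahler k (1 + laurent_var 1 + laurent_var 2 :: 2 laurent_poly) = 2 * (LBINT \<theta>:{0<..pi/2}. \<phi> \<theta>)"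
    using neg by simp
  thus ?thesis unfolding eq2 by simp
qed

section \<open>Membership of both integrals in the space of polylogarithm values\<close>

lemma of_real_of_rat: "complex_of_real (of_rat q) = of_rat q"
  by (cases q) (simp add: of_rat_rat)

lemma i_MPL_space_add:
  "x \<in> (*) \<i> ` MPL_space n N \<Longrightarrow> y \<in> (*) \<i> ` MPL_space n N \<Longrightarrow> x + y \<in> (*) \<i> ` MPL_space n N"
  by (auto simp: distrib_left[symmetric] intro!: imageI MPL_space_add)

lemma i_MPL_space_scale: "x \<in> (*) \<i> ` MPL_space n N \<Longrightarrow> of_rat q * x \<in> (*) \<i> ` MPL_space n N"
  by (auto simp: mult.left_commute[of _ \<i>] intro!: imageI MPL_space_scale)

lemma i_MPL_space_sum:
  "(\<And>i. i \<in> I \<Longrightarrow> f i \<in> (*) \<i> ` MPL_space n N) \<Longrightarrow> sum f I \<in> (*) \<i> ` MPL_space n N"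
proof (induction I rule: infinite_finite_induct)
  case (insert x F)
  thus ?case by (simp add: i_MPL_space_add)
qed (auto intro!: image_eqI[of _ _ 0])

lemma integral_rho_small_in_MPL_space:
  assumes "k > 0"
  shows "complex_of_real (LBINT \<theta>:{0..pi/6}. rho k (2 * sin \<theta>)) \<in> (*) \<i> ` MPL_space (k + 1) 3"
proof (cases "k = 1")
  case True
  have "(LBINT \<theta>:{0..pi/6}. rho k (2 * sin \<theta>)) = 0" using True by (simp add: rho_def set_lebesgue_integral_def)
  thus ?thesis by (auto intro!: image_eqI[of _ _ 0])
next
  case False
  hence k: "k \<ge> 2" using assms by simp
  define q :: "nat list \<Rightarrow> rat" where "q A = (- 1) ^ k * fact k / 4 ^ k * 4 ^ length A" for A
  have q: "real_of_rat (q A) = (- 1) ^ k * fact k / 4 ^ k * 4 ^ length A" for A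
  proof -
    have "real_of_rat (fact k) = fact k" by (metis of_nat_fact of_rat_of_nat_eq)
    thus ?thesis by (simp add: q_def of_rat_mult of_rat_divide of_rat_power of_rat_minus)
  qed
  have fin: "finite (rho_indices k)" using finite_rho_words[of k] assms by (simp add: rho_words_def)
  have A: "A \<noteq> []" "0 \<notin> set A" "hd A \<ge> 2" "sum_list A = k" if "A \<in> rho_indices k" for A
    using rho_words_props[of A k] that assms by (auto simp: rho_words_def)
  have "(LBINT \<theta>:{0..pi/6}. rho k (2 * sin \<theta>)) = (LBINT \<theta>:{0..pi/6}. (\<Sum>A\<in>rho_indices k. real_of_rat (q A) * multi_L A ((2 * sin \<theta>) ^ 2)))"
    using k by (simp add: rho_def q sum_distrib_left mult_ac)
  also have "\<dots> = (\<Sum>A\<in>rho_indices k. real_of_rat (q A) * (LBINT \<theta>:{0..pi/6}. multi_L A ((2 * sin \<theta>) ^ 2)))"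
  proof (rule set_integral_sum_mult)
    fix B assume "B \<in> rho_indices k"
    note B = A[OF this]
    obtain M where M: "\<And>z. norm z < 1 \<Longrightarrow> norm (polylog (ones B) z) \<le> M"
      using norm_polylog_ones_bounded[of B] B by auto
    have range: "0 \<le> (2 * sin \<theta>) ^ 2" "(2 * sin \<theta>) ^ 2 < 1" if "0 < \<theta>" "\<theta> < pi / 6" for \<theta>
      using sin_cos_bounds[OF that] power_strict_mono[of "2 * sin \<theta>" 1 2] by auto
    have eq: "multi_L B ((2 * sin \<theta>) ^ 2) = Re (polylog (ones B) (of_real ((2 * sin \<theta>) ^ 2)))"
      if "0 < \<theta>" "\<theta> < pi / 6" for \<theta>
      using multi_L_eq_polylog[OF B(1,2) range[OF that]] by (metis Re_complex_of_real)
    have nrm: "norm (complex_of_real ((2 * sin \<theta>) ^ 2)) < 1" if "0 < \<theta>" "\<theta> < pi / 6" for \<theta>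
      using range[OF that] by (simp only: norm_of_real abs_of_nonneg)
    have "set_integrable lborel {0<..<pi/6} (\<lambda>\<theta>. Re (polylog (ones B) (of_real ((2 * sin \<theta>) ^ 2))))"
    proof (rule set_integrable_bounded_open_interval)
      have "continuous_on (ball 0 1) (polylog (ones B))"
        using has_field_derivative_polylog[of "ones B"] B DERIV_isCont
        by (intro continuous_at_imp_continuous_on) fastforce
      moreover have "continuous_on {0<..<pi/6} (\<lambda>\<theta>. complex_of_real ((2 * sin \<theta>) ^ 2))" by (intro continuous_intros)
      moreover have "(\<lambda>\<theta>. complex_of_real ((2 * sin \<theta>) ^ 2)) ` {0<..<pi/6} \<subseteq> ball 0 1"
        using nrm by (auto simp del: of_real_power of_real_mult)
      ultimately have "continuous_on {0<..<pi/6} (\<lambda>\<theta>. polylog (ones B) (of_real ((2 * sin \<theta>) ^ 2)))"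
        by (rule continuous_on_compose2)
      thus "continuous_on {0<..<pi/6} (\<lambda>\<theta>. Re (polylog (ones B) (of_real ((2 * sin \<theta>) ^ 2))))"
        by (intro continuous_intros)
      show "norm (Re (polylog (ones B) (of_real ((2 * sin \<theta>) ^ 2)))) \<le> M" if "0 < \<theta>" "\<theta> < pi / 6" for \<theta>
        unfolding real_norm_def by (rule order_trans[OF abs_Re_le_cmod M[OF nrm[OF that]]])
    qed
    thus "set_integrable lborel {0..pi/6} (\<lambda>\<theta>. multi_L B ((2 * sin \<theta>) ^ 2))"
      unfolding set_integrable_Icc_iff_Ioo
      by (rule set_integrable_cong[THEN iffD1, rotated -1])
         (rule refl | use eq in \<open>simp only: greaterThanLessThan_iff\<close>)+
  qed
  finally have "complex_of_real (LBINT \<theta>:{0..pi/6}. rho k (2 * sin \<theta>)) =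
     (\<Sum>A\<in>rho_indices k. of_rat (q A) * of_real (LBINT \<theta>:{0..pi/6}. multi_L A ((2 * sin \<theta>) ^ 2)))"
    by (simp add: of_real_of_rat)
  also have "\<dots> \<in> (*) \<i> ` MPL_space (k + 1) 3"
  proof (intro i_MPL_space_sum i_MPL_space_scale)
    fix B assume "B \<in> rho_indices k"
    note B = A[OF this]
    show "complex_of_real (LBINT \<theta>:{0..pi/6}. multi_L B ((2 * sin \<theta>) ^ 2)) \<in> (*) \<i> ` MPL_space (k + 1) 3"
      using integral_multi_L_circle[OF B(1-3)] B(4) by simp
  qed
  finally show ?thesis .
qed

lemma integral_rho_large_in_MPL_space:
  assumes "j \<le> k"
  shows "complex_of_real (LBINT \<theta>:{pi/6..pi/2}. rho j (1 / (2 * sin \<theta>)) * ln (2 * sin \<theta>) ^ (k - j)) \<in> (*) \<i> ` MPL_space (k + 1) 3"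
proof -
  define q :: "nat list \<Rightarrow> rat" where "q A = fact j / 2 ^ j * ((- 1) ^ j * 4 ^ length A / 2 ^ j)" for A
  have q: "real_of_rat (q A) = fact j / 2 ^ j * word_weight A" if "A \<in> rho_words j" for A
  proof -
    have "real_of_rat (fact j) = fact j" by (metis of_nat_fact of_rat_of_nat_eq)
    thus ?thesis by (simp add: q_def rho_words_props(5)[OF that] of_rat_mult of_rat_divide of_rat_power of_rat_minus)
  qed
  define f where "f A \<theta> = Re (polylog (ones A) (of_real ((1 / (2 * sin \<theta>)) ^ 2))) * ln (2 * sin \<theta>) ^ (k - j)" for A \<theta>
  have "(LBINT \<theta>:{pi/6..pi/2}. rho j (1 / (2 * sin \<theta>)) * ln (2 * sin \<theta>) ^ (k - j)) =
     (LBINT \<theta>:{pi/6..pi/2}. (\<Sum>A\<in>rho_words j. real_of_rat (q A) * f A \<theta>))"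
  proof (rule set_integral_cong_Ioo)
    fix \<theta> assume \<theta>: "pi / 6 < \<theta>" "\<theta> < pi / 2"
    have "rho j (1 / (2 * sin \<theta>)) = fact j / 2 ^ j * (\<Sum>A\<in>rho_words j. word_weight A * Re (polylog (ones A) (of_real ((1 / (2 * sin \<theta>)) ^ 2))))"
      using sin_cos_bounds'[OF \<theta>] by (intro rho_expand) auto
    also have "\<dots> * ln (2 * sin \<theta>) ^ (k - j) = (\<Sum>A\<in>rho_words j. real_of_rat (q A) * f A \<theta>)"
      unfolding sum_distrib_left sum_distrib_right f_def by (intro sum.cong refl) (simp only: q mult_ac)
    finally show "rho j (1 / (2 * sin \<theta>)) * ln (2 * sin \<theta>) ^ (k - j) = (\<Sum>A\<in>rho_words j. real_of_rat (q A) * f A \<theta>)" .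
  qed
  also have "\<dots> = (\<Sum>A\<in>rho_words j. real_of_rat (q A) * (LBINT \<theta>:{pi/6..pi/2}. f A \<theta>))"
  proof (rule set_integral_sum_mult)
    fix A assume A: "A \<in> rho_words j"
    obtain M where M: "\<And>z. norm z < 1 \<Longrightarrow> norm (polylog (ones A) z) \<le> M"
      using norm_polylog_ones_bounded[of A] rho_words_props[OF A] by auto
    have M0: "M \<ge> 0" using order_trans[OF norm_ge_zero M[of 0]] by simp
    have range: "norm (complex_of_real ((1 / (2 * sin \<theta>)) ^ 2)) < 1" if "pi / 6 < \<theta>" "\<theta> < pi / 2" for \<theta>
    proof -
      have "(1 / (2 * sin \<theta>)) ^ 2 < 1 ^ 2"
        using sin_cos_bounds'[OF that] by (intro power_strict_mono) auto
      thus ?thesis by (simp only: norm_of_real) simp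
    qed
    show "set_integrable lborel {pi/6..pi/2} (f A)"
      unfolding set_integrable_Icc_iff_Ioo
    proof (rule set_integrable_bounded_open_interval)
      have "continuous_on (ball 0 1) (polylog (ones A))"
        using has_field_derivative_polylog[of "ones A"] rho_words_props[OF A] DERIV_isCont
        by (intro continuous_at_imp_continuous_on) fastforce
      moreover have "continuous_on {pi/6<..<pi/2} (\<lambda>\<theta>. complex_of_real ((1 / (2 * sin \<theta>)) ^ 2))"
        using sin_cos_bounds' by (intro continuous_intros) force
      moreover have "(\<lambda>\<theta>. complex_of_real ((1 / (2 * sin \<theta>)) ^ 2)) ` {pi/6<..<pi/2} \<subseteq> ball 0 1"
        using range by (auto simp del: of_real_power of_real_mult of_real_divide)
      ultimately have "continuous_on {pi/6<..<pi/2} (\<lambda>\<theta>. polylog (ones A) (of_real ((1 / (2 * sin \<theta>)) ^ 2)))"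
        by (rule continuous_on_compose2)
      thus "continuous_on {pi/6<..<pi/2} (f A)"
        unfolding f_def using sin_cos_bounds' by (intro continuous_intros) (auto, force)
      show "norm (f A \<theta>) \<le> M * 1 ^ (k - j)" if "pi / 6 < \<theta>" "\<theta> < pi / 2" for \<theta>
      proof -
        note s = sin_cos_bounds'[OF that]
        have "\<bar>ln (2 * sin \<theta>)\<bar> \<le> 1"
          using s ln_le_minus_one[of "2 * sin \<theta>"] ln_ge_zero[of "2 * sin \<theta>"] by auto
        moreover have "\<bar>Re (polylog (ones A) (of_real ((1 / (2 * sin \<theta>)) ^ 2)))\<bar> \<le> M"
          by (rule order_trans[OF abs_Re_le_cmod M[OF range[OF that]]])
        ultimately show ?thesis
          unfolding f_def real_norm_def abs_mult power_abs using M0 by (intro mult_mono power_mono) auto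
      qed
    qed
  qed
  finally have "complex_of_real (LBINT \<theta>:{pi/6..pi/2}. rho j (1 / (2 * sin \<theta>)) * ln (2 * sin \<theta>) ^ (k - j)) =
     (\<Sum>A\<in>rho_words j. of_rat (q A) * of_real (LBINT \<theta>:{pi/6..pi/2}. f A \<theta>))"
    by (simp add: of_real_of_rat)
  also have "\<dots> \<in> (*) \<i> ` MPL_space (k + 1) 3"
  proof (intro i_MPL_space_sum i_MPL_space_scale)
    fix A assume A: "A \<in> rho_words j"
    \<comment> \<open>The weights balance: \<open>k - j\<close> from the power of the logarithm, 1
      from d\<theta> and \<open>j\<close> from the word, so every \<open>j\<close> lands in the same
      space.\<close>
    have "k - j + 1 + sum_list A = k + 1" using rho_words_props(3)[OF A] assms by simp
    thus "complex_of_real (LBINT \<theta>:{pi/6..pi/2}. f A \<theta>) \<in> (*) \<i> ` MPL_space (k + 1) 3"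
      using integral_polylog_arc[OF rho_words_props(1,2)[OF A], of "k - j"] unfolding f_def by simp
  qed
  finally show ?thesis .
qed

theorem mainTheorem3:
  fixes k :: nat
  assumes "k \<ge> 1"
  shows "pi * mahler k (1 + laurent_var 1 + laurent_var 2 :: 2 laurent_poly) =
           2 * (LBINT \<theta>:{0..pi/6}. rho k (2 * sin \<theta>)) +
           2 * (\<Sum>j=0..k. real (k choose j) *
             (LBINT \<theta>:{pi/6..pi/2}. rho j (1 / (2 * sin \<theta>)) * (ln (2 * sin \<theta>)) ^ (k - j)))
         \<and> complex_of_real (pi * mahler k (1 + laurent_var 1 + laurent_var 2 :: 2 laurent_poly))
           \<in> (*) \<i> ` MPL_space (k + 1) 3"
proof
  define I where "I = (LBINT \<theta>:{0..pi/6}. rho k (2 * sin \<theta>))"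
  define J where "J j = (LBINT \<theta>:{pi/6..pi/2}. rho j (1 / (2 * sin \<theta>)) * (ln (2 * sin \<theta>)) ^ (k - j))" for j
  show eq: "pi * mahler k (1 + laurent_var 1 + laurent_var 2 :: 2 laurent_poly) =
           2 * (LBINT \<theta>:{0..pi/6}. rho k (2 * sin \<theta>)) +
           2 * (\<Sum>j=0..k. real (k choose j) *
             (LBINT \<theta>:{pi/6..pi/2}. rho j (1 / (2 * sin \<theta>)) * (ln (2 * sin \<theta>)) ^ (k - j)))"
    by (rule pi_mahler_eq)
  have "complex_of_real (pi * mahler k (1 + laurent_var 1 + laurent_var 2 :: 2 laurent_poly)) =
     of_rat 2 * of_real I + of_rat 2 * (\<Sum>j=0..k. of_rat (of_nat (k choose j)) * of_real (J j))"
    unfolding eq I_def[symmetric] J_def[symmetric] by simp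
  also have "\<dots> \<in> (*) \<i> ` MPL_space (k + 1) 3"
    unfolding I_def J_def using assms
    by (intro i_MPL_space_add i_MPL_space_scale i_MPL_space_sum
        integral_rho_small_in_MPL_space integral_rho_large_in_MPL_space) auto
  finally show "complex_of_real (pi * mahler k (1 + laurent_var 1 + laurent_var 2 :: 2 laurent_poly))
           \<in> (*) \<i> ` MPL_space (k + 1) 3" .
qed

end
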